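(* Let $X$ be a topological space and let $1\to\mathcal N\to\mathbf G\xrightarrow{F}\mathbf H\to 1$ be a central extension of gerbes on $X$. Let $j\in\operatorname{Ob}\mathbf H(X)$ be such that the obstruction class $\operatorname{cl}^2_F(j)$ is defined. Then there exists an object $i\in\operatorname{Ob}\mathbf G(X)$ with $\mathbf H(X)(F(i),j)\neq\emptyset$ if and only if $\operatorname{cl}^2_F(j)=1$ in $\check{\mathrm H}^2(X,\mathcal N)$.
   Context: **Gerbes.** A prestack of groupoids $\mathbf G$ on a topological space $X$ is a pseudofunctor $U\mapsto\mathbf G(U)$ from the opposite of the poset of open sets of $X$ to categories, with values in groupoids. The restriction functors are written $i\mapsto i|_V$, and the coherence isomorphisms $(i|_V)|_W\cong i|_W$ are used tacitly. $\mathbf G(U)(i,j)$ is the set of morphisms $i\to j$ in $\mathbf G(U)$. For $i,j\in\operatorname{Ob}\mathbf G(U)$, $\mathbf G(i,j)$ is the presheaf $V\mapsto\mathbf G(V)(i|_V,j|_V)$ on $U$. For objects over different open sets $U,V$, $\mathbf G(i,j)$ denotes the corresponding presheaf on $U\cap V$, and restriction signs are omitted. $\mathbf G$ is a stack if all presheaves $\mathbf G(i,j)$ are sheaves and descent data for objects are effective. A gerbe is a stack of groupoids that is locally nonempty (each $x\in X$ has an open neighborhood $U$ with $\operatorname{Ob}\mathbf G(U)\ne\emptyset$) and locally connected (for $i,j\in\operatorname{Ob}\mathbf G(U)$ and $x\in U$ there is an open $V$ with $x\in V\subset U$ and $\mathbf G(V)(i,j)\neq\emptyset$). Morphisms of gerbes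 are pseudonatural transformations. For $g\in \mathbf G(i,j)(W)$, $\operatorname{Ad}(g)(f)=g\circ f\circ g^{-1}$. A local object is an object of $\mathbf G(U)$ for some open $U\subset X$. **Weak epimorphism.** A morphism of gerbes $F:\mathbf G\to\mathbf H$ is a weak epimorphism if (i) for every open $U$, $j\in\operatorname{Ob}\mathbf H(U)$ and $x\in U$ there are an open $V$ with $x\in V\subset U$, an object $i\in\operatorname{Ob}\mathbf G(V)$ and an isomorphism $F(i)\to j|_V$ in $\mathbf H(V)$; and (ii) for all $i,j\in\operatorname{Ob}\mathbf G(U)$ the map of sheaves $\mathbf G(i,j)\to\mathbf H(F(i),F(j))$ is surjective. **Central extension.** A central extension of gerbes $1\to\mathcal N\to\mathbf G\xrightarrow{F}\mathbf H\to1$ consists of gerbes $\mathbf G,\mathbf H$, a weak epimorphism $F$ such that for every local object $i$ of $\mathbf G$ the sheaf $\operatorname{Ker}(F:\mathbf G(i,i)\to\mathbf H(F(i),F(i)))$ lies in the center of $\mathbf G(i,i)$, and a sheaf of abelian groups $\mathcal N$ on $X$ (written multiplicatively, with unit $1$) together with isomorphisms of sheaves of groups $\chi_i:\mathcal N|_U\to\operatorname{Ker}(\mathbf G(i,i)\to\mathbf H(F(i),F(i)))$ for $i\in\operatorname{Ob}\mathbf G(U)$, satisfying $\operatorname{Ad}(g)\circ\chi_i=\chi_j$ on $W$ for every $g\in\mathbf G(i,j)(W)$. The $\chi_i$ are used to regard $\mathcal N|_U$ as a subsheaf of $\mathbf G(i,i)$. Here the center of a sheaf of groups $\mathcal G$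 is $\mathrm Z(\mathcal G)(U)=\{g\in\mathcal G(U): g|_V\in\mathrm Z(\mathcal G(V))\ \forall V\subset U\}$. **The class $\operatorname{cl}^2_F(j)$.** $\check{\mathrm H}^p(X,\mathcal N)$ is Čech cohomology (the direct limit over open coverings). Write $U_{k_0,\dots,k_m}=U_{k_0}\cap\dots\cap U_{k_m}$. Given $j\in\operatorname{Ob}\mathbf H(X)$, choose an open covering $\{U_k\}_{k\in K}$ of $X$ and, if possible: objects $i_k\in\operatorname{Ob}\mathbf G(U_k)$ and isomorphisms $h_k\in\mathbf H(U_k)(F(i_k),j)$ for all $k\in K$; and then, with $h_{k_0,k_1}:=h_{k_1}^{-1}\circ h_{k_0}\in\mathbf H(U_{k_0,k_1})(F(i_{k_0}),F(i_{k_1}))$, isomorphisms $g_{k_0,k_1}\in\mathbf G(U_{k_0,k_1})(i_{k_0},i_{k_1})$ with $F(g_{k_0,k_1})=h_{k_0,k_1}$ for all $(k_0,k_1)\in K\times K$. Put $g_{k_0,k_1,k_2}:=g_{k_0,k_2}^{-1}\circ g_{k_1,k_2}\circ g_{k_0,k_1}\in\mathbf G(U_{k_0,k_1,k_2})(i_{k_0},i_{k_0})$. These elements lie in $\mathcal N(U_{k_0,k_1,k_2})$ and form a Čech $2$-cocycle $c$. If such choices exist for some open covering, the class $\operatorname{cl}^2_F(j):=[c]\in\check{\mathrm H}^2(X,\mathcal N)$ is said to be defined (it is independent of the choices); otherwise it is undefined. *)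

theory Defs
  imports "HOL-Algebra.Product_Groups" "HOL-Algebra.FiniteProduct" "HOL-Analysis.Abstract_Topology"
begin

section \<open>Groupoids\<close>

record ('o, 'm) cat =
  obj :: "'o set"
  arr :: "'m set"
  src :: "'m \<Rightarrow> 'o"
  tgt :: "'m \<Rightarrow> 'o"
  cmp :: "['m, 'm] \<Rightarrow> 'm"  (infixl "\<star>\<index>" 70)
  ident :: "'o \<Rightarrow> 'm"

definition homset :: "('o, 'm, 'z) cat_scheme \<Rightarrow> 'o \<Rightarrow> 'o \<Rightarrow> 'm set" where
  "homset C i j = {f \<in> arr C. src C f = i \<and> tgt C f = j}"

locale category =
  fixes C :: "('o, 'm, 'z) cat_scheme" (structure)
  assumes src_obj: "f \<in> arr C \<Longrightarrow> src C f \<in> obj C"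
    and tgt_obj: "f \<in> arr C \<Longrightarrow> tgt C f \<in> obj C"
    and cmp_hom: "\<lbrakk>f \<in> homset C i j; g \<in> homset C j k\<rbrakk> \<Longrightarrow> g \<star> f \<in> homset C i k"
    and ident_hom: "i \<in> obj C \<Longrightarrow> ident C i \<in> homset C i i"
    and cmp_assoc:
      "\<lbrakk>f \<in> homset C i j; g \<in> homset C j k; h \<in> homset C k l\<rbrakk>
        \<Longrightarrow> (h \<star> g) \<star> f = h \<star> (g \<star> f)"
    and cmp_ident_left: "f \<in> homset C i j \<Longrightarrow> ident C j \<star> f = f"
    and cmp_ident_right: "f \<in> homset C i j \<Longrightarrow> f \<star> ident C i = f"

locale groupoid = category +
  assumes has_inverse:
    "f \<in> homset C i j \<Longrightarrow>
      \<exists>g \<in> homset C j i. g \<star> f = ident C i \<and> f \<star> g = ident C j"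

definition minv :: "('o, 'm, 'z) cat_scheme \<Rightarrow> 'm \<Rightarrow> 'm" where
  "minv C f = (THE g. g \<in> homset C (tgt C f) (src C f) \<and>
     g \<star>\<^bsub>C\<^esub> f = ident C (src C f) \<and> f \<star>\<^bsub>C\<^esub> g = ident C (tgt C f))"

locale cat_functor =
  fixes C :: "('o, 'm, 'z) cat_scheme" and D :: "('p, 'q, 'y) cat_scheme"
    and Fo :: "'o \<Rightarrow> 'p" and Fa :: "'m \<Rightarrow> 'q"
  assumes fun_obj: "i \<in> obj C \<Longrightarrow> Fo i \<in> obj D"
    and fun_hom: "f \<in> homset C i j \<Longrightarrow> Fa f \<in> homset D (Fo i) (Fo j)"
    and fun_cmp:
      "\<lbrakk>f \<in> homset C i j; g \<in> homset C j k\<rbrakk> \<Longrightarrow> Fa (g \<star>\<^bsub>C\<^esub> f) = Fa g \<star>\<^bsub>D\<^esub> Fa f"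
    and fun_ident: "i \<in> obj C \<Longrightarrow> Fa (ident C i) = ident D (Fo i)"


section \<open>Open coverings and sheaves\<close>

text \<open>
  An open covering of an open set \<open>A\<close> is a family \<open>(U k)\<close> indexed by a set \<open>K\<close>.  Wherever we
  quantify over all coverings of a space with points in \<open>'x\<close>, the indices are drawn from the
  type \<open>'x set\<close>: every set of open sets, indexed by itself, is then such a family, so
  every covering (with whatever index set) has the same members as one of these.
\<close>

definition is_open_cover :: "'x topology \<Rightarrow> 'x set \<Rightarrow> 'k set \<Rightarrow> ('k \<Rightarrow> 'x set) \<Rightarrow> bool" where
  "is_open_cover X A K U \<longleftrightarrow> (\<forall>k\<in>K. openin X (U k)) \<and> (\<Union>k\<in>K. U k) = A"

locale presheaf =
  fixes X :: "'x topology" and S :: "'x set \<Rightarrow> 's set" and r :: "'x set \<Rightarrow> 'x set \<Rightarrow> 's \<Rightarrow> 's"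
  assumes res_sections:
      "\<lbrakk>openin X U; openin X V; V \<subseteq> U; s \<in> S U\<rbrakk> \<Longrightarrow> r U V s \<in> S V"
    and res_self: "\<lbrakk>openin X U; s \<in> S U\<rbrakk> \<Longrightarrow> r U U s = s"
    and res_res:
      "\<lbrakk>openin X U; openin X V; openin X W; W \<subseteq> V; V \<subseteq> U; s \<in> S U\<rbrakk>
        \<Longrightarrow> r V W (r U V s) = r U W s"

locale sheaf = presheaf X S r
  for X :: "'x topology" and S :: "'x set \<Rightarrow> 's set" and r +
  assumes gluing:
    "\<And>A (K :: 'x set set) U s.
      \<lbrakk>openin X A; is_open_cover X A K U; \<And>k. k \<in> K \<Longrightarrow> s k \<in> S (U k);
       \<And>k l. \<lbrakk>k \<in> K; l \<in> K\<rbrakk> \<Longrightarrow> r (U k) (U k \<inter> U l) (s k) = r (U l) (U k \<inter> U l) (s l)\<rbrakk>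
      \<Longrightarrow> \<exists>!t. t \<in> S A \<and> (\<forall>k\<in>K. r A (U k) t = s k)"

text \<open>Surjectivity as a map of sheaves, i.e. local surjectivity.\<close>

definition sheaf_surjective ::
  "'x topology \<Rightarrow> ('x set \<Rightarrow> 's set) \<Rightarrow> ('x set \<Rightarrow> 't set) \<Rightarrow> ('x set \<Rightarrow> 'x set \<Rightarrow> 't \<Rightarrow> 't)
    \<Rightarrow> ('x set \<Rightarrow> 's \<Rightarrow> 't) \<Rightarrow> bool" where
  "sheaf_surjective X S T rT \<phi> \<longleftrightarrow>
     (\<forall>V t x. openin X V \<and> t \<in> T V \<and> x \<in> V \<longrightarrow>
        (\<exists>W s. openin X W \<and> x \<in> W \<and> W \<subseteq> V \<and> s \<in> S W \<and> \<phi> W s = rT V W t))"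

record ('x, 'g) group_presheaf =
  grp :: "'x set \<Rightarrow> 'g monoid"
  gres :: "'x set \<Rightarrow> 'x set \<Rightarrow> 'g \<Rightarrow> 'g"

locale abelian_sheaf =
  fixes X :: "'x topology" and N :: "('x, 'n) group_presheaf"
  assumes is_sheaf: "sheaf X (\<lambda>U. carrier (grp N U)) (gres N)"
    and comm_groups: "openin X U \<Longrightarrow> comm_group (grp N U)"
    and gres_hom:
      "\<lbrakk>openin X U; openin X V; V \<subseteq> U\<rbrakk> \<Longrightarrow> gres N U V \<in> hom (grp N U) (grp N V)"

definition group_center :: "('g, 'z) monoid_scheme \<Rightarrow> 'g set" where
  "group_center A = {z \<in> carrier A. \<forall>a \<in> carrier A. z \<otimes>\<^bsub>A\<^esub> a = a \<otimes>\<^bsub>A\<^esub> z}"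

definition center_sections ::
  "'x topology \<Rightarrow> ('x, 'g) group_presheaf \<Rightarrow> 'x set \<Rightarrow> 'g set" where
  "center_sections X A U =
     {g \<in> carrier (grp A U). \<forall>V. openin X V \<and> V \<subseteq> U \<longrightarrow> gres A U V g \<in> group_center (grp A V)}"

definition group_presheaf_iso ::
  "'x topology \<Rightarrow> ('x, 'g) group_presheaf \<Rightarrow> ('x, 'h) group_presheaf \<Rightarrow> ('x set \<Rightarrow> 'g \<Rightarrow> 'h) \<Rightarrow> bool"
  where
  "group_presheaf_iso X A B \<phi> \<longleftrightarrow>
     (\<forall>U. openin X U \<longrightarrow> \<phi> U \<in> iso (grp A U) (grp B U)) \<and>
     (\<forall>U V a. openin X U \<and> openin X V \<and> V \<subseteq> U \<and> a \<in> carrier (grp A U) \<longrightarrow>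
        \<phi> V (gres A U V a) = gres B U V (\<phi> U a))"


section \<open>Prestacks of groupoids\<close>

text \<open>
  \<open>sect G U\<close> is the category \<open>G(U)\<close>; \<open>rob G U V\<close> and \<open>rarr G U V\<close> are the restriction functor
  from \<open>G(U)\<close> to \<open>G(V)\<close> on objects and morphisms.  The coherence data are
  \<open>coh G U V W i : (i|V)|W \<rightarrow> i|W\<close> for \<open>i\<close> over \<open>U\<close> and \<open>W \<subseteq> V \<subseteq> U\<close>, and \<open>unt G U i : i \<rightarrow> i|U\<close>.
\<close>

record ('x, 'o, 'm) prestack =
  sect :: "'x set \<Rightarrow> ('o, 'm) cat"
  rob :: "'x set \<Rightarrow> 'x set \<Rightarrow> 'o \<Rightarrow> 'o"
  rarr :: "'x set \<Rightarrow> 'x set \<Rightarrow> 'm \<Rightarrow> 'm"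
  coh :: "'x set \<Rightarrow> 'x set \<Rightarrow> 'x set \<Rightarrow> 'o \<Rightarrow> 'm"
  unt :: "'x set \<Rightarrow> 'o \<Rightarrow> 'm"

locale groupoid_prestack =
  fixes X :: "'x topology" and G :: "('x, 'o, 'm) prestack"
  assumes sect_groupoid: "openin X U \<Longrightarrow> groupoid (sect G U)"
    and restriction_functor:
      "\<lbrakk>openin X U; openin X V; V \<subseteq> U\<rbrakk>
        \<Longrightarrow> cat_functor (sect G U) (sect G V) (rob G U V) (rarr G U V)"
    and coh_hom:
      "\<lbrakk>openin X U; openin X V; openin X W; W \<subseteq> V; V \<subseteq> U; i \<in> obj (sect G U)\<rbrakk>
        \<Longrightarrow> coh G U V W i \<in> homset (sect G W) (rob G V W (rob G U V i)) (rob G U W i)"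
    and coh_natural:
      "\<lbrakk>openin X U; openin X V; openin X W; W \<subseteq> V; V \<subseteq> U; f \<in> homset (sect G U) i j\<rbrakk>
        \<Longrightarrow> coh G U V W j \<star>\<^bsub>sect G W\<^esub> rarr G V W (rarr G U V f)
            = rarr G U W f \<star>\<^bsub>sect G W\<^esub> coh G U V W i"
    and coh_assoc:
      "\<lbrakk>openin X U; openin X V; openin X W; openin X Z; Z \<subseteq> W; W \<subseteq> V; V \<subseteq> U;
        i \<in> obj (sect G U)\<rbrakk>
        \<Longrightarrow> coh G U W Z i \<star>\<^bsub>sect G Z\<^esub> rarr G W Z (coh G U V W i)
            = coh G U V Z i \<star>\<^bsub>sect G Z\<^esub> coh G V W Z (rob G U V i)"
    and unt_hom:
      "\<lbrakk>openin X U; i \<in> obj (sect G U)\<rbrakk> \<Longrightarrow> unt G U i \<in> homset (sect G U) i (rob G U U i)"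
    and unt_natural:
      "\<lbrakk>openin X U; f \<in> homset (sect G U) i j\<rbrakk>
        \<Longrightarrow> unt G U j \<star>\<^bsub>sect G U\<^esub> f = rarr G U U f \<star>\<^bsub>sect G U\<^esub> unt G U i"
    and coh_unt_left:
      "\<lbrakk>openin X U; openin X V; V \<subseteq> U; i \<in> obj (sect G U)\<rbrakk>
        \<Longrightarrow> coh G U U V i \<star>\<^bsub>sect G V\<^esub> rarr G U V (unt G U i) = ident (sect G V) (rob G U V i)"
    and coh_unt_right:
      "\<lbrakk>openin X U; openin X V; V \<subseteq> U; i \<in> obj (sect G U)\<rbrakk>
        \<Longrightarrow> coh G U V V i \<star>\<^bsub>sect G V\<^esub> unt G V (rob G U V i) = ident (sect G V) (rob G U V i)"

text \<open>
  For \<open>i\<close> over \<open>U\<close> and \<open>j\<close> over \<open>V\<close>, the presheaf \<open>G(i,j)\<close> on \<open>U \<inter> V\<close>: its sections over \<open>W\<close>,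
  and its restriction maps from \<open>W\<close> to \<open>W'\<close> with the coherence isomorphisms made explicit.
\<close>

definition hom_sect ::
  "('x, 'o, 'm) prestack \<Rightarrow> 'x set \<Rightarrow> 'o \<Rightarrow> 'x set \<Rightarrow> 'o \<Rightarrow> 'x set \<Rightarrow> 'm set" where
  "hom_sect G U i V j W = homset (sect G W) (rob G U W i) (rob G V W j)"

definition hom_res ::
  "('x, 'o, 'm) prestack \<Rightarrow> 'x set \<Rightarrow> 'o \<Rightarrow> 'x set \<Rightarrow> 'o \<Rightarrow> 'x set \<Rightarrow> 'x set \<Rightarrow> 'm \<Rightarrow> 'm" where
  "hom_res G U i V j W W' f =
     coh G V W W' j \<star>\<^bsub>sect G W'\<^esub> rarr G W W' f \<star>\<^bsub>sect G W'\<^esub> minv (sect G W') (coh G U W W' i)"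

definition aut_presheaf ::
  "('x, 'o, 'm) prestack \<Rightarrow> 'x set \<Rightarrow> 'o \<Rightarrow> ('x, 'm) group_presheaf" where
  "aut_presheaf G U i =
     \<lparr>grp = (\<lambda>W. \<lparr>carrier = hom_sect G U i U i W, monoid.mult = cmp (sect G W),
                   one = ident (sect G W) (rob G U W i)\<rparr>),
      gres = hom_res G U i U i\<rparr>"

text \<open>
  A descent datum for a covering \<open>(U k)\<close> of \<open>A\<close>, and its effectiveness.  In the latter,
  \<open>f k\<close> is restricted to \<open>U k \<inter> U l\<close> and \<open>(a|U k)|(U k \<inter> U l)\<close> is identified with \<open>a|(U k \<inter> U l)\<close>.
\<close>

definition descent_datum ::
  "('x, 'o, 'm) prestack \<Rightarrow> 'k set \<Rightarrow> ('k \<Rightarrow> 'x set) \<Rightarrow> ('k \<Rightarrow> 'o) \<Rightarrow> ('k \<Rightarrow> 'k \<Rightarrow> 'm) \<Rightarrow> bool" where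
  "descent_datum G K U i g \<longleftrightarrow>
     (\<forall>k\<in>K. i k \<in> obj (sect G (U k))) \<and>
     (\<forall>k\<in>K. \<forall>l\<in>K. g k l \<in> hom_sect G (U k) (i k) (U l) (i l) (U k \<inter> U l)) \<and>
     (\<forall>k\<in>K. \<forall>l\<in>K. \<forall>m\<in>K. let W = U k \<inter> U l \<inter> U m in
        hom_res G (U l) (i l) (U m) (i m) (U l \<inter> U m) W (g l m) \<star>\<^bsub>sect G W\<^esub>
        hom_res G (U k) (i k) (U l) (i l) (U k \<inter> U l) W (g k l)
        = hom_res G (U k) (i k) (U m) (i m) (U k \<inter> U m) W (g k m))"

definition effective_descent ::
  "('x, 'o, 'm) prestack \<Rightarrow> 'x set \<Rightarrow> 'k set \<Rightarrow> ('k \<Rightarrow> 'x set) \<Rightarrow> ('k \<Rightarrow> 'o) \<Rightarrow> ('k \<Rightarrow> 'k \<Rightarrow> 'm) \<Rightarrow> bool"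
  where
  "effective_descent G A K U i g \<longleftrightarrow>
     (\<exists>a f. a \<in> obj (sect G A) \<and>
        (\<forall>k\<in>K. f k \<in> homset (sect G (U k)) (rob G A (U k) a) (i k)) \<and>
        (\<forall>k\<in>K. \<forall>l\<in>K. let W = U k \<inter> U l in
           g k l \<star>\<^bsub>sect G W\<^esub>
             (rarr G (U k) W (f k) \<star>\<^bsub>sect G W\<^esub> minv (sect G W) (coh G A (U k) W a))
           = rarr G (U l) W (f l) \<star>\<^bsub>sect G W\<^esub> minv (sect G W) (coh G A (U l) W a)))"

text \<open>For open \<open>U\<close>, the open sets of \<open>subtopology X U\<close> are the open sets of \<open>X\<close> inside \<open>U\<close>.\<close>

locale groupoid_stack = groupoid_prestack X G
  for X :: "'x topology" and G :: "('x, 'o, 'm) prestack" +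
  assumes hom_sheaf:
      "\<lbrakk>openin X U; i \<in> obj (sect G U); j \<in> obj (sect G U)\<rbrakk>
        \<Longrightarrow> sheaf (subtopology X U) (hom_sect G U i U j) (hom_res G U i U j)"
    and descent_effective:
      "\<And>A (K :: 'x set set) U i g.
        \<lbrakk>openin X A; is_open_cover X A K U; descent_datum G K U i g\<rbrakk>
        \<Longrightarrow> effective_descent G A K U i g"

locale gerbe = groupoid_stack X G
  for X :: "'x topology" and G :: "('x, 'o, 'm) prestack" +
  assumes locally_nonempty:
      "x \<in> topspace X \<Longrightarrow> \<exists>U. openin X U \<and> x \<in> U \<and> obj (sect G U) \<noteq> {}"
    and locally_connected:
      "\<lbrakk>openin X U; i \<in> obj (sect G U); j \<in> obj (sect G U); x \<in> U\<rbrakk>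
        \<Longrightarrow> \<exists>V. openin X V \<and> x \<in> V \<and> V \<subseteq> U \<and> hom_sect G U i U j V \<noteq> {}"


section \<open>Morphisms and central extensions of gerbes\<close>

text \<open>
  A pseudonatural transformation: functors \<open>mob F U\<close>, \<open>marr F U\<close> from \<open>G(U)\<close> to \<open>H(U)\<close> with
  isomorphisms \<open>mnat F U V i : F(i)|V \<rightarrow> F(i|V)\<close> for \<open>i\<close> over \<open>U\<close>.
\<close>

record ('x, 'o, 'm, 'p, 'q) prestack_mor =
  mob :: "'x set \<Rightarrow> 'o \<Rightarrow> 'p"
  marr :: "'x set \<Rightarrow> 'm \<Rightarrow> 'q"
  mnat :: "'x set \<Rightarrow> 'x set \<Rightarrow> 'o \<Rightarrow> 'q"

locale pseudonatural =
  fixes X :: "'x topology" and G :: "('x, 'o, 'm) prestack" and H :: "('x, 'p, 'q) prestack"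
    and F :: "('x, 'o, 'm, 'p, 'q) prestack_mor"
  assumes mor_functor:
      "openin X U \<Longrightarrow> cat_functor (sect G U) (sect H U) (mob F U) (marr F U)"
    and mnat_hom:
      "\<lbrakk>openin X U; openin X V; V \<subseteq> U; i \<in> obj (sect G U)\<rbrakk>
        \<Longrightarrow> mnat F U V i \<in> homset (sect H V) (rob H U V (mob F U i)) (mob F V (rob G U V i))"
    and mnat_natural:
      "\<lbrakk>openin X U; openin X V; V \<subseteq> U; f \<in> homset (sect G U) i j\<rbrakk>
        \<Longrightarrow> mnat F U V j \<star>\<^bsub>sect H V\<^esub> rarr H U V (marr F U f)
            = marr F V (rarr G U V f) \<star>\<^bsub>sect H V\<^esub> mnat F U V i"
    and mnat_coh:
      "\<lbrakk>openin X U; openin X V; openin X W; W \<subseteq> V; V \<subseteq> U; i \<in> obj (sect G U)\<rbrakk>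
        \<Longrightarrow> mnat F U W i \<star>\<^bsub>sect H W\<^esub> coh H U V W (mob F U i)
            = marr F W (coh G U V W i) \<star>\<^bsub>sect H W\<^esub> mnat F V W (rob G U V i)
                \<star>\<^bsub>sect H W\<^esub> rarr H V W (mnat F U V i)"
    and mnat_unt:
      "\<lbrakk>openin X U; i \<in> obj (sect G U)\<rbrakk>
        \<Longrightarrow> mnat F U U i \<star>\<^bsub>sect H U\<^esub> unt H U (mob F U i) = marr F U (unt G U i)"

text \<open>
  The map \<open>G(i,j) \<rightarrow> H(F(i),F(j))\<close> on sections over \<open>W\<close>, for \<open>i\<close> over \<open>U\<close> and \<open>j\<close> over \<open>V\<close>.
\<close>

definition hom_map ::
  "('x, 'p, 'q) prestack \<Rightarrow> ('x, 'o, 'm, 'p, 'q) prestack_mor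
    \<Rightarrow> 'x set \<Rightarrow> 'o \<Rightarrow> 'x set \<Rightarrow> 'o \<Rightarrow> 'x set \<Rightarrow> 'm \<Rightarrow> 'q" where
  "hom_map H F U i V j W f =
     minv (sect H W) (mnat F V W j) \<star>\<^bsub>sect H W\<^esub> marr F W f \<star>\<^bsub>sect H W\<^esub> mnat F U W i"

definition weak_epimorphism ::
  "'x topology \<Rightarrow> ('x, 'o, 'm) prestack \<Rightarrow> ('x, 'p, 'q) prestack
    \<Rightarrow> ('x, 'o, 'm, 'p, 'q) prestack_mor \<Rightarrow> bool" where
  "weak_epimorphism X G H F \<longleftrightarrow>
     (\<forall>U j x. openin X U \<and> j \<in> obj (sect H U) \<and> x \<in> U \<longrightarrow>
        (\<exists>V i. openin X V \<and> x \<in> V \<and> V \<subseteq> U \<and> i \<in> obj (sect G V) \<and>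
           homset (sect H V) (mob F V i) (rob H U V j) \<noteq> {})) \<and>
     (\<forall>U i j. openin X U \<and> i \<in> obj (sect G U) \<and> j \<in> obj (sect G U) \<longrightarrow>
        sheaf_surjective (subtopology X U) (hom_sect G U i U j)
          (hom_sect H U (mob F U i) U (mob F U j)) (hom_res H U (mob F U i) U (mob F U j))
          (hom_map H F U i U j))"

definition kernel_sections ::
  "('x, 'o, 'm) prestack \<Rightarrow> ('x, 'p, 'q) prestack \<Rightarrow> ('x, 'o, 'm, 'p, 'q) prestack_mor
    \<Rightarrow> 'x set \<Rightarrow> 'o \<Rightarrow> 'x set \<Rightarrow> 'm set" where
  "kernel_sections G H F U i W =
     kernel (grp (aut_presheaf G U i) W) (grp (aut_presheaf H U (mob F U i)) W)
       (hom_map H F U i U i W)"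

definition kernel_presheaf ::
  "('x, 'o, 'm) prestack \<Rightarrow> ('x, 'p, 'q) prestack \<Rightarrow> ('x, 'o, 'm, 'p, 'q) prestack_mor
    \<Rightarrow> 'x set \<Rightarrow> 'o \<Rightarrow> ('x, 'm) group_presheaf" where
  "kernel_presheaf G H F U i =
     \<lparr>grp = (\<lambda>W. (grp (aut_presheaf G U i) W)\<lparr>carrier := kernel_sections G H F U i W\<rparr>),
      gres = gres (aut_presheaf G U i)\<rparr>"

text \<open>
  \<open>\<chi> U i\<close> is the isomorphism from \<open>N|U\<close> to the kernel sheaf of \<open>i\<close> over \<open>U\<close>.  The last axiom is
  \<open>Ad(g) \<circ> \<chi>\<^sub>i = \<chi>\<^sub>j\<close> on \<open>W\<close>, for local objects \<open>i\<close>, \<open>j\<close> over possibly different open sets.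
\<close>

locale central_extension =
  fixes X :: "'x topology" and N :: "('x, 'n) group_presheaf"
    and G :: "('x, 'o, 'm) prestack" and H :: "('x, 'p, 'q) prestack"
    and F :: "('x, 'o, 'm, 'p, 'q) prestack_mor"
    and \<chi> :: "'x set \<Rightarrow> 'o \<Rightarrow> 'x set \<Rightarrow> 'n \<Rightarrow> 'm"
  assumes gerbe_G: "gerbe X G"
    and gerbe_H: "gerbe X H"
    and morphism_F: "pseudonatural X G H F"
    and weak_epi_F: "weak_epimorphism X G H F"
    and kernel_central:
      "\<lbrakk>openin X U; i \<in> obj (sect G U); openin X V; V \<subseteq> U\<rbrakk>
        \<Longrightarrow> kernel_sections G H F U i V \<subseteq> center_sections (subtopology X U) (aut_presheaf G U i) V"
    and abelian_N: "abelian_sheaf X N"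
    and \<chi>_iso:
      "\<lbrakk>openin X U; i \<in> obj (sect G U)\<rbrakk>
        \<Longrightarrow> group_presheaf_iso (subtopology X U) N (kernel_presheaf G H F U i) (\<chi> U i)"
    and Ad_\<chi>:
      "\<lbrakk>openin X U; openin X V; i \<in> obj (sect G U); j \<in> obj (sect G V);
        openin X W; W \<subseteq> U \<inter> V; g \<in> hom_sect G U i V j W;
        openin X W'; W' \<subseteq> W; n \<in> carrier (grp N W'); g' = hom_res G U i V j W W' g\<rbrakk>
        \<Longrightarrow> g' \<star>\<^bsub>sect G W'\<^esub> \<chi> U i W' n \<star>\<^bsub>sect G W'\<^esub> minv (sect G W') g' = \<chi> V j W' n"


section \<open>Cech cohomology\<close>

text \<open>
  A \<open>p\<close>-cochain for the covering \<open>(K, U)\<close> is a family indexed by the lists \<open>[k\<^sub>0, \<dots>, k\<^sub>p]\<close> over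
  \<open>K\<close>, with values in \<open>N\<close> over the intersection of the sets \<open>U k\<^sub>0\<close>, \dots, \<open>U k\<^sub>p\<close>.
\<close>

definition cech_open :: "('k \<Rightarrow> 'x set) \<Rightarrow> 'k list \<Rightarrow> 'x set" where
  "cech_open U ks = (\<Inter>k\<in>set ks. U k)"

definition simplices :: "'k set \<Rightarrow> nat \<Rightarrow> 'k list set" where
  "simplices K p = {ks. set ks \<subseteq> K \<and> length ks = Suc p}"

definition face :: "nat \<Rightarrow> 'k list \<Rightarrow> 'k list" where
  "face m ks = take m ks @ drop (Suc m) ks"

type_synonym ('k, 'x) cover = "'k set \<times> ('k \<Rightarrow> 'x set)"

definition cech_cochains ::
  "('x, 'n) group_presheaf \<Rightarrow> ('k, 'x) cover \<Rightarrow> nat \<Rightarrow> ('k list \<Rightarrow> 'n) monoid" where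
  "cech_cochains N C p =
     product_group (simplices (fst C) p) (\<lambda>ks. grp N (cech_open (snd C) ks))"

definition cech_d ::
  "('x, 'n) group_presheaf \<Rightarrow> ('k, 'x) cover \<Rightarrow> nat \<Rightarrow> ('k list \<Rightarrow> 'n) \<Rightarrow> 'k list \<Rightarrow> 'n" where
  "cech_d N C p c =
     (\<lambda>ks \<in> simplices (fst C) (Suc p).
        finprod (grp N (cech_open (snd C) ks))
          (\<lambda>m. let a = gres N (cech_open (snd C) (face m ks)) (cech_open (snd C) ks) (c (face m ks))
               in if even m then a else inv\<^bsub>grp N (cech_open (snd C) ks)\<^esub> a)
          {..Suc p})"

definition cech_cocycles ::
  "('x, 'n) group_presheaf \<Rightarrow> ('k, 'x) cover \<Rightarrow> nat \<Rightarrow> ('k list \<Rightarrow> 'n) set" where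
  "cech_cocycles N C p = kernel (cech_cochains N C p) (cech_cochains N C (Suc p)) (cech_d N C p)"

fun cech_coboundaries ::
  "('x, 'n) group_presheaf \<Rightarrow> ('k, 'x) cover \<Rightarrow> nat \<Rightarrow> ('k list \<Rightarrow> 'n) set" where
  "cech_coboundaries N C 0 = {\<one>\<^bsub>cech_cochains N C 0\<^esub>}"
| "cech_coboundaries N C (Suc p) = cech_d N C p ` carrier (cech_cochains N C p)"

definition refines_via :: "('l, 'x) cover \<Rightarrow> ('k, 'x) cover \<Rightarrow> ('l \<Rightarrow> 'k) \<Rightarrow> bool" where
  "refines_via D C \<tau> \<longleftrightarrow> (\<forall>l \<in> fst D. \<tau> l \<in> fst C \<and> snd D l \<subseteq> snd C (\<tau> l))"

definition cech_pullback ::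
  "('x, 'n) group_presheaf \<Rightarrow> ('l, 'x) cover \<Rightarrow> ('k, 'x) cover \<Rightarrow> ('l \<Rightarrow> 'k) \<Rightarrow> nat
    \<Rightarrow> ('k list \<Rightarrow> 'n) \<Rightarrow> 'l list \<Rightarrow> 'n" where
  "cech_pullback N D C \<tau> p c =
     (\<lambda>ls \<in> simplices (fst D) p.
        gres N (cech_open (snd C) (map \<tau> ls)) (cech_open (snd D) ls) (c (map \<tau> ls)))"

text \<open>
  The direct limit over the open coverings of \<open>X\<close>, preordered by refinement, is the set of pairs
  of a covering and a cocycle for it, modulo the relation of becoming cohomologous
  on a common refinement.
\<close>

definition cech_pairs ::
  "'x topology \<Rightarrow> ('x, 'n) group_presheaf \<Rightarrow> nat
    \<Rightarrow> (('x set, 'x) cover \<times> ('x set list \<Rightarrow> 'n)) set" where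
  "cech_pairs X N p =
     {(C, c). is_open_cover X (topspace X) (fst C) (snd C) \<and> c \<in> cech_cocycles N C p}"

definition cech_rel ::
  "'x topology \<Rightarrow> ('x, 'n) group_presheaf \<Rightarrow> nat
    \<Rightarrow> (('x set, 'x) cover \<times> ('x set list \<Rightarrow> 'n)) rel" where
  "cech_rel X N p =
     {((C, c), (D, d)). (C, c) \<in> cech_pairs X N p \<and> (D, d) \<in> cech_pairs X N p \<and>
        (\<exists>(E :: ('x set, 'x) cover) \<tau> \<sigma>. is_open_cover X (topspace X) (fst E) (snd E) \<and>
           refines_via E C \<tau> \<and> refines_via E D \<sigma> \<and>
           (\<exists>b \<in> cech_coboundaries N E p.
              cech_pullback N E C \<tau> p c = b \<otimes>\<^bsub>cech_cochains N E p\<^esub> cech_pullback N E D \<sigma> p d))}"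

definition cech_class ::
  "'x topology \<Rightarrow> ('x, 'n) group_presheaf \<Rightarrow> nat \<Rightarrow> ('x set, 'x) cover \<Rightarrow> ('x set list \<Rightarrow> 'n)
    \<Rightarrow> (('x set, 'x) cover \<times> ('x set list \<Rightarrow> 'n)) set" where
  "cech_class X N p C c = cech_rel X N p `` {(C, c)}"

text \<open>
  Two classes are multiplied by choosing representatives on the same covering; the unit is the
  class of the trivial cocycle for the covering of \<open>X\<close> by itself.
\<close>

definition cech_cohomology ::
  "'x topology \<Rightarrow> ('x, 'n) group_presheaf \<Rightarrow> nat
    \<Rightarrow> (('x set, 'x) cover \<times> ('x set list \<Rightarrow> 'n)) set monoid" where
  "cech_cohomology X N p =
     \<lparr>carrier = cech_pairs X N p // cech_rel X N p,
      monoid.mult = (\<lambda>A B. \<Union> {cech_class X N p C (c \<otimes>\<^bsub>cech_cochains N C p\<^esub> d) | C c d.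
                            (C, c) \<in> A \<and> (C, d) \<in> B}),
      one = (let C = ({topspace X}, \<lambda>k. k)
             in cech_class X N p C \<one>\<^bsub>cech_cochains N C p\<^esub>)\<rparr>"


section \<open>The obstruction class\<close>

text \<open>
  \<open>h k\<close>, restricted to \<open>W \<subseteq> U k\<close> and regarded as a morphism \<open>F(i\<^sub>k)|W \<rightarrow> j|W\<close>.
\<close>

definition obs_h_res ::
  "'x topology \<Rightarrow> ('x, 'p, 'q) prestack \<Rightarrow> 'p \<Rightarrow> ('k \<Rightarrow> 'x set) \<Rightarrow> ('k \<Rightarrow> 'q) \<Rightarrow> 'k \<Rightarrow> 'x set \<Rightarrow> 'q"
  where
  "obs_h_res X H j U h k W =
     coh H (topspace X) (U k) W j \<star>\<^bsub>sect H W\<^esub> rarr H (U k) W (h k)"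

definition obs_choice ::
  "'x topology \<Rightarrow> ('x, 'o, 'm) prestack \<Rightarrow> ('x, 'p, 'q) prestack
    \<Rightarrow> ('x, 'o, 'm, 'p, 'q) prestack_mor \<Rightarrow> 'p \<Rightarrow> 'k set \<Rightarrow> ('k \<Rightarrow> 'x set)
    \<Rightarrow> ('k \<Rightarrow> 'o) \<Rightarrow> ('k \<Rightarrow> 'q) \<Rightarrow> ('k \<Rightarrow> 'k \<Rightarrow> 'm) \<Rightarrow> bool" where
  "obs_choice X G H F j K U i h g \<longleftrightarrow>
     is_open_cover X (topspace X) K U \<and>
     (\<forall>k\<in>K. i k \<in> obj (sect G (U k)) \<and>
        h k \<in> homset (sect H (U k)) (mob F (U k) (i k)) (rob H (topspace X) (U k) j)) \<and>
     (\<forall>k\<in>K. \<forall>l\<in>K. let W = U k \<inter> U l in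
        g k l \<in> hom_sect G (U k) (i k) (U l) (i l) W \<and>
        hom_map H F (U k) (i k) (U l) (i l) W (g k l)
          = minv (sect H W) (obs_h_res X H j U h l W) \<star>\<^bsub>sect H W\<^esub> obs_h_res X H j U h k W)"

definition obs_g3 ::
  "('x, 'o, 'm) prestack \<Rightarrow> ('k \<Rightarrow> 'x set) \<Rightarrow> ('k \<Rightarrow> 'o) \<Rightarrow> ('k \<Rightarrow> 'k \<Rightarrow> 'm) \<Rightarrow> 'k \<Rightarrow> 'k \<Rightarrow> 'k \<Rightarrow> 'm"
  where
  "obs_g3 G U i g k0 k1 k2 =
     (let W = U k0 \<inter> U k1 \<inter> U k2;
          r = (\<lambda>k l. hom_res G (U k) (i k) (U l) (i l) (U k \<inter> U l) W (g k l))
      in minv (sect G W) (r k0 k2) \<star>\<^bsub>sect G W\<^esub> r k1 k2 \<star>\<^bsub>sect G W\<^esub> r k0 k1)"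

text \<open>The element of \<open>N\<close> that \<open>\<chi>\<close> identifies with \<open>obs_g3\<close>.\<close>

definition obs_cocycle ::
  "('x, 'n) group_presheaf \<Rightarrow> ('x, 'o, 'm) prestack \<Rightarrow> ('x set \<Rightarrow> 'o \<Rightarrow> 'x set \<Rightarrow> 'n \<Rightarrow> 'm)
    \<Rightarrow> 'k set \<Rightarrow> ('k \<Rightarrow> 'x set) \<Rightarrow> ('k \<Rightarrow> 'o) \<Rightarrow> ('k \<Rightarrow> 'k \<Rightarrow> 'm) \<Rightarrow> 'k list \<Rightarrow> 'n" where
  "obs_cocycle N G \<chi> K U i g =
     (\<lambda>ks \<in> simplices K 2.
        inv_into (carrier (grp N (cech_open U ks))) (\<chi> (U (ks ! 0)) (i (ks ! 0)) (cech_open U ks))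
          (obs_g3 G U i g (ks ! 0) (ks ! 1) (ks ! 2)))"

definition cl2_defined ::
  "'x topology \<Rightarrow> ('x, 'o, 'm) prestack \<Rightarrow> ('x, 'p, 'q) prestack
    \<Rightarrow> ('x, 'o, 'm, 'p, 'q) prestack_mor \<Rightarrow> 'p \<Rightarrow> bool" where
  "cl2_defined X G H F j \<longleftrightarrow> (\<exists>(K :: 'x set set) U i h g. obs_choice X G H F j K U i h g)"

text \<open>
  The class does not depend on the choices for a central extension, so any choice may be
  selected.  It is meaningful only when \<open>cl2_defined\<close> holds.
\<close>

definition cl2 ::
  "'x topology \<Rightarrow> ('x, 'n) group_presheaf \<Rightarrow> ('x, 'o, 'm) prestack \<Rightarrow> ('x, 'p, 'q) prestack
    \<Rightarrow> ('x, 'o, 'm, 'p, 'q) prestack_mor \<Rightarrow> ('x set \<Rightarrow> 'o \<Rightarrow> 'x set \<Rightarrow> 'n \<Rightarrow> 'm) \<Rightarrow> 'p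
    \<Rightarrow> (('x set, 'x) cover \<times> ('x set list \<Rightarrow> 'n)) set" where
  "cl2 X N G H F \<chi> j =
     (SOME a. \<exists>(K :: 'x set set) U i h g. obs_choice X G H F j K U i h g \<and>
        a = cech_class X N 2 (K, U) (obs_cocycle N G \<chi> K U i g))"

end

theory Submission
  imports Defs
begin

text \<open>
  Regarding a local object \<open>i\<close> over \<open>U\<close> as an object over every open \<open>W \<subseteq> U\<close>, the sheaves \<open>G(i,j)\<close>
  with their restriction maps make the coherence isomorphisms disappear: composition, inverses and
  the maps induced by \<open>F\<close> commute strictly with restriction.  The cocycle \<open>c\<close> is then characterised
  by \<open>g\<^sub>l\<^sub>m g\<^sub>k\<^sub>l = g\<^sub>k\<^sub>m c\<^sub>k\<^sub>l\<^sub>m\<close>.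

  If \<open>c\<close> becomes the coboundary of \<open>a\<close> on a refinement, the morphisms \<open>g\<^sub>k\<^sub>l a\<^sub>k\<^sub>l\<^sup>-\<^sup>1\<close> form a descent
  datum; the object it defines carries local isomorphisms \<open>h\<^sub>k F(f\<^sub>k)\<close> to \<open>j\<close>, which agree on overlaps
  because \<open>F\<close> kills \<open>a\<close>, and hence glue.  Conversely, given \<open>\<phi> : F(e) \<rightarrow> j\<close>, weak epimorphy lifts
  \<open>h\<^sub>k\<^sup>-\<^sup>1 \<phi>\<close> locally to \<open>f\<^sub>k : e \<rightarrow> i\<^sub>k\<close>, and the differences \<open>b\<^sub>k\<^sub>l = f\<^sub>k f\<^sub>l\<^sup>-\<^sup>1 g\<^sub>k\<^sub>l\<close> lie in \<open>N\<close> and have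
  coboundary \<open>c\<close>.
\<close>

text \<open>Two difficulties shape the proof. The first is coherence. Descent is available only for
  objects over the members of the covering, and weak epimorphy only for two objects over the same
  open set, whereas after a refinement the objects \<open>i k\<close> live over larger sets than
  those on which one works. Both facts are therefore transported, by conjugation with coherence
  isomorphisms, to sections of \<open>hom_sect\<close> between objects over arbitrary larger open
  sets; this gives \<open>descent\<close> and \<open>lift_locally\<close>. The second is equality of
  classes. A class is the image of one pair under \<open>cech_rel\<close>, so being the unit is an
  equality of sets. It yields one refinement on which the cocycle is a coboundary; conversely it
  follows from a trivializing refinement below every given refinement, which a global object
  supplies because morphisms can be lifted locally on any covering. Centrality is used as a rule of
  motion: a section of \<open>N\<close> passes through any morphism of \<open>G\<close>, from its
  copy at the source to its copy at the target. Since \<open>cl2\<close> selects some admissible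
  choice, the equivalence is proved for an arbitrary one.\<close>

section \<open>Groupoids\<close>

context groupoid
begin

lemma arr_homset: "f \<in> arr C \<Longrightarrow> f \<in> homset C (src C f) (tgt C f)"
  by (simp add: homset_def)

text \<open>The axioms refer to intermediate objects through \<open>homset\<close> premises, which a
  rewriting step would have to guess. With \<open>src\<close> and \<open>tgt\<close> as functions,
  composability becomes an equation that simplification can check; the next lemmas are restated for
  the same reason.\<close>

lemma cmp_arr:
  assumes "f \<in> arr C" "g \<in> arr C" "src C g = tgt C f"
  shows "g \<star> f \<in> arr C" "src C (g \<star> f) = src C f" "tgt C (g \<star> f) = tgt C g"
  using cmp_hom[of f "src C f" "tgt C f" g "tgt C g"] assms by (auto simp: homset_def)

lemma assoc:
  assumes "f \<in> arr C" "g \<in> arr C" "h \<in> arr C" "src C g = tgt C f" "src C h = tgt C g"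
  shows "(h \<star> g) \<star> f = h \<star> (g \<star> f)"
  using cmp_assoc[of f "src C f" "tgt C f" g "tgt C g" h "tgt C h"] assms by (auto simp: homset_def)

lemma ident_arr:
  assumes "i \<in> obj C"
  shows "ident C i \<in> arr C" "src C (ident C i) = i" "tgt C (ident C i) = i"
  using ident_hom[OF assms] by (auto simp: homset_def)

lemma ident_left: "\<lbrakk>f \<in> arr C; tgt C f = i\<rbrakk> \<Longrightarrow> ident C i \<star> f = f"
  using cmp_ident_left[of f "src C f" i] by (auto simp: homset_def)

lemma ident_right: "\<lbrakk>f \<in> arr C; src C f = i\<rbrakk> \<Longrightarrow> f \<star> ident C i = f"
  using cmp_ident_right[of f i "tgt C f"] by (auto simp: homset_def)

text \<open>Justifies the \<open>THE\<close> in \<open>minv\<close>: two inverses \<open>g'\<close>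
  and \<open>g\<close> of \<open>f\<close> agree because
  \<open>g' = g' \<star> (f \<star> g) = (g' \<star> f) \<star> g = g\<close>.\<close>

lemma minv_props:
  assumes "f \<in> arr C"
  shows "minv C f \<in> homset C (tgt C f) (src C f) \<and>
    minv C f \<star> f = ident C (src C f) \<and> f \<star> minv C f = ident C (tgt C f)"
  unfolding minv_def
proof (rule theI')
  let ?P = "\<lambda>g. g \<in> homset C (tgt C f) (src C f) \<and>
    g \<star> f = ident C (src C f) \<and> f \<star> g = ident C (tgt C f)"
  have f: "f \<in> homset C (src C f) (tgt C f)" using assms by (rule arr_homset)
  then obtain g where g: "?P g" using has_inverse by blast
  moreover have "g' = g" if g': "?P g'" for g'
  proof -
    have "g' = g' \<star> (f \<star> g)" using g' g cmp_ident_right[of g' "tgt C f" "src C f"] by simp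
    also have "\<dots> = (g' \<star> f) \<star> g" by (rule cmp_assoc[symmetric]) (use g' g f in blast)+
    also have "\<dots> = g" using g' g cmp_ident_left[of g "tgt C f" "src C f"] by simp
    finally show ?thesis .
  qed
  ultimately show "\<exists>!g. ?P g" by blast
qed

lemma minv_arr:
  assumes "f \<in> arr C"
  shows "minv C f \<in> arr C" "src C (minv C f) = tgt C f" "tgt C (minv C f) = src C f"
  using minv_props[OF assms] by (auto simp: homset_def)

lemma minv_left: "\<lbrakk>f \<in> arr C\<rbrakk> \<Longrightarrow> minv C f \<star> f = ident C (src C f)"
  and minv_right: "\<lbrakk>f \<in> arr C\<rbrakk> \<Longrightarrow> f \<star> minv C f = ident C (tgt C f)"
  using minv_props[of f] by auto

text \<open>In a right-nested composite an inverse pair followed by a tail is not a subterm, so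
  \<open>minv_left\<close> and \<open>minv_right\<close> cannot reach it. These are the versions
  with the tail \<open>x\<close>.\<close>

lemma minv_cancel:
  assumes "f \<in> arr C" "x \<in> arr C"
  shows "tgt C x = src C f \<Longrightarrow> minv C f \<star> (f \<star> x) = x"
    and "tgt C x = tgt C f \<Longrightarrow> f \<star> (minv C f \<star> x) = x"
proof -
  assume *: "tgt C x = src C f"
  have "minv C f \<star> (f \<star> x) = (minv C f \<star> f) \<star> x"
    by (rule assoc[symmetric]) (use assms * in \<open>simp_all add: minv_arr\<close>)
  then show "minv C f \<star> (f \<star> x) = x"
    using assms * by (simp add: minv_left ident_left)
next
  assume *: "tgt C x = tgt C f"
  have "f \<star> (minv C f \<star> x) = (f \<star> minv C f) \<star> x"
    by (rule assoc[symmetric]) (use assms * in \<open>simp_all add: minv_arr\<close>)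
  then show "f \<star> (minv C f \<star> x) = x"
    using assms * by (simp add: minv_right ident_left)
qed

lemma left_cancel:
  assumes "f \<in> arr C" "x \<in> arr C" "y \<in> arr C" "tgt C x = src C f" "tgt C y = src C f"
    and "f \<star> x = f \<star> y"
  shows "x = y"
proof -
  have "x = minv C f \<star> (f \<star> x)" "y = minv C f \<star> (f \<star> y)"
    using assms(1-5) by (simp_all add: minv_cancel)
  then show ?thesis using assms(6) by simp
qed

lemma right_cancel:
  assumes "f \<in> arr C" "x \<in> arr C" "y \<in> arr C" "src C x = tgt C f" "src C y = tgt C f"
    and "x \<star> f = y \<star> f"
  shows "x = y"
proof -
  have "x = (x \<star> f) \<star> minv C f" "y = (y \<star> f) \<star> minv C f"
    using assms(1-5) by (auto simp: assoc minv_arr minv_right ident_right)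
  then show ?thesis using assms(6) by simp
qed

lemma minv_unique:
  assumes "f \<in> arr C" "g \<in> arr C" "src C g = tgt C f" "g \<star> f = ident C (src C f)"
  shows "minv C f = g"
  by (rule right_cancel[of f]) (use assms in \<open>auto simp: minv_arr minv_left\<close>)

lemma minv_minv: "f \<in> arr C \<Longrightarrow> minv C (minv C f) = f"
  by (rule minv_unique) (auto simp: minv_arr minv_right)

lemma minv_ident: "i \<in> obj C \<Longrightarrow> minv C (ident C i) = ident C i"
  by (rule minv_unique) (auto simp: ident_arr ident_left)

lemma minv_cmp:
  assumes "f \<in> arr C" "g \<in> arr C" "src C g = tgt C f"
  shows "minv C (g \<star> f) = minv C f \<star> minv C g"
  by (rule minv_unique)
    (use assms in \<open>auto simp: minv_arr cmp_arr assoc minv_cancel minv_left\<close>)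

text \<open>As rewrite rules these nest composites to the right, push inverses down to single
  factors and cancel neighbouring inverse pairs. Most equations between composites below are settled
  by comparing the resulting words.\<close>

lemmas simps = src_obj tgt_obj cmp_arr assoc ident_arr ident_left ident_right minv_arr minv_left
  minv_right minv_cancel minv_minv minv_ident minv_cmp

end

locale groupoid_functor = cat_functor C D Fo Fa + C: groupoid C + D: groupoid D
  for C :: "('o, 'm, 'z) cat_scheme" and D :: "('p, 'q, 'y) cat_scheme" and Fo Fa
begin

lemma functor_arr:
  assumes "f \<in> arr C"
  shows "Fa f \<in> arr D" "src D (Fa f) = Fo (src C f)" "tgt D (Fa f) = Fo (tgt C f)"
  using fun_hom[OF C.arr_homset[OF assms]] by (auto simp: homset_def)

lemma functor_cmp:
  assumes "f \<in> arr C" "g \<in> arr C" "src C g = tgt C f"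
  shows "Fa (g \<star>\<^bsub>C\<^esub> f) = Fa g \<star>\<^bsub>D\<^esub> Fa f"
  using fun_cmp[of f "src C f" "tgt C f" g "tgt C g"] assms by (auto simp: homset_def)

lemma functor_minv:
  assumes "f \<in> arr C"
  shows "Fa (minv C f) = minv D (Fa f)"
proof (rule D.minv_unique[symmetric])
  show "Fa (minv C f) \<star>\<^bsub>D\<^esub> Fa f = ident D (src D (Fa f))"
    using assms functor_cmp[of f "minv C f"]
    by (simp add: C.simps functor_arr fun_ident)
qed (use assms in \<open>auto simp: functor_arr C.simps\<close>)

lemmas functor_simps = fun_obj functor_arr functor_cmp fun_ident functor_minv

end

section \<open>Presheaves of morphisms between local objects, and descent\<close>

section \<open>Strict restriction of morphisms between local objects\<close>

context groupoid_prestack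
begin

lemma restriction:
  assumes "openin X U" "openin X V" "V \<subseteq> U"
  shows "groupoid_functor (sect G U) (sect G V) (rob G U V) (rarr G U V)"
  using assms by (simp add: groupoid_functor_def restriction_functor sect_groupoid)

lemmas gpd_simps = groupoid.simps[OF sect_groupoid] openin_Int
lemmas res_simps = groupoid_functor.functor_simps[OF restriction]

lemma coh_arr:
  assumes "openin X U" "openin X V" "openin X W" "W \<subseteq> V" "V \<subseteq> U" "i \<in> obj (sect G U)"
  shows "coh G U V W i \<in> arr (sect G W)"
    "src (sect G W) (coh G U V W i) = rob G V W (rob G U V i)"
    "tgt (sect G W) (coh G U V W i) = rob G U W i"
  using coh_hom[OF assms] by (auto simp: homset_def)

lemma unt_arr:
  assumes "openin X U" "i \<in> obj (sect G U)"
  shows "unt G U i \<in> arr (sect G U)" "src (sect G U) (unt G U i) = i"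
    "tgt (sect G U) (unt G U i) = rob G U U i"
  using unt_hom[OF assms] by (auto simp: homset_def)

lemmas ps_simps = gpd_simps res_simps coh_arr unt_arr

lemma hom_res_hom:
  assumes "openin X U" "openin X V" "openin X W" "openin X W'" "W' \<subseteq> W" "W \<subseteq> U" "W \<subseteq> V"
    "i \<in> obj (sect G U)" "j \<in> obj (sect G V)" "f \<in> hom_sect G U i V j W"
  shows "hom_res G U i V j W W' f \<in> hom_sect G U i V j W'"
  using assms by (auto simp: hom_sect_def hom_res_def homset_def ps_simps)

text \<open>Both restricted factors are conjugated by coherence isomorphisms, and the two at the
  middle object \<open>j\<close> cancel; functoriality of \<open>rarr\<close> gives the
  rest.\<close>

lemma hom_res_cmp:
  assumes "openin X U" "openin X V" "openin X Z" "openin X W" "openin X W'" "W' \<subseteq> W"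
    "W \<subseteq> U" "W \<subseteq> V" "W \<subseteq> Z"
    "i \<in> obj (sect G U)" "j \<in> obj (sect G V)" "k \<in> obj (sect G Z)"
    "f \<in> hom_sect G U i V j W" "g \<in> hom_sect G V j Z k W"
  shows "hom_res G U i Z k W W' (g \<star>\<^bsub>sect G W\<^esub> f)
     = hom_res G V j Z k W W' g \<star>\<^bsub>sect G W'\<^esub> hom_res G U i V j W W' f"
  using assms by (auto simp: hom_sect_def hom_res_def homset_def ps_simps)

text \<open>By \<open>coh_unt_right\<close> the coherence isomorphisms from \<open>W\<close> to
  \<open>W\<close> are inverse to the units at the restricted objects, so the claim becomes
  naturality of the unit.\<close>

lemma hom_res_self:
  assumes "openin X U" "openin X V" "openin X W" "W \<subseteq> U" "W \<subseteq> V"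
    "i \<in> obj (sect G U)" "j \<in> obj (sect G V)" "f \<in> hom_sect G U i V j W"
  shows "hom_res G U i V j W W f = f"
proof -
  have coh: "coh G U' W W k = minv (sect G W) (unt G W (rob G U' W k))"
    if "openin X U'" "W \<subseteq> U'" "k \<in> obj (sect G U')" for U' k
    by (rule groupoid.minv_unique[OF sect_groupoid, symmetric])
      (use that assms coh_unt_right[of U' W k] in \<open>auto simp: ps_simps\<close>)
  have nat: "rarr G W W f \<star>\<^bsub>sect G W\<^esub> unt G W (rob G U W i) = unt G W (rob G V W j) \<star>\<^bsub>sect G W\<^esub> f"
    using unt_natural[of W f] assms by (auto simp: hom_sect_def)
  show ?thesis
    using assms by (auto simp: hom_res_def hom_sect_def homset_def coh nat ps_simps)
qed

text \<open>\<open>coh_assoc\<close>, solved for the restricted coherence isomorphism, and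
  \<open>coh_natural\<close>, solved for the twice restricted \<open>f\<close>, turn both sides into
  the same word.\<close>

lemma hom_res_res:
  assumes "openin X U" "openin X V" "openin X W" "openin X W'" "openin X W''"
    "W'' \<subseteq> W'" "W' \<subseteq> W" "W \<subseteq> U" "W \<subseteq> V"
    "i \<in> obj (sect G U)" "j \<in> obj (sect G V)" "f \<in> hom_sect G U i V j W"
  shows "hom_res G U i V j W' W'' (hom_res G U i V j W W' f) = hom_res G U i V j W W'' f"
proof -
  let ?C = "sect G W''"
  have sub: "W'' \<subseteq> W" "W' \<subseteq> U" "W' \<subseteq> V" "W'' \<subseteq> U" "W'' \<subseteq> V" using assms by auto
  have f: "f \<in> arr (sect G W)" "src (sect G W) f = rob G U W i" "tgt (sect G W) f = rob G V W j"
    using assms by (auto simp: hom_sect_def homset_def)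
  have coh: "rarr G W' W'' (coh G T W W' k) =
      minv ?C (coh G T W' W'' k) \<star>\<^bsub>?C\<^esub> coh G T W W'' k \<star>\<^bsub>?C\<^esub> coh G W W' W'' (rob G T W k)"
    if "openin X T" "W \<subseteq> T" "k \<in> obj (sect G T)" for T k
  proof -
    have "coh G T W' W'' k \<star>\<^bsub>?C\<^esub> rarr G W' W'' (coh G T W W' k)
            = coh G T W W'' k \<star>\<^bsub>?C\<^esub> coh G W W' W'' (rob G T W k)"
      by (rule coh_assoc) (use assms that in auto)
    then have "minv ?C (coh G T W' W'' k) \<star>\<^bsub>?C\<^esub> (coh G T W' W'' k \<star>\<^bsub>?C\<^esub> rarr G W' W'' (coh G T W W' k))
            = minv ?C (coh G T W' W'' k) \<star>\<^bsub>?C\<^esub> (coh G T W W'' k \<star>\<^bsub>?C\<^esub> coh G W W' W'' (rob G T W k))"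
      by simp
    then show ?thesis using assms that sub by (simp add: ps_simps subset_trans[of W' W T])
  qed
  have nat: "rarr G W' W'' (rarr G W W' f) = minv ?C (coh G W W' W'' (rob G V W j))
      \<star>\<^bsub>?C\<^esub> rarr G W W'' f \<star>\<^bsub>?C\<^esub> coh G W W' W'' (rob G U W i)"
  proof -
    have "coh G W W' W'' (rob G V W j) \<star>\<^bsub>?C\<^esub> rarr G W' W'' (rarr G W W' f)
            = rarr G W W'' f \<star>\<^bsub>?C\<^esub> coh G W W' W'' (rob G U W i)"
      by (rule coh_natural) (use assms in \<open>auto simp: hom_sect_def\<close>)
    then have "minv ?C (coh G W W' W'' (rob G V W j)) \<star>\<^bsub>?C\<^esub> (coh G W W' W'' (rob G V W j) \<star>\<^bsub>?C\<^esub> rarr G W' W'' (rarr G W W' f))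
            = minv ?C (coh G W W' W'' (rob G V W j)) \<star>\<^bsub>?C\<^esub> (rarr G W W'' f \<star>\<^bsub>?C\<^esub> coh G W W' W'' (rob G U W i))"
      by simp
    then show ?thesis using assms sub f by (simp add: ps_simps)
  qed
  show ?thesis
    using assms sub f by (simp add: hom_res_def ps_simps coh nat)
qed

lemma hom_res_minv:
  assumes "openin X U" "openin X V" "openin X W" "openin X W'" "W' \<subseteq> W" "W \<subseteq> U" "W \<subseteq> V"
    "i \<in> obj (sect G U)" "j \<in> obj (sect G V)" "f \<in> hom_sect G U i V j W"
  shows "hom_res G V j U i W W' (minv (sect G W) f) = minv (sect G W') (hom_res G U i V j W W' f)"
  using assms by (auto simp: hom_sect_def hom_res_def homset_def ps_simps)

lemma coh_hom_sect:
  assumes "openin X U" "openin X V" "openin X W" "W \<subseteq> V" "V \<subseteq> U" "i \<in> obj (sect G U)"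
  shows "coh G U V W i \<in> hom_sect G V (rob G U V i) U i W"
  using coh_hom[OF assms] by (simp add: hom_sect_def)

text \<open>The coherence isomorphisms form one compatible section of the morphisms from
  \<open>i\<close> restricted to \<open>V\<close> to \<open>i\<close> itself. Composing with it
  changes the open set over which an object is considered without disturbing restriction.\<close>

lemma hom_res_coh:
  assumes "openin X U" "openin X V" "openin X W" "openin X W'" "W' \<subseteq> W" "W \<subseteq> V" "V \<subseteq> U"
    "i \<in> obj (sect G U)"
  shows "hom_res G V (rob G U V i) U i W W' (coh G U V W i) = coh G U V W' i"
  using assms coh_assoc[of U V W W' i] by (auto simp: hom_res_def ps_simps)

text \<open>A morphism from an object over \<open>V\<close> to the restriction of an object over the
  larger \<open>U\<close> is read as a section between the two objects themselves. This is the shape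
  of \<open>obs_h_res\<close> and, after inversion, of the isomorphisms that effective descent
  returns. Compatibility combines \<open>coh_natural\<close> at \<open>f\<close> with
  \<open>coh_assoc\<close> at \<open>j\<close>.\<close>

lemma hom_res_coh_rarr:
  assumes "openin X U" "openin X V" "openin X W" "openin X W'" "W' \<subseteq> W" "W \<subseteq> V" "V \<subseteq> U"
    "i \<in> obj (sect G V)" "j \<in> obj (sect G U)" "f \<in> homset (sect G V) i (rob G U V j)"
  shows "coh G U V W j \<star>\<^bsub>sect G W\<^esub> rarr G V W f \<in> hom_sect G V i U j W"
    and "hom_res G V i U j W W' (coh G U V W j \<star>\<^bsub>sect G W\<^esub> rarr G V W f)
         = coh G U V W' j \<star>\<^bsub>sect G W'\<^esub> rarr G V W' f"
proof -
  have sub: "W \<subseteq> U" "W' \<subseteq> V" "W' \<subseteq> U" using assms by auto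
  have f: "f \<in> arr (sect G V)" "src (sect G V) f = i" "tgt (sect G V) f = rob G U V j"
    using assms(10) by (auto simp: homset_def)
  show "coh G U V W j \<star>\<^bsub>sect G W\<^esub> rarr G V W f \<in> hom_sect G V i U j W"
    using assms sub f by (simp add: hom_sect_def homset_def ps_simps)
  have nat: "coh G V W W' (rob G U V j) \<star>\<^bsub>sect G W'\<^esub> rarr G W W' (rarr G V W f)
      = rarr G V W' f \<star>\<^bsub>sect G W'\<^esub> coh G V W W' i"
    by (rule coh_natural) (use assms in auto)
  have "coh G U W W' j \<star>\<^bsub>sect G W'\<^esub> rarr G W W' (coh G U V W j)
            = coh G U V W' j \<star>\<^bsub>sect G W'\<^esub> coh G V W W' (rob G U V j)"
    by (rule coh_assoc) (use assms in auto)
  moreover have "hom_res G V i U j W W' (coh G U V W j \<star>\<^bsub>sect G W\<^esub> rarr G V W f)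
    = (coh G U W W' j \<star>\<^bsub>sect G W'\<^esub> rarr G W W' (coh G U V W j)) \<star>\<^bsub>sect G W'\<^esub>
      (rarr G W W' (rarr G V W f) \<star>\<^bsub>sect G W'\<^esub> minv (sect G W') (coh G V W W' i))"
    using assms sub f by (simp add: hom_res_def ps_simps)
  moreover have "\<dots> = coh G U W W' j \<star>\<^bsub>sect G W'\<^esub> rarr G W W' (coh G U V W j) \<star>\<^bsub>sect G W'\<^esub>
      rarr G W W' (rarr G V W f) \<star>\<^bsub>sect G W'\<^esub> minv (sect G W') (coh G V W W' i)"
    using assms sub f by (simp add: ps_simps)
  ultimately have "hom_res G V i U j W W' (coh G U V W j \<star>\<^bsub>sect G W\<^esub> rarr G V W f)
    = coh G U V W' j \<star>\<^bsub>sect G W'\<^esub> coh G V W W' (rob G U V j) \<star>\<^bsub>sect G W'\<^esub>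
      rarr G W W' (rarr G V W f) \<star>\<^bsub>sect G W'\<^esub> minv (sect G W') (coh G V W W' i)"
    by simp
  also have "\<dots> = coh G U V W' j \<star>\<^bsub>sect G W'\<^esub> (coh G V W W' (rob G U V j) \<star>\<^bsub>sect G W'\<^esub>
      rarr G W W' (rarr G V W f)) \<star>\<^bsub>sect G W'\<^esub> minv (sect G W') (coh G V W W' i)"
    using assms sub f by (simp add: ps_simps)
  also have "\<dots> = coh G U V W' j \<star>\<^bsub>sect G W'\<^esub> rarr G V W' f"
    using assms sub f by (simp add: nat ps_simps)
  finally show "hom_res G V i U j W W' (coh G U V W j \<star>\<^bsub>sect G W\<^esub> rarr G V W f)
    = coh G U V W' j \<star>\<^bsub>sect G W'\<^esub> rarr G V W' f" .
qed

lemma hom_sect_iff: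
  "f \<in> hom_sect G U i V j W \<longleftrightarrow>
    f \<in> arr (sect G W) \<and> src (sect G W) f = rob G U W i \<and> tgt (sect G W) f = rob G V W j"
  by (simp add: hom_sect_def homset_def)

end

text \<open>The axiom \<open>descent_effective\<close> wants each object over its own member of the
  covering. Here \<open>i l\<close> lives over a larger \<open>D l\<close>, as happens after a
  refinement. The datum is conjugated into the axiom's form, and the isomorphisms that come back are
  conjugated out again.\<close>

lemma (in groupoid_stack) descent:
  fixes L :: "'x set set"
  assumes A: "openin X A" "is_open_cover X A L E"
    and D: "\<And>l. l \<in> L \<Longrightarrow> openin X (D l) \<and> E l \<subseteq> D l \<and> i l \<in> obj (sect G (D l))"
    and \<gamma>: "\<And>l m. \<lbrakk>l \<in> L; m \<in> L\<rbrakk> \<Longrightarrow> \<gamma> l m \<in> hom_sect G (D l) (i l) (D m) (i m) (E l \<inter> E m)"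
    and cocycle: "\<And>l m n W. \<lbrakk>l \<in> L; m \<in> L; n \<in> L; W = E l \<inter> E m \<inter> E n\<rbrakk> \<Longrightarrow>
        hom_res G (D m) (i m) (D n) (i n) (E m \<inter> E n) W (\<gamma> m n) \<star>\<^bsub>sect G W\<^esub>
        hom_res G (D l) (i l) (D m) (i m) (E l \<inter> E m) W (\<gamma> l m)
        = hom_res G (D l) (i l) (D n) (i n) (E l \<inter> E n) W (\<gamma> l n)"
  obtains a f where "a \<in> obj (sect G A)"
    "\<And>l. l \<in> L \<Longrightarrow> f l \<in> hom_sect G A a (D l) (i l) (E l)"
    "\<And>l m W. \<lbrakk>l \<in> L; m \<in> L; W = E l \<inter> E m\<rbrakk> \<Longrightarrow>
      hom_res G A a (D m) (i m) (E m) W (f m)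
      = \<gamma> l m \<star>\<^bsub>sect G W\<^esub> hom_res G A a (D l) (i l) (E l) W (f l)"
proof -
  \<comment> \<open>\<open>\<kappa> l W\<close> compares restricting \<open>i l\<close> to
    \<open>W\<close> by way of \<open>E l\<close> with restricting it directly; \<open>g\<close> is
    \<open>\<gamma>\<close> conjugated by these comparisons.\<close>
  define i' where "i' l = rob G (D l) (E l) (i l)" for l
  define \<kappa> where "\<kappa> l W = coh G (D l) (E l) W (i l)" for l W
  define g where "g l m = minv (sect G (E l \<inter> E m)) (\<kappa> m (E l \<inter> E m)) \<star>\<^bsub>sect G (E l \<inter> E m)\<^esub>
    (\<gamma> l m \<star>\<^bsub>sect G (E l \<inter> E m)\<^esub> \<kappa> l (E l \<inter> E m))" for l m
  have E: "openin X (E l)" "E l \<subseteq> A" if "l \<in> L" for l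
    using A(2) that by (auto simp: is_open_cover_def)
  have i': "i' l \<in> obj (sect G (E l))" if "l \<in> L" for l
    using D[OF that] E[OF that] by (simp add: i'_def ps_simps)
  have \<kappa>: "\<kappa> l W \<in> hom_sect G (E l) (i' l) (D l) (i l) W"
    if "l \<in> L" "openin X W" "W \<subseteq> E l" for l W
    unfolding \<kappa>_def i'_def by (rule coh_hom_sect) (use that E D in auto)
  have \<kappa>_res: "hom_res G (E l) (i' l) (D l) (i l) W W' (\<kappa> l W) = \<kappa> l W'"
    if "l \<in> L" "openin X W" "W \<subseteq> E l" "openin X W'" "W' \<subseteq> W" for l W W'
    unfolding \<kappa>_def i'_def by (rule hom_res_coh) (use that E D in auto)
  have g: "g l m \<in> hom_sect G (E l) (i' l) (E m) (i' m) (E l \<inter> E m)" if "l \<in> L" "m \<in> L" for l m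
    using \<gamma>[OF that] \<kappa>[of l "E l \<inter> E m"] \<kappa>[of m "E l \<inter> E m"] E[of l] E[of m] that
    by (simp add: g_def hom_sect_iff gpd_simps)
  \<comment> \<open>Since \<open>\<kappa>\<close> restricts to itself, \<open>g\<close> remains the
    conjugate of \<open>\<gamma>\<close> on every smaller set. In the cocycle condition on a triple
    intersection the middle \<open>\<kappa>\<close> then cancels.\<close>
  have g_res: "hom_res G (E l) (i' l) (E m) (i' m) (E l \<inter> E m) W (g l m) =
      minv (sect G W) (\<kappa> m W) \<star>\<^bsub>sect G W\<^esub>
       (hom_res G (D l) (i l) (D m) (i m) (E l \<inter> E m) W (\<gamma> l m) \<star>\<^bsub>sect G W\<^esub> \<kappa> l W)"
    if lm: "l \<in> L" "m \<in> L" and W: "openin X W" "W \<subseteq> E l \<inter> E m" for l m W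
  proof -
    let ?V = "E l \<inter> E m"
    have V: "openin X ?V" using E lm by auto
    have kl: "\<kappa> l ?V \<in> hom_sect G (E l) (i' l) (D l) (i l) ?V" by (rule \<kappa>) (use V lm in auto)
    have km: "\<kappa> m ?V \<in> hom_sect G (E m) (i' m) (D m) (i m) ?V" by (rule \<kappa>) (use V lm in auto)
    have gk: "\<gamma> l m \<star>\<^bsub>sect G ?V\<^esub> \<kappa> l ?V \<in> hom_sect G (E l) (i' l) (D m) (i m) ?V"
      using \<gamma>[OF lm] kl V by (simp add: hom_sect_iff gpd_simps)
    have mk: "minv (sect G ?V) (\<kappa> m ?V) \<in> hom_sect G (D m) (i m) (E m) (i' m) ?V"
      using km V by (simp add: hom_sect_iff gpd_simps)
    have ED: "E l \<subseteq> D l" "E m \<subseteq> D m" "openin X (D l)" "openin X (D m)"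
      "i l \<in> obj (sect G (D l))" "i m \<in> obj (sect G (D m))"
      "openin X (E l)" "openin X (E m)" using D E lm by auto
    have "hom_res G (E l) (i' l) (E m) (i' m) ?V W (g l m) =
        hom_res G (D m) (i m) (E m) (i' m) ?V W (minv (sect G ?V) (\<kappa> m ?V)) \<star>\<^bsub>sect G W\<^esub>
        hom_res G (E l) (i' l) (D m) (i m) ?V W (\<gamma> l m \<star>\<^bsub>sect G ?V\<^esub> \<kappa> l ?V)"
      unfolding g_def by (rule hom_res_cmp[OF _ _ _ V W(1,2) _ _ _ _ _ _ gk mk]) (use ED i' lm in auto)
    moreover have "hom_res G (E l) (i' l) (D m) (i m) ?V W (\<gamma> l m \<star>\<^bsub>sect G ?V\<^esub> \<kappa> l ?V)
       = hom_res G (D l) (i l) (D m) (i m) ?V W (\<gamma> l m) \<star>\<^bsub>sect G W\<^esub> \<kappa> l W"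
      using hom_res_cmp[OF _ _ _ V W(1,2) _ _ _ _ _ _ kl \<gamma>[OF lm]] ED i' lm \<kappa>_res[of l ?V W] V W
      by (simp add: le_infI1 le_infI2)
    moreover have "hom_res G (D m) (i m) (E m) (i' m) ?V W (minv (sect G ?V) (\<kappa> m ?V))
        = minv (sect G W) (\<kappa> m W)"
      using hom_res_minv[OF _ _ V W(1,2) _ _ _ _ km] ED i' lm \<kappa>_res[of m ?V W] V W
      by (simp add: le_infI1 le_infI2)
    ultimately show ?thesis by simp
  qed
  have "descent_datum G L E i' g"
    unfolding descent_datum_def
  proof (intro conjI ballI)
    fix l m n assume lmn: "l \<in> L" "m \<in> L" "n \<in> L"
    define W where "W = E l \<inter> E m \<inter> E n"
    have W: "openin X W" "W \<subseteq> E l \<inter> E m" "W \<subseteq> E m \<inter> E n" "W \<subseteq> E l \<inter> E n"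
      using E lmn by (auto simp: W_def)
    have r: "hom_res G (D p) (i p) (D q) (i q) (E p \<inter> E q) W (\<gamma> p q)
        \<in> hom_sect G (D p) (i p) (D q) (i q) W" if "p \<in> L" "q \<in> L" "W \<subseteq> E p \<inter> E q" for p q
      by (rule hom_res_hom) (use D[of p] D[of q] E[of p] E[of q] that W \<gamma>[of p q] in auto)
    have k: "\<kappa> p W \<in> hom_sect G (E p) (i' p) (D p) (i p) W" if "p \<in> {l, m, n}" for p
      by (rule \<kappa>) (use that W lmn in auto)
    show "let W = E l \<inter> E m \<inter> E n
       in hom_res G (E m) (i' m) (E n) (i' n) (E m \<inter> E n) W (g m n) \<star>\<^bsub>sect G W\<^esub>
          hom_res G (E l) (i' l) (E m) (i' m) (E l \<inter> E m) W (g l m) =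
          hom_res G (E l) (i' l) (E n) (i' n) (E l \<inter> E n) W (g l n)"
      unfolding Let_def W_def[symmetric]
      using cocycle[OF lmn W_def, symmetric] r[of m n] r[of l m] k[of l] k[of m] k[of n] lmn W
      by (simp add: g_res hom_sect_iff gpd_simps)
  qed (use i' g in auto)
  then have "effective_descent G A L E i' g" by (rule descent_effective[OF A])
  then obtain a f where a: "a \<in> obj (sect G A)"
    and f: "\<And>l. l \<in> L \<Longrightarrow> f l \<in> homset (sect G (E l)) (rob G A (E l) a) (i' l)"
    and gf: "\<And>l m W. \<lbrakk>l \<in> L; m \<in> L; W = E l \<inter> E m\<rbrakk> \<Longrightarrow> g l m \<star>\<^bsub>sect G W\<^esub>
             (rarr G (E l) W (f l) \<star>\<^bsub>sect G W\<^esub> minv (sect G W) (coh G A (E l) W a))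
           = rarr G (E m) W (f m) \<star>\<^bsub>sect G W\<^esub> minv (sect G W) (coh G A (E m) W a)"
    unfolding effective_descent_def Let_def by blast
  define \<phi> where "\<phi> l W = rarr G (E l) W (f l) \<star>\<^bsub>sect G W\<^esub> minv (sect G W) (coh G A (E l) W a)" for l W
  \<comment> \<open>The isomorphism \<open>f l\<close> starts at the restriction of
    \<open>a\<close>, the opposite direction to \<open>hom_res_coh_rarr\<close>. That lemma is
    therefore applied to the inverse of \<open>f l\<close>.\<close>
  have \<phi>_minv: "\<phi> l W = minv (sect G W) (coh G A (E l) W a \<star>\<^bsub>sect G W\<^esub>
      rarr G (E l) W (minv (sect G (E l)) (f l)))"
    if "l \<in> L" "openin X W" "W \<subseteq> E l" for l W
    using f[of l] E[of l] A a that by (simp add: \<phi>_def homset_def ps_simps)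
  have f': "minv (sect G (E l)) (f l) \<in> homset (sect G (E l)) (i' l) (rob G A (E l) a)"
    if "l \<in> L" for l
    using f[OF that] E[OF that] by (simp add: homset_def gpd_simps)
  have \<phi>: "\<phi> l W \<in> hom_sect G A a (E l) (i' l) W"
    if "l \<in> L" "openin X W" "W \<subseteq> E l" for l W
    using hom_res_coh_rarr(1)[OF A(1) E(1)[OF that(1)] that(2,2) subset_refl that(3) E(2)[OF that(1)] i'[OF that(1)] a f'[OF that(1)]] that
    by (simp add: \<phi>_minv hom_sect_iff gpd_simps)
  have \<phi>_res: "hom_res G A a (E l) (i' l) W W' (\<phi> l W) = \<phi> l W'"
    if "l \<in> L" "openin X W" "W \<subseteq> E l" "openin X W'" "W' \<subseteq> W" for l W W'
  proof -
    note h = hom_res_coh_rarr[OF A(1) E(1)[OF that(1)] that(2,4,5,3) E(2)[OF that(1)] i'[OF that(1)] a f'[OF that(1)]]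
    show ?thesis
      using that h(2) hom_res_minv[OF E(1)[OF that(1)] A(1) that(2,4,5,3) _ i'[OF that(1)] a h(1)] E(2)[OF that(1)]
      by (simp add: \<phi>_minv subset_trans[of W' W])
  qed
  \<comment> \<open>Undoes the passage from \<open>i l\<close> to \<open>i' l\<close>, so that the
    result ends at \<open>i l\<close> regarded over \<open>D l\<close>.\<close>
  define F where "F l = \<kappa> l (E l) \<star>\<^bsub>sect G (E l)\<^esub> \<phi> l (E l)" for l
  have F: "F l \<in> hom_sect G A a (D l) (i l) (E l)" if "l \<in> L" for l
    using \<phi>[of l "E l"] \<kappa>[of l "E l"] E[of l] that by (simp add: F_def hom_sect_iff gpd_simps)
  have F_res: "hom_res G A a (D l) (i l) (E l) W (F l) = \<kappa> l W \<star>\<^bsub>sect G W\<^esub> \<phi> l W"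
    if "l \<in> L" "openin X W" "W \<subseteq> E l" for l W
    using hom_res_cmp[OF A(1) E(1)[OF that(1)] _ E(1)[OF that(1)] that(2,3) E(2)[OF that(1)] subset_refl _ a i'[OF that(1)] _
        \<phi>[OF that(1) E(1)[OF that(1)] subset_refl] \<kappa>[OF that(1) E(1)[OF that(1)] subset_refl]] D[OF that(1)] E[OF that(1)] that
    by (simp add: F_def \<phi>_res \<kappa>_res)
  show ?thesis
  proof (rule that[OF a F])
    fix l m W assume lm: "l \<in> L" "m \<in> L" and W_def: "W = E l \<inter> E m"
    have W: "openin X W" "W \<subseteq> E l" "W \<subseteq> E m" using E lm by (auto simp: W_def)
    have "\<phi> m W = g l m \<star>\<^bsub>sect G W\<^esub> \<phi> l W"
      using gf[OF lm W_def] by (simp add: \<phi>_def)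
    then show "hom_res G A a (D m) (i m) (E m) W (F m)
      = \<gamma> l m \<star>\<^bsub>sect G W\<^esub> hom_res G A a (D l) (i l) (E l) W (F l)"
      using lm W \<phi>[of l W] \<kappa>[of l W] \<kappa>[of m W] \<gamma>[OF lm]
      by (simp add: F_res g_def W_def[symmetric] hom_sect_iff gpd_simps)
  qed
qed

section \<open>Cochain groups, differential and pullback along refinements\<close>

section \<open>Cech cohomology\<close>

lemma set_face_subset: "set (face m ks) \<subseteq> set ks"
  by (auto simp: face_def dest: in_set_takeD in_set_dropD)

lemma face_simplex:
  assumes "ks \<in> simplices K (Suc p)" "m \<le> Suc p"
  shows "face m ks \<in> simplices K p"
  using assms set_face_subset[of m ks] by (auto simp: simplices_def face_def)

lemma map_face: "map \<tau> (face m ks) = face m (map \<tau> ks)"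
  by (simp add: face_def take_map drop_map)

lemma cech_open_face: "cech_open U ks \<subseteq> cech_open U (face m ks)"
  using set_face_subset[of m ks] by (auto simp: cech_open_def)

lemma map_simplex:
  assumes "refines_via D C \<tau>" "ls \<in> simplices (fst D) p"
  shows "map \<tau> ls \<in> simplices (fst C) p"
  using assms by (auto simp: refines_via_def simplices_def)

lemma cech_open_refine:
  assumes "refines_via D C \<tau>" "ls \<in> simplices (fst D) p"
  shows "cech_open (snd D) ls \<subseteq> cech_open (snd C) (map \<tau> ls)"
  using assms by (fastforce simp: refines_via_def simplices_def cech_open_def)

lemma refines_via_trans:
  assumes "refines_via E D \<rho>" "refines_via D C \<tau>"
  shows "refines_via E C (\<tau> \<circ> \<rho>)"
  using assms by (fastforce simp: refines_via_def)

lemma simplices_1_iff: "ks \<in> simplices K 1 \<longleftrightarrow> (\<exists>k l. ks = [k, l] \<and> k \<in> K \<and> l \<in> K)"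
  by (auto simp: simplices_def length_Suc_conv)

lemma simplices_2_iff:
  "ks \<in> simplices K 2 \<longleftrightarrow> (\<exists>k l m. ks = [k, l, m] \<and> k \<in> K \<and> l \<in> K \<and> m \<in> K)"
  by (auto simp: simplices_def length_Suc_conv eval_nat_numeral)

context abelian_sheaf
begin

abbreviation cover :: "('k, 'x) cover \<Rightarrow> bool" where
  "cover C \<equiv> is_open_cover X (topspace X) (fst C) (snd C)"

lemma presheaf_N: "presheaf X (\<lambda>U. carrier (grp N U)) (gres N)"
  using is_sheaf by (simp add: sheaf_def)

lemma gres_gres:
  "\<lbrakk>openin X U; openin X V; openin X W; W \<subseteq> V; V \<subseteq> U; n \<in> carrier (grp N U)\<rbrakk>
    \<Longrightarrow> gres N V W (gres N U V n) = gres N U W n"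
  by (rule presheaf.res_res[OF presheaf_N])

lemma gres_group_hom:
  assumes "openin X U" "openin X V" "V \<subseteq> U"
  shows "group_hom (grp N U) (grp N V) (gres N U V)"
  using assms comm_groups gres_hom
  by (simp add: group_hom_def group_hom_axioms_def comm_group.axioms)

lemmas gres_simps = group_hom.hom_closed[OF gres_group_hom] group_hom.hom_mult[OF gres_group_hom]
  group_hom.hom_one[OF gres_group_hom] group_hom.hom_inv[OF gres_group_hom]

lemma gres_finprod:
  assumes "openin X U" "openin X V" "V \<subseteq> U" "f \<in> I \<rightarrow> carrier (grp N U)"
  shows "gres N U V (finprod (grp N U) f I) = finprod (grp N V) (\<lambda>i. gres N U V (f i)) I"
proof -
  interpret U: comm_group "grp N U" using assms(1) by (rule comm_groups)
  interpret V: comm_group "grp N V" using assms(2) by (rule comm_groups)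
  interpret r: group_hom "grp N U" "grp N V" "gres N U V" using assms(1-3) by (rule gres_group_hom)
  show ?thesis using assms(4)
    by (induction I rule: infinite_finite_induct) (simp_all add: Pi_iff)
qed

lemma openin_cech_open:
  assumes "cover C" "ks \<in> simplices (fst C) p"
  shows "openin X (cech_open (snd C) ks)"
proof -
  have "openin X (\<Inter>(snd C ` set ks))"
    by (rule openin_Inter) (use assms in \<open>auto simp: simplices_def is_open_cover_def\<close>)
  then show ?thesis by (simp add: cech_open_def)
qed

lemma comm_group_cochains:
  assumes "cover C"
  shows "comm_group (cech_cochains N C p)"
proof -
  have grp: "comm_group (grp N (cech_open (snd C) ks))" if "ks \<in> simplices (fst C) p" for ks
    by (rule comm_groups) (rule openin_cech_open[OF assms that])
  show ?thesis
  proof (rule group.group_comm_groupI)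
    show "group (cech_cochains N C p)"
      using grp by (simp add: cech_cochains_def comm_group.axioms)
    show "x \<otimes>\<^bsub>cech_cochains N C p\<^esub> y = y \<otimes>\<^bsub>cech_cochains N C p\<^esub> x"
      if "x \<in> carrier (cech_cochains N C p)" "y \<in> carrier (cech_cochains N C p)" for x y
      using that grp by (auto simp: cech_cochains_def fun_eq_iff restrict_def PiE_iff
          intro!: comm_monoid.m_comm comm_group.axioms)
  qed
qed

text \<open>Names a single signed factor of \<open>cech_d\<close>, so that products over the faces
  can be compared factor by factor.\<close>

definition face_term :: "('k, 'x) cover \<Rightarrow> ('k list \<Rightarrow> 'n) \<Rightarrow> 'k list \<Rightarrow> nat \<Rightarrow> 'n" where
  "face_term C c ks m =
    (let a = gres N (cech_open (snd C) (face m ks)) (cech_open (snd C) ks) (c (face m ks))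
     in if even m then a else inv\<^bsub>grp N (cech_open (snd C) ks)\<^esub> a)"

lemma cech_d_eq:
  "cech_d N C p c = (\<lambda>ks\<in>simplices (fst C) (Suc p).
    finprod (grp N (cech_open (snd C) ks)) (face_term C c ks) {..Suc p})"
  by (simp add: cech_d_def face_term_def[abs_def])

lemma cochain_closed:
  "\<lbrakk>c \<in> carrier (cech_cochains N C p); ks \<in> simplices (fst C) p\<rbrakk>
    \<Longrightarrow> c ks \<in> carrier (grp N (cech_open (snd C) ks))"
  by (auto simp: cech_cochains_def)

lemma gres_face_closed:
  assumes "cover C" "c \<in> carrier (cech_cochains N C p)" "ks \<in> simplices (fst C) (Suc p)" "m \<le> Suc p"
  shows "gres N (cech_open (snd C) (face m ks)) (cech_open (snd C) ks) (c (face m ks))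
    \<in> carrier (grp N (cech_open (snd C) ks))"
  by (intro gres_simps(1) openin_cech_open[OF assms(1) face_simplex[OF assms(3,4)]]
      openin_cech_open[OF assms(1,3)] cech_open_face cochain_closed[OF assms(2)]
      face_simplex[OF assms(3,4)])

lemma face_term_closed:
  assumes "cover C" "c \<in> carrier (cech_cochains N C p)" "ks \<in> simplices (fst C) (Suc p)"
  shows "face_term C c ks \<in> {..Suc p} \<rightarrow> carrier (grp N (cech_open (snd C) ks))"
proof
  fix m assume "m \<in> {..Suc p}"
  then have m: "m \<le> Suc p" by simp
  interpret comm_group "grp N (cech_open (snd C) ks)"
    by (rule comm_groups) (rule openin_cech_open[OF assms(1,3)])
  show "face_term C c ks m \<in> carrier (grp N (cech_open (snd C) ks))"
    using gres_face_closed[OF assms m] by (simp add: face_term_def Let_def)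
qed

text \<open>Restriction is a homomorphism, inversion is one in a commutative group, and a product of
  products splits. Consequently coboundaries form a subgroup and the unit cochain is a
  cocycle.\<close>

lemma cech_d_hom:
  assumes "cover C"
  shows "group_hom (cech_cochains N C p) (cech_cochains N C (Suc p)) (cech_d N C p)"
proof -
  interpret c: comm_group "cech_cochains N C p" by (rule comm_group_cochains[OF assms])
  interpret d: comm_group "cech_cochains N C (Suc p)" by (rule comm_group_cochains[OF assms])
  have "cech_d N C p \<in> hom (cech_cochains N C p) (cech_cochains N C (Suc p))"
  proof (rule homI)
    fix x assume x: "x \<in> carrier (cech_cochains N C p)"
    show "cech_d N C p x \<in> carrier (cech_cochains N C (Suc p))"
      using face_term_closed[OF assms x] openin_cech_open[OF assms]
      by (auto simp: cech_d_eq cech_cochains_def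
          intro!: comm_monoid.finprod_closed comm_group.axioms(1) comm_groups)
  next
    fix x y assume x: "x \<in> carrier (cech_cochains N C p)" and y: "y \<in> carrier (cech_cochains N C p)"
    have "cech_d N C p (x \<otimes>\<^bsub>cech_cochains N C p\<^esub> y) ks
        = (cech_d N C p x \<otimes>\<^bsub>cech_cochains N C (Suc p)\<^esub> cech_d N C p y) ks" for ks
    proof (cases "ks \<in> simplices (fst C) (Suc p)")
      case True
      let ?V = "cech_open (snd C) ks"
      have V: "openin X ?V" by (rule openin_cech_open[OF assms True])
      interpret comm_group "grp N ?V" by (rule comm_groups[OF V])
      have "face_term C (x \<otimes>\<^bsub>cech_cochains N C p\<^esub> y) ks m
        = face_term C x ks m \<otimes>\<^bsub>grp N ?V\<^esub> face_term C y ks m" if m: "m \<le> Suc p" for m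
      proof -
        have f: "face m ks \<in> simplices (fst C) p" using True m by (rule face_simplex)
        have "gres N (cech_open (snd C) (face m ks)) ?V ((x \<otimes>\<^bsub>cech_cochains N C p\<^esub> y) (face m ks))
          = gres N (cech_open (snd C) (face m ks)) ?V (x (face m ks)) \<otimes>\<^bsub>grp N ?V\<^esub>
            gres N (cech_open (snd C) (face m ks)) ?V (y (face m ks))"
          using f openin_cech_open[OF assms f] V cech_open_face[of "snd C" ks m]
            cochain_closed[OF x f] cochain_closed[OF y f]
          by (simp add: cech_cochains_def gres_simps)
        then show ?thesis
          using gres_face_closed[OF assms x True m] gres_face_closed[OF assms y True m]
          by (simp add: face_term_def Let_def inv_mult)
      qed
      then have "finprod (grp N ?V) (face_term C (x \<otimes>\<^bsub>cech_cochains N C p\<^esub> y) ks) {..Suc p}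
        = finprod (grp N ?V) (\<lambda>m. face_term C x ks m \<otimes>\<^bsub>grp N ?V\<^esub> face_term C y ks m) {..Suc p}"
        by (intro finprod_cong')
          (use face_term_closed[OF assms x True] face_term_closed[OF assms y True] in auto)
      also have "\<dots> = finprod (grp N ?V) (face_term C x ks) {..Suc p} \<otimes>\<^bsub>grp N ?V\<^esub>
          finprod (grp N ?V) (face_term C y ks) {..Suc p}"
        by (rule finprod_multf[OF face_term_closed[OF assms x True] face_term_closed[OF assms y True]])
      finally show ?thesis using True by (simp add: cech_d_eq cech_cochains_def)
    qed (simp add: cech_d_eq cech_cochains_def)
    then show "cech_d N C p (x \<otimes>\<^bsub>cech_cochains N C p\<^esub> y)
        = cech_d N C p x \<otimes>\<^bsub>cech_cochains N C (Suc p)\<^esub> cech_d N C p y" by blast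
  qed
  then show ?thesis by (simp add: group_hom_def group_hom_axioms_def c.is_group d.is_group)
qed

lemma subgroup_coboundaries:
  assumes "cover C"
  shows "subgroup (cech_coboundaries N C (Suc p)) (cech_cochains N C (Suc p))"
  using group_hom.img_is_subgroup[OF cech_d_hom[OF assms]] by simp

lemma pullback_hom:
  assumes "cover C" "cover D" "refines_via D C \<tau>"
  shows "group_hom (cech_cochains N C p) (cech_cochains N D p) (cech_pullback N D C \<tau> p)"
proof -
  interpret c: comm_group "cech_cochains N C p" by (rule comm_group_cochains[OF assms(1)])
  interpret d: comm_group "cech_cochains N D p" by (rule comm_group_cochains[OF assms(2)])
  have s: "map \<tau> ls \<in> simplices (fst C) p"
    and r: "group_hom (grp N (cech_open (snd C) (map \<tau> ls))) (grp N (cech_open (snd D) ls))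
      (gres N (cech_open (snd C) (map \<tau> ls)) (cech_open (snd D) ls))"
    if "ls \<in> simplices (fst D) p" for ls
  proof -
    show s: "map \<tau> ls \<in> simplices (fst C) p" by (rule map_simplex[OF assms(3) that])
    show "group_hom (grp N (cech_open (snd C) (map \<tau> ls))) (grp N (cech_open (snd D) ls))
      (gres N (cech_open (snd C) (map \<tau> ls)) (cech_open (snd D) ls))"
      by (intro gres_group_hom openin_cech_open[OF assms(1) s] openin_cech_open[OF assms(2) that]
          cech_open_refine[OF assms(3) that])
  qed
  have "cech_pullback N D C \<tau> p \<in> hom (cech_cochains N C p) (cech_cochains N D p)"
  proof (rule homI)
    fix x assume x: "x \<in> carrier (cech_cochains N C p)"
    show "cech_pullback N D C \<tau> p x \<in> carrier (cech_cochains N D p)"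
      using group_hom.hom_closed[OF r cochain_closed[OF x s]]
      by (simp add: cech_pullback_def cech_cochains_def)
  next
    fix x y assume x: "x \<in> carrier (cech_cochains N C p)" and y: "y \<in> carrier (cech_cochains N C p)"
    show "cech_pullback N D C \<tau> p (x \<otimes>\<^bsub>cech_cochains N C p\<^esub> y) =
      cech_pullback N D C \<tau> p x \<otimes>\<^bsub>cech_cochains N D p\<^esub> cech_pullback N D C \<tau> p y"
      using group_hom.hom_mult[OF r cochain_closed[OF x s] cochain_closed[OF y s]] s
      by (simp add: cech_pullback_def cech_cochains_def fun_eq_iff restrict_def)
  qed
  then show ?thesis by (simp add: group_hom_def group_hom_axioms_def c.is_group d.is_group)
qed

lemma pullback_pullback:
  assumes "cover C" "cover D" "cover E" "refines_via D C \<tau>" "refines_via E D \<rho>"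
    "c \<in> carrier (cech_cochains N C p)"
  shows "cech_pullback N E D \<rho> p (cech_pullback N D C \<tau> p c) = cech_pullback N E C (\<tau> \<circ> \<rho>) p c"
proof -
  have "gres N (cech_open (snd D) (map \<rho> ls)) (cech_open (snd E) ls)
      (gres N (cech_open (snd C) (map \<tau> (map \<rho> ls))) (cech_open (snd D) (map \<rho> ls)) (c (map \<tau> (map \<rho> ls))))
    = gres N (cech_open (snd C) (map \<tau> (map \<rho> ls))) (cech_open (snd E) ls) (c (map \<tau> (map \<rho> ls)))"
    if ls: "ls \<in> simplices (fst E) p" for ls
  proof -
    note ks = map_simplex[OF assms(5) ls]
    note js = map_simplex[OF assms(4) ks]
    show ?thesis
      by (intro gres_gres openin_cech_open[OF assms(1) js] openin_cech_open[OF assms(2) ks]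
          openin_cech_open[OF assms(3) ls] cech_open_refine[OF assms(5) ls]
          cech_open_refine[OF assms(4) ks] cochain_closed[OF assms(6) js])
  qed
  then show ?thesis
    using map_simplex[OF assms(5)] by (auto simp: cech_pullback_def fun_eq_iff restrict_def)
qed

text \<open>Pullback is a cochain map because \<open>\<tau>\<close> acts vertex by vertex and so
  commutes with deleting a vertex. On either side the factor for a face is the value of
  \<open>c\<close> on the image face, restricted in two stages to the open set of \<open>ls\<close>;
  by functoriality the intermediate set does not matter.\<close>

lemma pullback_cech_d:
  assumes "cover C" "cover D" "refines_via D C \<tau>" "c \<in> carrier (cech_cochains N C p)"
  shows "cech_pullback N D C \<tau> (Suc p) (cech_d N C p c) = cech_d N D p (cech_pullback N D C \<tau> p c)"
proof
  fix ls
  show "cech_pullback N D C \<tau> (Suc p) (cech_d N C p c) ls = cech_d N D p (cech_pullback N D C \<tau> p c) ls"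
  proof (cases "ls \<in> simplices (fst D) (Suc p)")
    case ls: True
    let ?V = "cech_open (snd C) (map \<tau> ls)" and ?W = "cech_open (snd D) ls"
    note ks = map_simplex[OF assms(3) ls]
    have V: "openin X ?V" and W: "openin X ?W" and WV: "?W \<subseteq> ?V"
      using openin_cech_open[OF assms(1) ks] openin_cech_open[OF assms(2) ls]
        cech_open_refine[OF assms(3) ls] by auto
    interpret W: comm_group "grp N ?W" by (rule comm_groups[OF W])
    have pc: "cech_pullback N D C \<tau> p c \<in> carrier (cech_cochains N D p)"
      by (rule group_hom.hom_closed[OF pullback_hom[OF assms(1-3)] assms(4)])
    have "gres N ?V ?W (face_term C c (map \<tau> ls) m) = face_term D (cech_pullback N D C \<tau> p c) ls m"
      if m: "m \<le> Suc p" for m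
    proof -
      note f = face_simplex[OF ls m] face_simplex[OF ks m]
      note o = openin_cech_open[OF assms(2) f(1)] openin_cech_open[OF assms(1) f(2)]
      have "gres N ?V ?W (gres N (cech_open (snd C) (face m (map \<tau> ls))) ?V (c (face m (map \<tau> ls))))
        = gres N (cech_open (snd C) (face m (map \<tau> ls))) ?W (c (face m (map \<tau> ls)))"
        by (intro gres_gres o V W WV cech_open_face cochain_closed[OF assms(4) f(2)])
      moreover have "gres N (cech_open (snd D) (face m ls)) ?W
          (gres N (cech_open (snd C) (face m (map \<tau> ls))) (cech_open (snd D) (face m ls)) (c (face m (map \<tau> ls))))
        = gres N (cech_open (snd C) (face m (map \<tau> ls))) ?W (c (face m (map \<tau> ls)))"
        using cech_open_refine[OF assms(3) f(1)]
        by (intro gres_gres o V W cech_open_face cochain_closed[OF assms(4) f(2)]) (simp add: map_face)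
      ultimately show ?thesis
        using f gres_face_closed[OF assms(1,4) ks m] V W WV
        by (simp add: face_term_def Let_def cech_pullback_def map_face gres_simps)
    qed
    then have "finprod (grp N ?W) (\<lambda>m. gres N ?V ?W (face_term C c (map \<tau> ls) m)) {..Suc p}
      = finprod (grp N ?W) (face_term D (cech_pullback N D C \<tau> p c) ls) {..Suc p}"
      by (intro W.finprod_cong') (use face_term_closed[OF assms(2) pc ls] in auto)
    then show ?thesis
      using ls ks gres_finprod[OF V W WV face_term_closed[OF assms(1,4) ks]]
      by (simp add: cech_pullback_def cech_d_eq)
  qed (simp add: cech_pullback_def cech_d_eq)
qed

lemma pullback_coboundary:
  assumes "cover C" "cover D" "refines_via D C \<tau>" "b \<in> cech_coboundaries N C (Suc p)"
  shows "cech_pullback N D C \<tau> (Suc p) b \<in> cech_coboundaries N D (Suc p)"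
  using assms(4) pullback_cech_d[OF assms(1-3)] group_hom.hom_closed[OF pullback_hom[OF assms(1-3)]]
  by auto

section \<open>Triviality of a class in the direct limit\<close>

abbreviation trivial_cover :: "('x set, 'x) cover" where
  "trivial_cover \<equiv> ({topspace X}, \<lambda>k. k)"

lemma cover_trivial: "cover trivial_cover"
  by (simp add: is_open_cover_def)

lemma refines_trivial:
  assumes "cover E"
  shows "refines_via E trivial_cover (\<lambda>_. topspace X)"
  using assms by (auto simp: refines_via_def is_open_cover_def)

lemma one_in_pairs:
  assumes "cover C"
  shows "(C, \<one>\<^bsub>cech_cochains N C p\<^esub>) \<in> cech_pairs X N p"
proof -
  interpret group_hom "cech_cochains N C p" "cech_cochains N C (Suc p)" "cech_d N C p"
    by (rule cech_d_hom[OF assms])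
  show ?thesis using assms by (simp add: cech_pairs_def cech_cocycles_def kernel_def)
qed

lemma pairs_closed: "(C, c) \<in> cech_pairs X N p \<Longrightarrow> cover C \<and> c \<in> carrier (cech_cochains N C p)"
  by (auto simp: cech_pairs_def cech_cocycles_def kernel_def)

text \<open>The unit cochain pulls back to the unit, so the relation says that a coboundary times
  the pullback of \<open>d\<close> is the unit. Coboundaries are closed under inverses, hence that
  pullback is itself a coboundary, and conversely.\<close>

lemma trivial_rel_iff:
  fixes D :: "('x set, 'x) cover"
  shows "((trivial_cover, \<one>\<^bsub>cech_cochains N trivial_cover (Suc p)\<^esub>), (D, d)) \<in> cech_rel X N (Suc p) \<longleftrightarrow>
    (D, d) \<in> cech_pairs X N (Suc p) \<and>
    (\<exists>(E :: ('x set, 'x) cover) \<sigma>. cover E \<and> refines_via E D \<sigma> \<and>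
      cech_pullback N E D \<sigma> (Suc p) d \<in> cech_coboundaries N E (Suc p))"
  (is "?l \<longleftrightarrow> ?r")
proof
  assume ?l
  then obtain E :: "('x set, 'x) cover" and \<tau> \<sigma> b where D: "(D, d) \<in> cech_pairs X N (Suc p)"
    and E: "cover E" "refines_via E trivial_cover \<tau>" "refines_via E D \<sigma>"
    and b: "b \<in> cech_coboundaries N E (Suc p)"
    and eq: "cech_pullback N E trivial_cover \<tau> (Suc p) \<one>\<^bsub>cech_cochains N trivial_cover (Suc p)\<^esub>
      = b \<otimes>\<^bsub>cech_cochains N E (Suc p)\<^esub> cech_pullback N E D \<sigma> (Suc p) d"
    unfolding cech_rel_def by blast
  interpret E: comm_group "cech_cochains N E (Suc p)" by (rule comm_group_cochains[OF E(1)])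
  interpret B: subgroup "cech_coboundaries N E (Suc p)" "cech_cochains N E (Suc p)"
    by (rule subgroup_coboundaries[OF E(1)])
  have d: "cech_pullback N E D \<sigma> (Suc p) d \<in> carrier (cech_cochains N E (Suc p))"
    using pairs_closed[OF D] group_hom.hom_closed[OF pullback_hom[OF _ E(1,3)]] by blast
  have "b \<otimes>\<^bsub>cech_cochains N E (Suc p)\<^esub> cech_pullback N E D \<sigma> (Suc p) d = \<one>\<^bsub>cech_cochains N E (Suc p)\<^esub>"
    using eq group_hom.hom_one[OF pullback_hom[OF cover_trivial E(1,2)]] by simp
  then have "cech_pullback N E D \<sigma> (Suc p) d = inv\<^bsub>cech_cochains N E (Suc p)\<^esub> b"
    using d B.mem_carrier[OF b] by (metis E.inv_equality E.m_comm)
  then have "cech_pullback N E D \<sigma> (Suc p) d \<in> cech_coboundaries N E (Suc p)"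
    using B.m_inv_closed[OF b] by (simp del: cech_coboundaries.simps)
  then show ?r using D E(1,3) by blast
next
  assume ?r
  then obtain E :: "('x set, 'x) cover" and \<sigma> where D: "(D, d) \<in> cech_pairs X N (Suc p)"
    and E: "cover E" "refines_via E D \<sigma>"
    and b: "cech_pullback N E D \<sigma> (Suc p) d \<in> cech_coboundaries N E (Suc p)" by blast
  interpret E: comm_group "cech_cochains N E (Suc p)" by (rule comm_group_cochains[OF E(1)])
  interpret B: subgroup "cech_coboundaries N E (Suc p)" "cech_cochains N E (Suc p)"
    by (rule subgroup_coboundaries[OF E(1)])
  have "cech_pullback N E trivial_cover (\<lambda>_. topspace X) (Suc p) \<one>\<^bsub>cech_cochains N trivial_cover (Suc p)\<^esub>
    = inv\<^bsub>cech_cochains N E (Suc p)\<^esub> cech_pullback N E D \<sigma> (Suc p) d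
      \<otimes>\<^bsub>cech_cochains N E (Suc p)\<^esub> cech_pullback N E D \<sigma> (Suc p) d"
    using B.mem_carrier[OF b] group_hom.hom_one[OF pullback_hom[OF cover_trivial E(1) refines_trivial[OF E(1)]]]
    by (simp only: E.l_inv)
  then show ?l
    using D E refines_trivial[OF E(1)] one_in_pairs[OF cover_trivial] B.m_inv_closed[OF b]
    unfolding cech_rel_def by blast
qed

lemma cohomology_one:
  "\<one>\<^bsub>cech_cohomology X N p\<^esub> = cech_class X N p trivial_cover \<one>\<^bsub>cech_cochains N trivial_cover p\<^esub>"
  by (simp add: cech_cohomology_def Let_def)

text \<open>The unit pair is related to itself, so it belongs to the unit class and, by the assumed
  equality of sets, to the class of \<open>c\<close>. Unfolding this one membership gives the
  refinement.\<close>

lemma class_eq_oneD: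
  assumes "cech_class X N (Suc p) C c = \<one>\<^bsub>cech_cohomology X N (Suc p)\<^esub>"
  obtains E :: "('x set, 'x) cover" and \<tau> where "cover E" "refines_via E C \<tau>"
    "cech_pullback N E C \<tau> (Suc p) c \<in> cech_coboundaries N E (Suc p)"
proof -
  let ?T = "(trivial_cover, \<one>\<^bsub>cech_cochains N trivial_cover (Suc p)\<^esub>)"
  interpret T: comm_group "cech_cochains N trivial_cover (Suc p)"
    by (rule comm_group_cochains[OF cover_trivial])
  interpret B: subgroup "cech_coboundaries N trivial_cover (Suc p)" "cech_cochains N trivial_cover (Suc p)"
    by (rule subgroup_coboundaries[OF cover_trivial])
  have "(?T, ?T) \<in> cech_rel X N (Suc p)"
    unfolding trivial_rel_iff
    using one_in_pairs[OF cover_trivial] cover_trivial refines_trivial[OF cover_trivial]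
      group_hom.hom_one[OF pullback_hom[OF cover_trivial cover_trivial refines_trivial[OF cover_trivial]]]
      B.one_closed by metis
  then have "((C, c), ?T) \<in> cech_rel X N (Suc p)"
    using assms by (auto simp: cohomology_one cech_class_def)
  then obtain E :: "('x set, 'x) cover" and \<tau> \<sigma> b where C: "(C, c) \<in> cech_pairs X N (Suc p)"
    and E: "cover E" "refines_via E C \<tau>" "refines_via E trivial_cover \<sigma>"
    and b: "b \<in> cech_coboundaries N E (Suc p)"
    and eq: "cech_pullback N E C \<tau> (Suc p) c = b \<otimes>\<^bsub>cech_cochains N E (Suc p)\<^esub>
       cech_pullback N E trivial_cover \<sigma> (Suc p) \<one>\<^bsub>cech_cochains N trivial_cover (Suc p)\<^esub>"
    unfolding cech_rel_def by blast
  interpret E: comm_group "cech_cochains N E (Suc p)" by (rule comm_group_cochains[OF E(1)])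
  have "b \<in> carrier (cech_cochains N E (Suc p))"
    using subgroup.subset[OF subgroup_coboundaries[OF E(1)]] b by blast
  then have "cech_pullback N E C \<tau> (Suc p) c = b"
    using eq group_hom.hom_one[OF pullback_hom[OF cover_trivial E(1,3)]] by simp
  then show ?thesis using that E b by blast
qed

text \<open>Pairwise intersections indexed by pairs would leave the index type
  \<open>'x set\<close>. Instead all open sets contained in a member of both coverings are taken,
  each as its own index.\<close>

lemma common_refinement:
  fixes C D :: "('x set, 'x) cover"
  assumes "cover C" "cover D"
  obtains E :: "('x set, 'x) cover" and \<tau> \<sigma> where "cover E" "refines_via E C \<tau>" "refines_via E D \<sigma>"
proof -
  define L where "L = {W. openin X W \<and> (\<exists>k\<in>fst C. W \<subseteq> snd C k) \<and> (\<exists>l\<in>fst D. W \<subseteq> snd D l)}"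
  have cov: "\<exists>W\<in>L. x \<in> W" if "x \<in> topspace X" for x
  proof -
    have "x \<in> (\<Union>k\<in>fst C. snd C k)" "x \<in> (\<Union>l\<in>fst D. snd D l)"
      using that assms by (simp_all add: is_open_cover_def)
    then obtain k l where "k \<in> fst C" "x \<in> snd C k" "l \<in> fst D" "x \<in> snd D l" by blast
    then have "snd C k \<inter> snd D l \<in> L" "x \<in> snd C k \<inter> snd D l"
      using assms by (auto simp: L_def is_open_cover_def)
    then show ?thesis by blast
  qed
  have "\<Union>L \<subseteq> topspace X" by (auto simp: L_def dest: openin_subset)
  moreover have "topspace X \<subseteq> \<Union>L" using cov by blast
  ultimately have "cover (L, \<lambda>W. W)" by (simp add: is_open_cover_def L_def)
  moreover have "\<exists>\<tau>. \<forall>W\<in>L. \<tau> W \<in> fst C \<and> W \<subseteq> snd C (\<tau> W)"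
    by (rule bchoice) (auto simp: L_def)
  then obtain \<tau> where "refines_via (L, \<lambda>W. W) C \<tau>" by (auto simp: refines_via_def)
  moreover have "\<exists>\<sigma>. \<forall>W\<in>L. \<sigma> W \<in> fst D \<and> W \<subseteq> snd D (\<sigma> W)"
    by (rule bchoice) (auto simp: L_def)
  then obtain \<sigma> where "refines_via (L, \<lambda>W. W) D \<sigma>" by (auto simp: refines_via_def)
  ultimately show ?thesis by (rule that)
qed

text \<open>Since every refinement of \<open>C\<close> is assumed to have a further refinement trivializing \<open>c\<close>,
  transitivity of the relation defining the direct limit is not needed.\<close>

lemma class_eq_oneI:
  fixes C :: "('x set, 'x) cover"
  assumes C: "(C, c) \<in> cech_pairs X N (Suc p)"
    and triv: "\<And>(D :: ('x set, 'x) cover) \<tau>. \<lbrakk>cover D; refines_via D C \<tau>\<rbrakk> \<Longrightarrow>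
      \<exists>(E :: ('x set, 'x) cover) \<rho>. cover E \<and> refines_via E D \<rho> \<and>
        cech_pullback N E C (\<tau> \<circ> \<rho>) (Suc p) c \<in> cech_coboundaries N E (Suc p)"
  shows "cech_class X N (Suc p) C c = \<one>\<^bsub>cech_cohomology X N (Suc p)\<^esub>"
proof -
  let ?T = "(trivial_cover, \<one>\<^bsub>cech_cochains N trivial_cover (Suc p)\<^esub>)"
  have c: "cover C" "c \<in> carrier (cech_cochains N C (Suc p))" using pairs_closed[OF C] by auto
  \<comment> \<open>The two classes are images under the same relation, so they are equal once they
    contain the same pairs.\<close>
  have "((C, c), (D, d)) \<in> cech_rel X N (Suc p) \<longleftrightarrow> (?T, (D, d)) \<in> cech_rel X N (Suc p)"
    for D :: "('x set, 'x) cover" and d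
  proof
    assume "((C, c), (D, d)) \<in> cech_rel X N (Suc p)"
    then obtain E :: "('x set, 'x) cover" and \<tau> \<sigma> b where D: "(D, d) \<in> cech_pairs X N (Suc p)"
      and E: "cover E" "refines_via E C \<tau>" "refines_via E D \<sigma>"
      and b: "b \<in> cech_coboundaries N E (Suc p)"
      and eq: "cech_pullback N E C \<tau> (Suc p) c
        = b \<otimes>\<^bsub>cech_cochains N E (Suc p)\<^esub> cech_pullback N E D \<sigma> (Suc p) d"
      unfolding cech_rel_def by blast
    have d: "cover D" "d \<in> carrier (cech_cochains N D (Suc p))" using pairs_closed[OF D] by auto
    \<comment> \<open>On \<open>Z\<close> both \<open>c\<close> and \<open>b\<close> are
      coboundaries; solving the pulled back equation for \<open>d\<close> makes \<open>d\<close> a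
      coboundary there too.\<close>
    obtain Z :: "('x set, 'x) cover" and \<rho> where Z: "cover Z" "refines_via Z E \<rho>"
      and cb: "cech_pullback N Z C (\<tau> \<circ> \<rho>) (Suc p) c \<in> cech_coboundaries N Z (Suc p)"
      using triv[OF E(1,2)] by blast
    interpret Z: comm_group "cech_cochains N Z (Suc p)" by (rule comm_group_cochains[OF Z(1)])
    interpret B: subgroup "cech_coboundaries N Z (Suc p)" "cech_cochains N Z (Suc p)"
      by (rule subgroup_coboundaries[OF Z(1)])
    interpret \<rho>: group_hom "cech_cochains N E (Suc p)" "cech_cochains N Z (Suc p)" "cech_pullback N Z E \<rho> (Suc p)"
      by (rule pullback_hom[OF E(1) Z])
    have ed: "cech_pullback N E D \<sigma> (Suc p) d \<in> carrier (cech_cochains N E (Suc p))"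
      by (rule group_hom.hom_closed[OF pullback_hom[OF d(1) E(1,3)] d(2)])
    have "b \<in> carrier (cech_cochains N E (Suc p))"
      using subgroup.subset[OF subgroup_coboundaries[OF E(1)]] b by blast
    then have "cech_pullback N Z C (\<tau> \<circ> \<rho>) (Suc p) c = cech_pullback N Z E \<rho> (Suc p) b
       \<otimes>\<^bsub>cech_cochains N Z (Suc p)\<^esub> cech_pullback N Z D (\<sigma> \<circ> \<rho>) (Suc p) d"
      using pullback_pullback[OF c(1) E(1) Z(1) E(2) Z(2) c(2)] pullback_pullback[OF d(1) E(1) Z(1) E(3) Z(2) d(2)]
        eq ed by (metis \<rho>.hom_mult)
    moreover have "cech_pullback N Z D (\<sigma> \<circ> \<rho>) (Suc p) d \<in> carrier (cech_cochains N Z (Suc p))"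
      by (rule group_hom.hom_closed[OF pullback_hom[OF d(1) Z(1) refines_via_trans[OF Z(2) E(3)]] d(2)])
    moreover note pb = pullback_coboundary[OF E(1) Z b]
    ultimately have "cech_pullback N Z D (\<sigma> \<circ> \<rho>) (Suc p) d =
        inv\<^bsub>cech_cochains N Z (Suc p)\<^esub> cech_pullback N Z E \<rho> (Suc p) b
        \<otimes>\<^bsub>cech_cochains N Z (Suc p)\<^esub> cech_pullback N Z C (\<tau> \<circ> \<rho>) (Suc p) c"
      using B.mem_carrier[OF pb] by (simp add: Z.m_assoc[symmetric] del: cech_coboundaries.simps)
    then have "cech_pullback N Z D (\<sigma> \<circ> \<rho>) (Suc p) d \<in> cech_coboundaries N Z (Suc p)"
      using B.m_closed[OF B.m_inv_closed[OF pb] cb] by (simp del: cech_coboundaries.simps)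
    then show "(?T, (D, d)) \<in> cech_rel X N (Suc p)"
      unfolding trivial_rel_iff using D Z(1) refines_via_trans[OF Z(2) E(3)] by blast
  next
    assume "(?T, (D, d)) \<in> cech_rel X N (Suc p)"
    then obtain E :: "('x set, 'x) cover" and \<sigma> where D: "(D, d) \<in> cech_pairs X N (Suc p)"
      and E: "cover E" "refines_via E D \<sigma>"
      and b: "cech_pullback N E D \<sigma> (Suc p) d \<in> cech_coboundaries N E (Suc p)"
      unfolding trivial_rel_iff by blast
    have d: "cover D" "d \<in> carrier (cech_cochains N D (Suc p))" using pairs_closed[OF D] by auto
    \<comment> \<open>\<open>triv\<close> applies only to refinements of \<open>C\<close>, whereas
      \<open>d\<close> is trivial on \<open>E\<close>. Below \<open>M\<close> both cocycles can be
      trivialized on the same covering.\<close>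
    obtain M :: "('x set, 'x) cover" and \<tau> \<pi> where M: "cover M" "refines_via M C \<tau>" "refines_via M E \<pi>"
      using common_refinement[OF c(1) E(1)] by blast
    obtain Z :: "('x set, 'x) cover" and \<rho> where Z: "cover Z" "refines_via Z M \<rho>"
      and cb: "cech_pullback N Z C (\<tau> \<circ> \<rho>) (Suc p) c \<in> cech_coboundaries N Z (Suc p)"
      using triv[OF M(1,2)] by blast
    interpret Z: comm_group "cech_cochains N Z (Suc p)" by (rule comm_group_cochains[OF Z(1)])
    interpret B: subgroup "cech_coboundaries N Z (Suc p)" "cech_cochains N Z (Suc p)"
      by (rule subgroup_coboundaries[OF Z(1)])
    note r = refines_via_trans[OF Z(2) M(3)]
    have db: "cech_pullback N Z D (\<sigma> \<circ> (\<pi> \<circ> \<rho>)) (Suc p) d \<in> cech_coboundaries N Z (Suc p)"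
      using pullback_coboundary[OF E(1) Z(1) r b] pullback_pullback[OF d(1) E(1) Z(1) E(2) r d(2)] by simp
    have "cech_pullback N Z C (\<tau> \<circ> \<rho>) (Suc p) c = (cech_pullback N Z C (\<tau> \<circ> \<rho>) (Suc p) c
        \<otimes>\<^bsub>cech_cochains N Z (Suc p)\<^esub> inv\<^bsub>cech_cochains N Z (Suc p)\<^esub> cech_pullback N Z D (\<sigma> \<circ> (\<pi> \<circ> \<rho>)) (Suc p) d)
        \<otimes>\<^bsub>cech_cochains N Z (Suc p)\<^esub> cech_pullback N Z D (\<sigma> \<circ> (\<pi> \<circ> \<rho>)) (Suc p) d"
      using B.mem_carrier[OF cb] B.mem_carrier[OF db]
      by (simp add: Z.m_assoc del: cech_coboundaries.simps)
    then show "((C, c), (D, d)) \<in> cech_rel X N (Suc p)"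
      using C D Z(1) refines_via_trans[OF Z(2) M(2)] refines_via_trans[OF r E(2)]
        B.m_closed[OF cb B.m_inv_closed[OF db]]
      unfolding cech_rel_def by blast
  qed
  then show ?thesis by (auto simp: cohomology_one cech_class_def)
qed

end

section \<open>The differential in degrees one and two\<close>

context abelian_sheaf
begin

text \<open>The factors run from the last face to the face omitting the first vertex, which is the
  order in which the product over an initial segment of the naturals unfolds.\<close>

lemma cech_d_1:
  assumes "cover C" "a \<in> carrier (cech_cochains N C 1)" "k \<in> fst C" "l \<in> fst C" "m \<in> fst C"
    and W: "W = cech_open (snd C) [k, l, m]"
  shows "cech_d N C 1 a [k, l, m] = gres N (cech_open (snd C) [k, l]) W (a [k, l]) \<otimes>\<^bsub>grp N W\<^esub>
    (inv\<^bsub>grp N W\<^esub> gres N (cech_open (snd C) [k, m]) W (a [k, m]) \<otimes>\<^bsub>grp N W\<^esub>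
     gres N (cech_open (snd C) [l, m]) W (a [l, m]))"
proof -
  have s: "[k, l, m] \<in> simplices (fst C) (Suc 1)"
    using assms by (simp add: simplices_def)
  interpret comm_group "grp N W"
    unfolding W by (rule comm_groups) (rule openin_cech_open[OF assms(1) s])
  have *: "face_term C a [k, l, m] \<in> {..Suc (Suc 0)} \<rightarrow> carrier (grp N W)"
    using face_term_closed[OF assms(1,2) s] W by simp
  have f: "face 0 [k, l, m] = [l, m]" "face (Suc 0) [k, l, m] = [k, m]" "face (Suc (Suc 0)) [k, l, m] = [k, l]"
    by (simp_all add: face_def)
  \<comment> \<open>Iterated \<open>Suc\<close> is the form on which the recursion for
    \<open>finprod\<close> acts.\<close>
  have "{..Suc 1} = {..Suc (Suc 0)}" by simp
  then have "cech_d N C 1 a [k, l, m] = finprod (grp N W) (face_term C a [k, l, m]) {..Suc (Suc 0)}"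
    using s W by (simp add: cech_d_eq)
  also have "\<dots> = face_term C a [k, l, m] (Suc (Suc 0)) \<otimes>\<^bsub>grp N W\<^esub>
      (face_term C a [k, l, m] (Suc 0) \<otimes>\<^bsub>grp N W\<^esub> face_term C a [k, l, m] 0)"
    using * by (simp add: Pi_iff)
  finally show ?thesis by (simp add: face_term_def Let_def f W)
qed

lemma cech_d_2:
  assumes "cover C" "a \<in> carrier (cech_cochains N C 2)" "k \<in> fst C" "l \<in> fst C" "m \<in> fst C" "n \<in> fst C"
    and W: "W = cech_open (snd C) [k, l, m, n]"
  shows "cech_d N C 2 a [k, l, m, n] =
     inv\<^bsub>grp N W\<^esub> gres N (cech_open (snd C) [k, l, m]) W (a [k, l, m]) \<otimes>\<^bsub>grp N W\<^esub>
    (gres N (cech_open (snd C) [k, l, n]) W (a [k, l, n]) \<otimes>\<^bsub>grp N W\<^esub>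
    (inv\<^bsub>grp N W\<^esub> gres N (cech_open (snd C) [k, m, n]) W (a [k, m, n]) \<otimes>\<^bsub>grp N W\<^esub>
     gres N (cech_open (snd C) [l, m, n]) W (a [l, m, n])))"
proof -
  have s: "[k, l, m, n] \<in> simplices (fst C) (Suc 2)"
    using assms by (simp add: simplices_def)
  interpret comm_group "grp N W"
    unfolding W by (rule comm_groups) (rule openin_cech_open[OF assms(1) s])
  have 3: "{..Suc 2} = {..Suc (Suc (Suc 0))}" by (simp add: eval_nat_numeral)
  have *: "face_term C a [k, l, m, n] \<in> {..Suc (Suc (Suc 0))} \<rightarrow> carrier (grp N W)"
    using face_term_closed[OF assms(1,2) s] unfolding 3 W[symmetric] .
  have f: "face 0 [k, l, m, n] = [l, m, n]" "face (Suc 0) [k, l, m, n] = [k, m, n]"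
    "face (Suc (Suc 0)) [k, l, m, n] = [k, l, n]" "face (Suc (Suc (Suc 0))) [k, l, m, n] = [k, l, m]"
    by (simp_all add: face_def)
  have "cech_d N C 2 a [k, l, m, n] = finprod (grp N W) (face_term C a [k, l, m, n]) {..Suc (Suc (Suc 0))}"
    unfolding 3[symmetric] using s W by (simp add: cech_d_eq)
  also have "\<dots> = face_term C a [k, l, m, n] (Suc (Suc (Suc 0))) \<otimes>\<^bsub>grp N W\<^esub>
      (face_term C a [k, l, m, n] (Suc (Suc 0)) \<otimes>\<^bsub>grp N W\<^esub>
      (face_term C a [k, l, m, n] (Suc 0) \<otimes>\<^bsub>grp N W\<^esub> face_term C a [k, l, m, n] 0))"
    using * by (simp add: Pi_iff)
  finally show ?thesis by (simp add: face_term_def Let_def f W)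
qed

end

section \<open>The action of a morphism of prestacks on sections between local objects\<close>

section \<open>Morphisms and central extensions\<close>

locale groupoid_prestack_mor = pseudonatural X G H F
    + G: groupoid_prestack X G + H: groupoid_prestack X H
  for X :: "'x topology" and G :: "('x, 'o, 'm) prestack" and H :: "('x, 'p, 'q) prestack"
    and F :: "('x, 'o, 'm, 'p, 'q) prestack_mor"
begin

lemma section_functor:
  assumes "openin X U"
  shows "groupoid_functor (sect G U) (sect H U) (mob F U) (marr F U)"
  using assms by (simp add: groupoid_functor_def mor_functor G.sect_groupoid H.sect_groupoid)

lemma mnat_arr:
  assumes "openin X U" "openin X V" "V \<subseteq> U" "i \<in> obj (sect G U)"
  shows "mnat F U V i \<in> arr (sect H V)"
    "src (sect H V) (mnat F U V i) = rob H U V (mob F U i)"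
    "tgt (sect H V) (mnat F U V i) = mob F V (rob G U V i)"
  using mnat_hom[OF assms] by (auto simp: homset_def)

lemmas mor_simps = groupoid_functor.functor_simps[OF section_functor] mnat_arr

lemma hom_map_hom:
  assumes "openin X U" "openin X V" "openin X W" "W \<subseteq> U" "W \<subseteq> V"
    "i \<in> obj (sect G U)" "j \<in> obj (sect G V)" "f \<in> hom_sect G U i V j W"
  shows "hom_map H F U i V j W f \<in> hom_sect H U (mob F U i) V (mob F V j) W"
  using assms
  by (simp add: hom_map_def H.hom_sect_iff G.hom_sect_iff G.ps_simps H.ps_simps mor_simps)

lemma hom_map_cmp:
  assumes "openin X U" "openin X V" "openin X Z" "openin X W" "W \<subseteq> U" "W \<subseteq> V" "W \<subseteq> Z"
    "i \<in> obj (sect G U)" "j \<in> obj (sect G V)" "k \<in> obj (sect G Z)"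
    "f \<in> hom_sect G U i V j W" "g \<in> hom_sect G V j Z k W"
  shows "hom_map H F U i Z k W (g \<star>\<^bsub>sect G W\<^esub> f)
    = hom_map H F V j Z k W g \<star>\<^bsub>sect H W\<^esub> hom_map H F U i V j W f"
  using assms
  by (simp add: hom_map_def H.hom_sect_iff G.hom_sect_iff G.ps_simps H.ps_simps mor_simps)

lemma hom_map_minv:
  assumes "openin X U" "openin X V" "openin X W" "W \<subseteq> U" "W \<subseteq> V"
    "i \<in> obj (sect G U)" "j \<in> obj (sect G V)" "f \<in> hom_sect G U i V j W"
  shows "hom_map H F V j U i W (minv (sect G W) f) = minv (sect H W) (hom_map H F U i V j W f)"
  using assms
  by (simp add: hom_map_def H.hom_sect_iff G.hom_sect_iff G.ps_simps H.ps_simps mor_simps)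

text \<open>\<open>mnat_coh\<close>, solved for the restricted comparison isomorphism, and
  \<open>mnat_natural\<close> at \<open>f\<close> rewrite the left side; the comparisons from
  \<open>W\<close> to \<open>W'\<close> then cancel in pairs.\<close>

lemma hom_map_res:
  assumes "openin X U" "openin X V" "openin X W" "openin X W'" "W' \<subseteq> W" "W \<subseteq> U" "W \<subseteq> V"
    "i \<in> obj (sect G U)" "j \<in> obj (sect G V)" "f \<in> hom_sect G U i V j W"
  shows "hom_res H U (mob F U i) V (mob F V j) W W' (hom_map H F U i V j W f)
    = hom_map H F U i V j W' (hom_res G U i V j W W' f)"
proof -
  let ?C = "sect H W'"
  have sub: "W' \<subseteq> U" "W' \<subseteq> V" using assms by auto
  have f: "f \<in> arr (sect G W)" "src (sect G W) f = rob G U W i" "tgt (sect G W) f = rob G V W j"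
    using assms by (auto simp: G.hom_sect_iff)
  have mn: "rarr H W W' (mnat F T W k) = minv ?C (mnat F W W' (rob G T W k)) \<star>\<^bsub>?C\<^esub>
      (minv ?C (marr F W' (coh G T W W' k)) \<star>\<^bsub>?C\<^esub> (mnat F T W' k \<star>\<^bsub>?C\<^esub> coh H T W W' (mob F T k)))"
    if T: "openin X T" "W \<subseteq> T" "W' \<subseteq> T" "k \<in> obj (sect G T)" for T k
  proof -
    have "mnat F T W' k \<star>\<^bsub>?C\<^esub> coh H T W W' (mob F T k)
            = marr F W' (coh G T W W' k) \<star>\<^bsub>?C\<^esub> mnat F W W' (rob G T W k)
                \<star>\<^bsub>?C\<^esub> rarr H W W' (mnat F T W k)"
      by (rule mnat_coh) (use assms T in auto)
    then show ?thesis using assms T by (simp add: G.ps_simps H.ps_simps mor_simps)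
  qed
  have nat: "rarr H W W' (marr F W f) = minv ?C (mnat F W W' (rob G V W j)) \<star>\<^bsub>?C\<^esub>
      (marr F W' (rarr G W W' f) \<star>\<^bsub>?C\<^esub> mnat F W W' (rob G U W i))"
  proof -
    have *: "mnat F W W' (rob G V W j) \<star>\<^bsub>?C\<^esub> rarr H W W' (marr F W f)
      = marr F W' (rarr G W W' f) \<star>\<^bsub>?C\<^esub> mnat F W W' (rob G U W i)"
      by (rule mnat_natural) (use assms f in \<open>auto simp: homset_def\<close>)
    show ?thesis unfolding *[symmetric]
      using assms f by (simp add: G.ps_simps H.ps_simps mor_simps)
  qed
  show ?thesis
    using assms sub f by (simp add: hom_map_def hom_res_def mn nat G.ps_simps H.ps_simps mor_simps)
qed

end

sublocale central_extension \<subseteq> G: gerbe X G by (rule gerbe_G)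
sublocale central_extension \<subseteq> H: gerbe X H by (rule gerbe_H)
sublocale central_extension \<subseteq> groupoid_prestack_mor X G H F
  by (intro groupoid_prestack_mor.intro morphism_F G.groupoid_prestack_axioms H.groupoid_prestack_axioms)
sublocale central_extension \<subseteq> N: abelian_sheaf X N by (rule abelian_N)

section \<open>Local lifts along \<open>F\<close> and the copies of \<open>N\<close> in the
  automorphism sheaves\<close>

context central_extension
begin

text \<open>Weak epimorphy speaks of two objects over one open set. Both objects are restricted to
  \<open>W\<close>, the section \<open>t\<close> is transported to these restrictions and lifted
  there, and the lift is transported back. The transport in \<open>H\<close> uses the images under
  \<open>F\<close> of the coherence isomorphisms of \<open>G\<close>, so that the two passages
  match.\<close>

lemma lift_locally:
  assumes "openin X U" "openin X V" "openin X W" "W \<subseteq> U" "W \<subseteq> V"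
    "i \<in> obj (sect G U)" "j \<in> obj (sect G V)"
    "t \<in> hom_sect H U (mob F U i) V (mob F V j) W" "x \<in> W"
  obtains Z s where "openin X Z" "x \<in> Z" "Z \<subseteq> W" "s \<in> hom_sect G U i V j Z"
    "hom_map H F U i V j Z s = hom_res H U (mob F U i) V (mob F V j) W Z t"
proof -
  define i' j' where "i' = rob G U W i" and "j' = rob G V W j"
  define \<kappa> \<mu> where "\<kappa> Z = coh G U W Z i" and "\<mu> Z = coh G V W Z j" for Z
  have obj: "i' \<in> obj (sect G W)" "j' \<in> obj (sect G W)"
    using assms by (simp_all add: i'_def j'_def G.ps_simps)
  have \<kappa>: "\<kappa> Z \<in> hom_sect G W i' U i Z" and \<mu>: "\<mu> Z \<in> hom_sect G W j' V j Z"
    if "openin X Z" "Z \<subseteq> W" for Z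
    using G.coh_hom_sect[of U W Z i] G.coh_hom_sect[of V W Z j] that assms
    by (simp_all add: \<kappa>_def \<mu>_def i'_def j'_def)
  have res: "hom_res G W i' U i W Z (\<kappa> W) = \<kappa> Z" "hom_res G W j' V j W Z (\<mu> W) = \<mu> Z"
    if "openin X Z" "Z \<subseteq> W" for Z
    using G.hom_res_coh[of U W W Z i] G.hom_res_coh[of V W W Z j] that assms
    by (simp_all add: \<kappa>_def \<mu>_def i'_def j'_def)
  define F\<kappa> F\<mu> where "F\<kappa> Z = hom_map H F W i' U i Z (\<kappa> Z)" and "F\<mu> Z = hom_map H F W j' V j Z (\<mu> Z)" for Z
  have F\<kappa>: "F\<kappa> Z \<in> hom_sect H W (mob F W i') U (mob F U i) Z"
    and F\<mu>: "F\<mu> Z \<in> hom_sect H W (mob F W j') V (mob F V j) Z" if "openin X Z" "Z \<subseteq> W" for Z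
    unfolding F\<kappa>_def F\<mu>_def
    by (rule hom_map_hom; use that assms obj \<kappa>[of Z] \<mu>[of Z] in auto)+
  have Fres: "hom_res H W (mob F W i') U (mob F U i) W Z (F\<kappa> W) = F\<kappa> Z"
    "hom_res H W (mob F W j') V (mob F V j) W Z (F\<mu> W) = F\<mu> Z"
    if "openin X Z" "Z \<subseteq> W" for Z
    using hom_map_res[of W U W Z i' i "\<kappa> W"] hom_map_res[of W V W Z j' j "\<mu> W"]
      \<kappa>[of W] \<mu>[of W] res that assms obj by (simp_all add: F\<kappa>_def F\<mu>_def)
  have Fobj: "mob F W i' \<in> obj (sect H W)" "mob F W j' \<in> obj (sect H W)"
    "mob F U i \<in> obj (sect H U)" "mob F V j \<in> obj (sect H V)"
    using obj assms by (simp_all add: mor_simps)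
  \<comment> \<open>\<open>t\<close> conjugated to a section between the images of the restricted
    objects, the only kind to which surjectivity applies.\<close>
  define t' where "t' = minv (sect H W) (F\<mu> W) \<star>\<^bsub>sect H W\<^esub> (t \<star>\<^bsub>sect H W\<^esub> F\<kappa> W)"
  have t\<kappa>: "t \<star>\<^bsub>sect H W\<^esub> F\<kappa> W \<in> hom_sect H W (mob F W i') V (mob F V j) W"
    using assms F\<kappa>[of W] by (simp add: H.hom_sect_iff H.gpd_simps)
  have m\<mu>: "minv (sect H W) (F\<mu> W) \<in> hom_sect H V (mob F V j) W (mob F W j') W"
    using assms F\<mu>[of W] by (simp add: H.hom_sect_iff H.gpd_simps)
  have t': "t' \<in> hom_sect H W (mob F W i') W (mob F W j') W"
    using assms t\<kappa> m\<mu> by (simp add: t'_def H.hom_sect_iff H.gpd_simps)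
  have "sheaf_surjective (subtopology X W) (hom_sect G W i' W j')
          (hom_sect H W (mob F W i') W (mob F W j')) (hom_res H W (mob F W i') W (mob F W j'))
          (hom_map H F W i' W j')"
    using weak_epi_F assms obj by (simp add: weak_epimorphism_def)
  then obtain Z s where Z: "openin (subtopology X W) Z" "x \<in> Z" "Z \<subseteq> W"
    and s: "s \<in> hom_sect G W i' W j' Z"
    and Fs: "hom_map H F W i' W j' Z s = hom_res H W (mob F W i') W (mob F W j') W Z t'"
    using t' assms(3,9) unfolding sheaf_surjective_def
    by (metis openin_open_subtopology subset_refl)
  have oZ: "openin X Z" using Z assms(3) by (simp add: openin_open_subtopology)
  have sub: "Z \<subseteq> U" "Z \<subseteq> V" using Z assms by auto
  have rt': "hom_res H W (mob F W i') W (mob F W j') W Z t' = minv (sect H Z) (F\<mu> Z) \<star>\<^bsub>sect H Z\<^esub>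
      (hom_res H U (mob F U i) V (mob F V j) W Z t \<star>\<^bsub>sect H Z\<^esub> F\<kappa> Z)"
    using H.hom_res_cmp[OF assms(3) assms(2) assms(3,3) oZ Z(3) subset_refl assms(5) subset_refl Fobj(1,4,2) t\<kappa> m\<mu>]
      H.hom_res_minv[OF assms(3,2,3) oZ Z(3) subset_refl assms(5) Fobj(2,4) F\<mu>[OF assms(3) subset_refl]]
      H.hom_res_cmp[OF assms(3) assms(1,2,3) oZ Z(3) subset_refl assms(4,5) Fobj(1,3,4) F\<kappa>[OF assms(3) subset_refl] assms(8)]
      Fres[OF oZ Z(3)]
    by (simp add: t'_def)
  have rt: "hom_res H U (mob F U i) V (mob F V j) W Z t \<in> hom_sect H U (mob F U i) V (mob F V j) Z"
    by (rule H.hom_res_hom) (use assms oZ Z Fobj in auto)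
  \<comment> \<open>The inverse conjugation, now in \<open>G\<close>; applying \<open>F\<close> to
    it cancels the factors \<open>F\<kappa>\<close> and \<open>F\<mu>\<close> in
    \<open>t'\<close>.\<close>
  define s' where "s' = \<mu> Z \<star>\<^bsub>sect G Z\<^esub> (s \<star>\<^bsub>sect G Z\<^esub> minv (sect G Z) (\<kappa> Z))"
  have m\<kappa>: "minv (sect G Z) (\<kappa> Z) \<in> hom_sect G U i W i' Z"
    and sm: "s \<star>\<^bsub>sect G Z\<^esub> minv (sect G Z) (\<kappa> Z) \<in> hom_sect G U i W j' Z"
    and s': "s' \<in> hom_sect G U i V j Z"
    using \<kappa>[OF oZ Z(3)] \<mu>[OF oZ Z(3)] s oZ by (simp_all add: s'_def G.hom_sect_iff G.gpd_simps)
  have "hom_map H F U i V j Z s' = F\<mu> Z \<star>\<^bsub>sect H Z\<^esub>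
      (hom_map H F W i' W j' Z s \<star>\<^bsub>sect H Z\<^esub> minv (sect H Z) (F\<kappa> Z))"
    using hom_map_cmp[OF assms(1,3,2) oZ sub(1) Z(3) sub(2) assms(6) obj(2) assms(7) sm \<mu>[OF oZ Z(3)]]
      hom_map_cmp[OF assms(1,3,3) oZ sub(1) Z(3) Z(3) assms(6) obj m\<kappa> s]
      hom_map_minv[OF assms(3,1) oZ Z(3) sub(1) obj(1) assms(6) \<kappa>[OF oZ Z(3)]]
    by (simp add: s'_def F\<kappa>_def F\<mu>_def)
  also have "\<dots> = hom_res H U (mob F U i) V (mob F V j) W Z t"
    using rt F\<kappa>[OF oZ Z(3)] F\<mu>[OF oZ Z(3)] oZ
    by (simp add: Fs rt' H.hom_sect_iff H.gpd_simps)
  finally show ?thesis by (rule that[OF oZ Z(2,3) s'])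
qed

lemma \<chi>_hom:
  assumes "openin X U" "openin X W" "W \<subseteq> U" "i \<in> obj (sect G U)" "n \<in> carrier (grp N W)"
  shows "\<chi> U i W n \<in> hom_sect G U i U i W"
    and "hom_map H F U i U i W (\<chi> U i W n) = ident (sect H W) (rob H U W (mob F U i))"
proof -
  have "\<chi> U i W \<in> iso (grp N W) (grp (kernel_presheaf G H F U i) W)"
    using \<chi>_iso[OF assms(1,4)] assms(1-3) by (simp add: group_presheaf_iso_def openin_open_subtopology)
  then have "\<chi> U i W n \<in> kernel_sections G H F U i W"
    using assms(5) by (auto simp: iso_def hom_def kernel_presheaf_def)
  then show "\<chi> U i W n \<in> hom_sect G U i U i W"
    "hom_map H F U i U i W (\<chi> U i W n) = ident (sect H W) (rob H U W (mob F U i))"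
    by (auto simp: kernel_sections_def kernel_def aut_presheaf_def)
qed

text \<open>The source of the sections of \<open>N\<close> constructed below: the values of the
  cocycle and the family \<open>\<beta>\<close> are read off from automorphisms that
  \<open>F\<close> sends to identities.\<close>

lemma \<chi>_surj:
  assumes "openin X U" "openin X W" "W \<subseteq> U" "i \<in> obj (sect G U)"
    "f \<in> hom_sect G U i U i W"
    "hom_map H F U i U i W f = ident (sect H W) (rob H U W (mob F U i))"
  shows "\<exists>n \<in> carrier (grp N W). f = \<chi> U i W n"
proof -
  have "\<chi> U i W \<in> iso (grp N W) (grp (kernel_presheaf G H F U i) W)"
    using \<chi>_iso[OF assms(1,4)] assms(1-3) by (simp add: group_presheaf_iso_def openin_open_subtopology)
  then have "\<chi> U i W ` carrier (grp N W) = kernel_sections G H F U i W"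
    by (auto simp: iso_def bij_betw_def kernel_presheaf_def)
  moreover have "f \<in> kernel_sections G H F U i W"
    using assms by (simp add: kernel_sections_def kernel_def aut_presheaf_def)
  ultimately show ?thesis by blast
qed

lemma \<chi>_inj:
  assumes "openin X U" "openin X W" "W \<subseteq> U" "i \<in> obj (sect G U)"
  shows "inj_on (\<chi> U i W) (carrier (grp N W))"
  using \<chi>_iso[OF assms(1,4)] assms(1-3)
  by (simp add: group_presheaf_iso_def openin_open_subtopology iso_def bij_betw_def)

lemma \<chi>_mult:
  assumes "openin X U" "openin X W" "W \<subseteq> U" "i \<in> obj (sect G U)"
    "n \<in> carrier (grp N W)" "m \<in> carrier (grp N W)"
  shows "\<chi> U i W (n \<otimes>\<^bsub>grp N W\<^esub> m) = \<chi> U i W n \<star>\<^bsub>sect G W\<^esub> \<chi> U i W m"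
  using \<chi>_iso[OF assms(1,4)] assms
  by (simp add: group_presheaf_iso_def openin_open_subtopology iso_def hom_def kernel_presheaf_def aut_presheaf_def)

lemma \<chi>_res:
  assumes "openin X U" "openin X W" "openin X W'" "W \<subseteq> U" "W' \<subseteq> W" "i \<in> obj (sect G U)"
    "n \<in> carrier (grp N W)"
  shows "hom_res G U i U i W W' (\<chi> U i W n) = \<chi> U i W' (gres N W W' n)"
proof -
  have "W' \<subseteq> U" using assms by auto
  then show ?thesis
    using \<chi>_iso[OF assms(1,6)] assms
    by (simp add: group_presheaf_iso_def openin_open_subtopology kernel_presheaf_def aut_presheaf_def)
qed

text \<open>The \<open>Ad\<close> axiom without inverses, obtained by composing it with
  \<open>g\<close> on the right. In this form it moves a section of \<open>N\<close> through a
  product of transition morphisms.\<close>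

lemma \<chi>_commute:
  assumes "openin X U" "openin X V" "openin X W" "W \<subseteq> U" "W \<subseteq> V"
    "i \<in> obj (sect G U)" "j \<in> obj (sect G V)" "g \<in> hom_sect G U i V j W" "n \<in> carrier (grp N W)"
  shows "g \<star>\<^bsub>sect G W\<^esub> \<chi> U i W n = \<chi> V j W n \<star>\<^bsub>sect G W\<^esub> g"
proof -
  have "g \<star>\<^bsub>sect G W\<^esub> \<chi> U i W n \<star>\<^bsub>sect G W\<^esub> minv (sect G W) g = \<chi> V j W n"
    by (rule Ad_\<chi>[of U V i j W g W n]) (use assms in \<open>auto simp: G.hom_res_self\<close>)
  moreover have "g \<star>\<^bsub>sect G W\<^esub> \<chi> U i W n \<star>\<^bsub>sect G W\<^esub> minv (sect G W) g \<star>\<^bsub>sect G W\<^esub> g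
     = g \<star>\<^bsub>sect G W\<^esub> \<chi> U i W n"
    using assms \<chi>_hom(1)[of U W i n] by (simp add: G.hom_sect_iff G.gpd_simps)
  ultimately show ?thesis by simp
qed

end

section \<open>The obstruction cocycle of a choice, and its triviality\<close>

section \<open>The obstruction class\<close>

text \<open>One arbitrary admissible choice is fixed here; the choice that \<open>cl2\<close>
  selects is substituted for it at the end.\<close>

locale obstruction = central_extension X N G H F \<chi>
  for X :: "'x topology" and N :: "('x, 'n) group_presheaf"
    and G :: "('x, 'o, 'm) prestack" and H :: "('x, 'p, 'q) prestack"
    and F :: "('x, 'o, 'm, 'p, 'q) prestack_mor"
    and \<chi> :: "'x set \<Rightarrow> 'o \<Rightarrow> 'x set \<Rightarrow> 'n \<Rightarrow> 'm" +
  fixes j :: 'p and K :: "'x set set" and U i h g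
  assumes j: "j \<in> obj (sect H (topspace X))"
    and choice: "obs_choice X G H F j K U i h g"
begin

abbreviation "T \<equiv> topspace X"
abbreviation "homG k l \<equiv> hom_sect G (U k) (i k) (U l) (i l)"
abbreviation "homH k \<equiv> hom_sect H (U k) (mob F (U k) (i k)) T j"
abbreviation "gr k l W \<equiv> hom_res G (U k) (i k) (U l) (i l) (U k \<inter> U l) W (g k l)"
abbreviation "hr \<equiv> obs_h_res X H j U h"
abbreviation "c \<equiv> obs_cocycle N G \<chi> K U i g"
abbreviation "chi k \<equiv> \<chi> (U k) (i k)"

lemma cover_U: "N.cover (K, U)"
  using choice by (simp add: obs_choice_def)

lemma openT: "openin X T" by simp

lemma U:
  assumes "k \<in> K"
  shows "openin X (U k)" "U k \<subseteq> T" "i k \<in> obj (sect G (U k))" "mob F (U k) (i k) \<in> obj (sect H (U k))"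
proof -
  show 1: "openin X (U k)" "U k \<subseteq> T" "i k \<in> obj (sect G (U k))"
    using choice assms by (auto simp: obs_choice_def is_open_cover_def)
  show "mob F (U k) (i k) \<in> obj (sect H (U k))" using 1 by (simp add: mor_simps)
qed

lemma hr_hom:
  assumes "k \<in> K" "openin X W" "W \<subseteq> U k"
  shows "hr k W \<in> homH k W"
    and "\<lbrakk>openin X W'; W' \<subseteq> W\<rbrakk> \<Longrightarrow>
      hom_res H (U k) (mob F (U k) (i k)) T j W W' (hr k W) = hr k W'"
proof -
  have h: "h k \<in> homset (sect H (U k)) (mob F (U k) (i k)) (rob H T (U k) j)"
    using choice assms(1) by (simp add: obs_choice_def)
  show "hr k W \<in> homH k W"
    unfolding obs_h_res_def
    by (rule H.hom_res_coh_rarr(1)[of T "U k" W W]) (use U[OF assms(1)] assms j h in auto)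
  show "hom_res H (U k) (mob F (U k) (i k)) T j W W' (hr k W) = hr k W'"
    if "openin X W'" "W' \<subseteq> W"
    unfolding obs_h_res_def
    by (rule H.hom_res_coh_rarr(2)) (use U[OF assms(1)] assms j h that in auto)
qed

text \<open>The equation for the image of \<open>g k l\<close> is prescribed only over the full
  double intersection. It passes to every smaller \<open>W\<close> because \<open>hom_map\<close>
  commutes with restriction and \<open>hr\<close> restricts to itself.\<close>

lemma gr_hom:
  assumes "k \<in> K" "l \<in> K" "openin X W" "W \<subseteq> U k" "W \<subseteq> U l"
  shows "gr k l W \<in> homG k l W"
    and "\<lbrakk>openin X W'; W' \<subseteq> W\<rbrakk> \<Longrightarrow> hom_res G (U k) (i k) (U l) (i l) W W' (gr k l W) = gr k l W'"
    and "hom_map H F (U k) (i k) (U l) (i l) W (gr k l W) = minv (sect H W) (hr l W) \<star>\<^bsub>sect H W\<^esub> hr k W"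
proof -
  let ?V = "U k \<inter> U l"
  note k = U[OF assms(1)] and l = U[OF assms(2)]
  have V: "openin X ?V" "W \<subseteq> ?V" using k l assms by auto
  have g: "g k l \<in> homG k l ?V"
    and Fg: "hom_map H F (U k) (i k) (U l) (i l) ?V (g k l) = minv (sect H ?V) (hr l ?V) \<star>\<^bsub>sect H ?V\<^esub> hr k ?V"
    using choice assms(1,2) unfolding obs_choice_def Let_def by blast+
  show "gr k l W \<in> homG k l W"
    by (rule G.hom_res_hom) (use k l V assms g in auto)
  show "hom_res G (U k) (i k) (U l) (i l) W W' (gr k l W) = gr k l W'" if "openin X W'" "W' \<subseteq> W"
    by (rule G.hom_res_res) (use k l V assms g that in auto)
  have hl: "hr l ?V \<in> homH l ?V" and hk: "hr k ?V \<in> homH k ?V"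
    by (rule hr_hom(1); use assms V in auto)+
  have ml: "minv (sect H ?V) (hr l ?V) \<in> hom_sect H T j (U l) (mob F (U l) (i l)) ?V"
    using hl V by (simp add: H.hom_sect_iff H.gpd_simps)
  have "hom_map H F (U k) (i k) (U l) (i l) W (gr k l W)
    = hom_res H (U k) (mob F (U k) (i k)) (U l) (mob F (U l) (i l)) ?V W
       (minv (sect H ?V) (hr l ?V) \<star>\<^bsub>sect H ?V\<^esub> hr k ?V)"
    unfolding Fg[symmetric]
    by (rule hom_map_res[symmetric]) (use k l V assms g in auto)
  also have "\<dots> = hom_res H T j (U l) (mob F (U l) (i l)) ?V W (minv (sect H ?V) (hr l ?V))
      \<star>\<^bsub>sect H W\<^esub> hom_res H (U k) (mob F (U k) (i k)) T j ?V W (hr k ?V)"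
    by (rule H.hom_res_cmp) (use k l V assms hk ml j in auto)
  also have "hom_res H T j (U l) (mob F (U l) (i l)) ?V W (minv (sect H ?V) (hr l ?V))
     = minv (sect H W) (hom_res H (U l) (mob F (U l) (i l)) T j ?V W (hr l ?V))"
    by (rule H.hom_res_minv) (use k l V assms hl j in auto)
  finally show "hom_map H F (U k) (i k) (U l) (i l) W (gr k l W)
    = minv (sect H W) (hr l W) \<star>\<^bsub>sect H W\<^esub> hr k W"
    using hr_hom(2)[of k ?V W] hr_hom(2)[of l ?V W] V assms by simp
qed

text \<open>Replaces the two inverses hidden in the cocycle, the one in \<open>obs_g3\<close> and
  \<open>inv_into\<close>, by a multiplicative relation valid on every open subset. All later
  computations use the cocycle through this relation.\<close>

lemma cocycle_value:
  assumes klm: "k \<in> K" "l \<in> K" "m \<in> K" and V: "V = cech_open U [k, l, m]"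
  shows "c [k, l, m] \<in> carrier (grp N V)"
    and "\<lbrakk>openin X W; W \<subseteq> V\<rbrakk> \<Longrightarrow> gr l m W \<star>\<^bsub>sect G W\<^esub> gr k l W
      = gr k m W \<star>\<^bsub>sect G W\<^esub> chi k W (gres N V W (c [k, l, m]))"
proof -
  note k = U[OF klm(1)] and l = U[OF klm(2)] and m = U[OF klm(3)]
  have V': "V = U k \<inter> U l \<inter> U m" by (auto simp: V cech_open_def)
  have oV: "openin X V" "V \<subseteq> U k" "V \<subseteq> U l" "V \<subseteq> U m" using k l m by (auto simp: V')
  note gs = gr_hom[OF klm(1,2) oV(1,2,3)] gr_hom[OF klm(2,3) oV(1,3,4)] gr_hom[OF klm(1,3) oV(1,2,4)]
  define q where "q = obs_g3 G U i g k l m"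
  have q: "q = minv (sect G V) (gr k m V) \<star>\<^bsub>sect G V\<^esub> gr l m V \<star>\<^bsub>sect G V\<^esub> gr k l V"
    by (simp add: q_def obs_g3_def V' Let_def)
  have mkm: "minv (sect G V) (gr k m V) \<in> homG m k V"
    and ml: "minv (sect G V) (gr k m V) \<star>\<^bsub>sect G V\<^esub> gr l m V \<in> homG l k V"
    and qh: "q \<in> homG k k V"
    using gs(1,4,7) oV by (simp_all add: q G.hom_sect_iff G.gpd_simps)
  have "hom_map H F (U k) (i k) (U k) (i k) V q =
    hom_map H F (U m) (i m) (U k) (i k) V (minv (sect G V) (gr k m V)) \<star>\<^bsub>sect H V\<^esub>
    hom_map H F (U l) (i l) (U m) (i m) V (gr l m V) \<star>\<^bsub>sect H V\<^esub>
    hom_map H F (U k) (i k) (U l) (i l) V (gr k l V)"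
    using hom_map_cmp[OF k(1) l(1) k(1) oV(1,2,3,2) k(3) l(3) k(3) gs(1) ml]
      hom_map_cmp[OF l(1) m(1) k(1) oV(1,3,4,2) l(3) m(3) k(3) gs(4) mkm]
    by (simp add: q)
  also have "hom_map H F (U m) (i m) (U k) (i k) V (minv (sect G V) (gr k m V))
     = minv (sect H V) (hom_map H F (U k) (i k) (U m) (i m) V (gr k m V))"
    by (rule hom_map_minv[OF k(1) m(1) oV(1,2,4) k(3) m(3) gs(7)])
  \<comment> \<open>With \<open>F(g_kl)\<close> equal to \<open>h_l^-1 h_k\<close>, the image of
    \<open>q\<close> is \<open>h_k^-1 h_m h_m^-1 h_l h_l^-1 h_k\<close>, which telescopes.\<close>
  finally have "hom_map H F (U k) (i k) (U k) (i k) V q = ident (sect H V) (rob H (U k) V (mob F (U k) (i k)))"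
    using hr_hom(1)[OF klm(1) oV(1,2)] hr_hom(1)[OF klm(2) oV(1,3)] hr_hom(1)[OF klm(3) oV(1,4)] oV
    by (simp add: gs(3,6,9) H.hom_sect_iff H.gpd_simps)
  from \<chi>_surj[OF k(1) oV(1,2) k(3) qh this] obtain n where n: "n \<in> carrier (grp N V)" "q = chi k V n"
    by blast
  \<comment> \<open>Injectivity of \<open>\<chi>\<close> makes \<open>inv_into\<close> return
    exactly this \<open>n\<close>.\<close>
  have "[k, l, m] \<in> simplices K 2" using klm by (auto simp: simplices_2_iff)
  then have cn: "c [k, l, m] = n"
    using inv_into_f_f[OF \<chi>_inj[OF k(1) oV(1,2) k(3)] n(1)] n(2)
    by (simp add: obs_cocycle_def V[symmetric] q_def)
  then show cV: "c [k, l, m] \<in> carrier (grp N V)" using n by simp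
  assume W: "openin X W" "W \<subseteq> V"
  have "gr l m V \<star>\<^bsub>sect G V\<^esub> gr k l V = gr k m V \<star>\<^bsub>sect G V\<^esub> q"
    using gs(1,4,7) oV by (simp add: q G.hom_sect_iff G.gpd_simps)
  then have "hom_res G (U k) (i k) (U m) (i m) V W (gr l m V \<star>\<^bsub>sect G V\<^esub> gr k l V)
    = hom_res G (U k) (i k) (U m) (i m) V W (gr k m V \<star>\<^bsub>sect G V\<^esub> q)" by simp
  then show "gr l m W \<star>\<^bsub>sect G W\<^esub> gr k l W
      = gr k m W \<star>\<^bsub>sect G W\<^esub> chi k W (gres N V W (c [k, l, m]))"
    using G.hom_res_cmp[OF k(1) l(1) m(1) oV(1) W oV(2,3,4) k(3) l(3) m(3) gs(1) gs(4)]
      G.hom_res_cmp[OF k(1) k(1) m(1) oV(1) W oV(2,2,4) k(3) k(3) m(3) qh gs(7)]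
      gs(2,5,8)[OF W] \<chi>_res[OF k(1) oV(1) W(1) oV(2) W(2) k(3) n(1)]
    by (simp add: n(2) cn)
qed

lemma cocycle_cochain: "c \<in> carrier (cech_cochains N (K, U) 2)"
proof -
  have "c \<in> (\<Pi>\<^sub>E ks\<in>simplices K 2. carrier (grp N (cech_open U ks)))"
  proof (rule PiE_I)
    fix ks assume "ks \<in> simplices K 2"
    then obtain k l m where "ks = [k, l, m]" "k \<in> K" "l \<in> K" "m \<in> K"
      unfolding simplices_2_iff by blast
    then show "c ks \<in> carrier (grp N (cech_open U ks))"
      using cocycle_value(1)[OF _ _ _ refl, of k l m] by simp
  qed (simp add: obs_cocycle_def)
  then show ?thesis by (simp add: cech_cochains_def)
qed

text \<open>The cocycle identity is associativity of \<open>g_mn g_lm g_kl\<close>. One bracketing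
  gives \<open>g_kn c_kmn c_klm\<close>; the other gives \<open>g_kn c_kln c_lmn\<close>, once
  \<open>c_lmn\<close> has been moved past \<open>g_kl\<close>. Cancelling \<open>g_kn\<close> and
  using injectivity of \<open>\<chi>\<close> leaves an equation in \<open>N\<close>.\<close>

lemma cocycle_in_pairs: "((K, U), c) \<in> cech_pairs X N 2"
proof -
  have "cech_d N (K, U) 2 c ks = \<one>\<^bsub>cech_cochains N (K, U) (Suc 2)\<^esub> ks" for ks
  proof (cases "ks \<in> simplices K (Suc 2)")
    case True
    then obtain k l m n where ks: "ks = [k, l, m, n]" and K: "k \<in> K" "l \<in> K" "m \<in> K" "n \<in> K"
      by (auto simp: simplices_def length_Suc_conv eval_nat_numeral)
    define W where "W = cech_open U ks"
    have W: "openin X W" using N.openin_cech_open[OF cover_U, of ks "Suc 2"] True by (simp add: W_def)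
    have sub: "W \<subseteq> cech_open U [k, l, m]" "W \<subseteq> cech_open U [k, l, n]" "W \<subseteq> cech_open U [k, m, n]"
      "W \<subseteq> cech_open U [l, m, n]" "W \<subseteq> U k" "W \<subseteq> U l" "W \<subseteq> U m" "W \<subseteq> U n"
      by (auto simp: W_def ks cech_open_def)
    let ?c = "\<lambda>k l m. gres N (cech_open U [k, l, m]) W (c [k, l, m])"
    interpret comm_group "grp N W" by (rule N.comm_groups[OF W])
    have oV: "openin X (cech_open U [k, l, m])" if "k \<in> K" "l \<in> K" "m \<in> K" for k l m
      using N.openin_cech_open[OF cover_U, of "[k, l, m]" 2] that by (auto simp: simplices_2_iff)
    have cc: "?c k l m \<in> carrier (grp N W)" "?c k l n \<in> carrier (grp N W)"
       "?c k m n \<in> carrier (grp N W)" "?c l m n \<in> carrier (grp N W)"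
      using K sub W oV cocycle_value(1) by (auto intro!: N.gres_simps(1))
    note keys = cocycle_value(2)[OF K(1,2,3) refl W sub(1)] cocycle_value(2)[OF K(1,2,4) refl W sub(2)]
       cocycle_value(2)[OF K(1,3,4) refl W sub(3)] cocycle_value(2)[OF K(2,3,4) refl W sub(4)]
    have grs: "gr k l W \<in> homG k l W" "gr l m W \<in> homG l m W" "gr m n W \<in> homG m n W"
      "gr k m W \<in> homG k m W" "gr l n W \<in> homG l n W" "gr k n W \<in> homG k n W"
      by (rule gr_hom(1); use K W sub in blast)+
    have \<chi>k: "chi k W x \<in> homG k k W" and \<chi>l: "chi l W x \<in> homG l l W"
      if "x \<in> carrier (grp N W)" for x
      by (rule \<chi>_hom(1); use U K W sub that in blast)+
    note ts = grs \<chi>k[OF cc(1)] \<chi>k[OF cc(2)] \<chi>k[OF cc(3)] \<chi>k[OF cc(4)] \<chi>l[OF cc(4)]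
    have "gr m n W \<star>\<^bsub>sect G W\<^esub> (gr l m W \<star>\<^bsub>sect G W\<^esub> gr k l W)
       = (gr m n W \<star>\<^bsub>sect G W\<^esub> gr k m W) \<star>\<^bsub>sect G W\<^esub> chi k W (?c k l m)"
      using ts W by (simp add: keys(1) G.hom_sect_iff G.gpd_simps)
    also have "\<dots> = gr k n W \<star>\<^bsub>sect G W\<^esub> (chi k W (?c k m n) \<star>\<^bsub>sect G W\<^esub> chi k W (?c k l m))"
      using ts W by (simp add: keys(3) G.hom_sect_iff G.gpd_simps)
    finally have 1: "gr m n W \<star>\<^bsub>sect G W\<^esub> (gr l m W \<star>\<^bsub>sect G W\<^esub> gr k l W) = \<dots>" .
    have "(gr m n W \<star>\<^bsub>sect G W\<^esub> gr l m W) \<star>\<^bsub>sect G W\<^esub> gr k l W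
        = gr l n W \<star>\<^bsub>sect G W\<^esub> (chi l W (?c l m n) \<star>\<^bsub>sect G W\<^esub> gr k l W)"
      using ts W by (simp add: keys(4) G.hom_sect_iff G.gpd_simps)
    \<comment> \<open>\<open>c_lmn\<close> arises as an automorphism of the object with index
      \<open>l\<close>; centrality exchanges it for its copy at index \<open>k\<close>.\<close>
    also have "chi l W (?c l m n) \<star>\<^bsub>sect G W\<^esub> gr k l W = gr k l W \<star>\<^bsub>sect G W\<^esub> chi k W (?c l m n)"
      by (rule \<chi>_commute[symmetric]) (use U K W sub grs cc in auto)
    also have "gr l n W \<star>\<^bsub>sect G W\<^esub> (gr k l W \<star>\<^bsub>sect G W\<^esub> chi k W (?c l m n))
        = (gr l n W \<star>\<^bsub>sect G W\<^esub> gr k l W) \<star>\<^bsub>sect G W\<^esub> chi k W (?c l m n)"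
      using ts W by (simp add: G.hom_sect_iff G.gpd_simps)
    also have "\<dots> = gr k n W \<star>\<^bsub>sect G W\<^esub> (chi k W (?c k l n) \<star>\<^bsub>sect G W\<^esub> chi k W (?c l m n))"
      using ts W by (simp add: keys(2) G.hom_sect_iff G.gpd_simps)
    also have "(gr m n W \<star>\<^bsub>sect G W\<^esub> gr l m W) \<star>\<^bsub>sect G W\<^esub> gr k l W
        = gr m n W \<star>\<^bsub>sect G W\<^esub> (gr l m W \<star>\<^bsub>sect G W\<^esub> gr k l W)"
      using ts W by (simp add: G.hom_sect_iff G.gpd_simps)
    finally have "gr k n W \<star>\<^bsub>sect G W\<^esub> (chi k W (?c k m n) \<star>\<^bsub>sect G W\<^esub> chi k W (?c k l m))
      = gr k n W \<star>\<^bsub>sect G W\<^esub> (chi k W (?c k l n) \<star>\<^bsub>sect G W\<^esub> chi k W (?c l m n))"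
      using 1 by simp
    then have "chi k W (?c k m n) \<star>\<^bsub>sect G W\<^esub> chi k W (?c k l m)
      = chi k W (?c k l n) \<star>\<^bsub>sect G W\<^esub> chi k W (?c l m n)"
      by (rule groupoid.left_cancel[OF G.sect_groupoid[OF W], rotated -1])
        (use ts W in \<open>simp_all add: G.hom_sect_iff G.gpd_simps\<close>)
    then have "chi k W (?c k m n \<otimes>\<^bsub>grp N W\<^esub> ?c k l m) = chi k W (?c k l n \<otimes>\<^bsub>grp N W\<^esub> ?c l m n)"
      using \<chi>_mult[OF U(1)[OF K(1)] W sub(5) U(3)[OF K(1)]] cc by simp
    then have eq: "?c k m n \<otimes>\<^bsub>grp N W\<^esub> ?c k l m = ?c k l n \<otimes>\<^bsub>grp N W\<^esub> ?c l m n"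
      using inj_onD[OF \<chi>_inj[OF U(1)[OF K(1)] W sub(5) U(3)[OF K(1)]]] cc by blast
    have "cech_d N (K, U) 2 c ks = inv\<^bsub>grp N W\<^esub> ?c k l m \<otimes>\<^bsub>grp N W\<^esub>
        (?c k l n \<otimes>\<^bsub>grp N W\<^esub> (inv\<^bsub>grp N W\<^esub> ?c k m n \<otimes>\<^bsub>grp N W\<^esub> ?c l m n))"
      unfolding ks using N.cech_d_2[OF cover_U cocycle_cochain, of k l m n W] K by (simp add: W_def ks)
    also have "\<dots> = inv\<^bsub>grp N W\<^esub> (?c k m n \<otimes>\<^bsub>grp N W\<^esub> ?c k l m) \<otimes>\<^bsub>grp N W\<^esub> (?c k l n \<otimes>\<^bsub>grp N W\<^esub> ?c l m n)"
      using cc by (simp add: inv_mult m_ac)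
    also have "\<dots> = \<one>\<^bsub>grp N W\<^esub>" using cc by (simp add: eq)
    finally show ?thesis using True by (simp add: cech_cochains_def W_def)
  qed (simp add: cech_d_def cech_cochains_def)
  then show ?thesis
    using cover_U cocycle_cochain by (auto simp: cech_pairs_def cech_cocycles_def kernel_def)
qed

text \<open>The correction by \<open>a\<close> removes exactly the defect of the \<open>g\<close>:
  with \<open>c = a_lm a_ln^-1 a_mn\<close>, the product \<open>g_ln c a_mn^-1 a_lm^-1\<close>
  collapses to \<open>g_ln a_ln^-1\<close>. The stack condition of \<open>G\<close> then gives the
  object, and the sheaf condition of \<open>H\<close> gives its isomorphism to
  \<open>j\<close>.\<close>

lemma object_of_coboundary:
  fixes E :: "('x set, 'x) cover"
  assumes E: "N.cover E" and \<tau>: "refines_via E (K, U) \<tau>"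
    and cob: "cech_pullback N E (K, U) \<tau> 2 c \<in> cech_coboundaries N E (Suc 1)"
  shows "\<exists>b \<in> obj (sect G T). homset (sect H T) (mob F T b) j \<noteq> {}"
proof -
  define L V where "L = fst E" and "V = snd E"
  obtain a where a: "a \<in> carrier (cech_cochains N E 1)"
    and da: "cech_pullback N E (K, U) \<tau> 2 c = cech_d N E 1 a"
    using cob by auto
  have V: "openin X (V l)" "V l \<subseteq> U (\<tau> l)" "\<tau> l \<in> K" "V l \<subseteq> T" if "l \<in> L" for l
    using that E \<tau> by (auto simp: is_open_cover_def refines_via_def L_def V_def)
  have VU: "openin X (V l \<inter> V m)" "V l \<inter> V m \<subseteq> U (\<tau> l)" "V l \<inter> V m \<subseteq> U (\<tau> m)"
    if "l \<in> L" "m \<in> L" for l m using V[OF that(1)] V[OF that(2)] by auto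
  have am: "a [l, m] \<in> carrier (grp N (V l \<inter> V m))" if "l \<in> L" "m \<in> L" for l m
    using N.cochain_closed[OF a, of "[l, m]"] that
    by (simp add: simplices_def cech_open_def L_def V_def)
  \<comment> \<open>Defined over every \<open>W\<close> at once, so that restricting
    \<open>\<gamma>\<close> yields \<open>\<gamma>\<close> again and the cocycle condition can be
    computed directly on triple intersections.\<close>
  define \<gamma> where "\<gamma> l m W = gr (\<tau> l) (\<tau> m) W \<star>\<^bsub>sect G W\<^esub>
     chi (\<tau> l) W (inv\<^bsub>grp N W\<^esub> gres N (V l \<inter> V m) W (a [l, m]))" for l m W
  have aW: "gres N (V l \<inter> V m) W (a [l, m]) \<in> carrier (grp N W)"
    "inv\<^bsub>grp N W\<^esub> gres N (V l \<inter> V m) W (a [l, m]) \<in> carrier (grp N W)"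
    if "l \<in> L" "m \<in> L" "openin X W" "W \<subseteq> V l \<inter> V m" for l m W
  proof -
    show 1: "gres N (V l \<inter> V m) W (a [l, m]) \<in> carrier (grp N W)"
      by (rule N.gres_simps(1)[OF VU(1)[OF that(1,2)] that(3,4) am[OF that(1,2)]])
    interpret comm_group "grp N W" by (rule N.comm_groups[OF that(3)])
    show "inv\<^bsub>grp N W\<^esub> gres N (V l \<inter> V m) W (a [l, m]) \<in> carrier (grp N W)"
      using 1 by simp
  qed
  have grW: "gr (\<tau> l) (\<tau> m) W \<in> homG (\<tau> l) (\<tau> m) W"
    and chiW: "chi (\<tau> l) W (inv\<^bsub>grp N W\<^esub> gres N (V l \<inter> V m) W (a [l, m])) \<in> homG (\<tau> l) (\<tau> l) W"
    if "l \<in> L" "m \<in> L" "openin X W" "W \<subseteq> V l \<inter> V m" for l m W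
  proof -
    have s: "W \<subseteq> U (\<tau> l)" "W \<subseteq> U (\<tau> m)" using VU[OF that(1,2)] that(4) by auto
    show "gr (\<tau> l) (\<tau> m) W \<in> homG (\<tau> l) (\<tau> m) W"
      by (rule gr_hom(1)[OF V(3)[OF that(1)] V(3)[OF that(2)] that(3) s])
    show "chi (\<tau> l) W (inv\<^bsub>grp N W\<^esub> gres N (V l \<inter> V m) W (a [l, m])) \<in> homG (\<tau> l) (\<tau> l) W"
      by (rule \<chi>_hom(1)[OF U(1)[OF V(3)[OF that(1)]] that(3) s(1) U(3)[OF V(3)[OF that(1)]] aW(2)[OF that]])
  qed
  have \<gamma>_hom: "\<gamma> l m W \<in> homG (\<tau> l) (\<tau> m) W"
    if "l \<in> L" "m \<in> L" "openin X W" "W \<subseteq> V l \<inter> V m" for l m W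
    using grW[OF that] chiW[OF that] that(3) by (simp add: \<gamma>_def G.hom_sect_iff G.gpd_simps)
  have \<gamma>_res: "hom_res G (U (\<tau> l)) (i (\<tau> l)) (U (\<tau> m)) (i (\<tau> m)) (V l \<inter> V m) W (\<gamma> l m (V l \<inter> V m))
      = \<gamma> l m W"
    if "l \<in> L" "m \<in> L" "openin X W" "W \<subseteq> V l \<inter> V m" for l m W
  proof -
    note W = VU[OF that(1,2)]
    note l = U[OF V(3)[OF that(1)]] and m = U[OF V(3)[OF that(2)]]
    let ?Y = "V l \<inter> V m"
    interpret r: group_hom "grp N ?Y" "grp N W" "gres N ?Y W"
      by (rule N.gres_group_hom[OF W(1) that(3,4)])
    have self: "gres N ?Y ?Y (a [l, m]) = a [l, m]"
      by (rule presheaf.res_self[OF N.presheaf_N W(1) am[OF that(1,2)]])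
    have "hom_res G (U (\<tau> l)) (i (\<tau> l)) (U (\<tau> l)) (i (\<tau> l)) ?Y W
        (chi (\<tau> l) ?Y (inv\<^bsub>grp N ?Y\<^esub> a [l, m]))
      = chi (\<tau> l) W (gres N ?Y W (inv\<^bsub>grp N ?Y\<^esub> a [l, m]))"
      by (rule \<chi>_res[OF l(1) W(1) that(3) W(2) that(4) l(3)]) (use am[OF that(1,2)] in simp)
    moreover have "gres N ?Y W (inv\<^bsub>grp N ?Y\<^esub> a [l, m]) = inv\<^bsub>grp N W\<^esub> gres N ?Y W (a [l, m])"
      using am[OF that(1,2)] by simp
    ultimately show ?thesis
      using G.hom_res_cmp[OF l(1) l(1) m(1) W(1) that(3,4) W(2,2,3) l(3) l(3) m(3)
          chiW[OF that(1,2) W(1) subset_refl] grW[OF that(1,2) W(1) subset_refl]]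
        gr_hom(2)[OF V(3)[OF that(1)] V(3)[OF that(2)] W that(3,4)]
      by (simp add: \<gamma>_def self)
  qed
  have cocycle: "\<gamma> m n W \<star>\<^bsub>sect G W\<^esub> \<gamma> l m W = \<gamma> l n W"
    if lmn: "l \<in> L" "m \<in> L" "n \<in> L" and W_def: "W = V l \<inter> V m \<inter> V n" for l m n W
  proof -
    have W: "openin X W" "W \<subseteq> V l \<inter> V m" "W \<subseteq> V l \<inter> V n" "W \<subseteq> V m \<inter> V n"
      using V lmn by (auto simp: W_def)
    have sub: "W \<subseteq> U (\<tau> l)" "W \<subseteq> U (\<tau> m)" "W \<subseteq> U (\<tau> n)" using W VU lmn by blast+
    define x y z where "x = gres N (V l \<inter> V m) W (a [l, m])"
      and "y = gres N (V l \<inter> V n) W (a [l, n])" and "z = gres N (V m \<inter> V n) W (a [m, n])"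
    interpret comm_group "grp N W" by (rule N.comm_groups[OF W(1)])
    have xyz: "x \<in> carrier (grp N W)" "y \<in> carrier (grp N W)" "z \<in> carrier (grp N W)"
      using aW(1)[OF lmn(1,2) W(1,2)] aW(1)[OF lmn(1,3) W(1,3)] aW(1)[OF lmn(2,3) W(1,4)]
      by (simp_all add: x_def y_def z_def)
    have WE: "W = cech_open (snd E) [l, m, n]" by (auto simp: W_def cech_open_def V_def)
    have s: "[l, m, n] \<in> simplices (fst E) 2" using lmn by (simp add: simplices_2_iff L_def)
    have "gres N (cech_open U [\<tau> l, \<tau> m, \<tau> n]) W (c [\<tau> l, \<tau> m, \<tau> n])
      = cech_pullback N E (K, U) \<tau> 2 c [l, m, n]"
      using s by (simp add: cech_pullback_def WE)
    also have "\<dots> = x \<otimes>\<^bsub>grp N W\<^esub> (inv\<^bsub>grp N W\<^esub> y \<otimes>\<^bsub>grp N W\<^esub> z)"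
      unfolding da using N.cech_d_1[OF E a _ _ _ WE] lmn
      by (simp add: L_def[symmetric] x_def y_def z_def cech_open_def V_def)
    finally have key: "gr (\<tau> m) (\<tau> n) W \<star>\<^bsub>sect G W\<^esub> gr (\<tau> l) (\<tau> m) W =
      gr (\<tau> l) (\<tau> n) W \<star>\<^bsub>sect G W\<^esub> chi (\<tau> l) W (x \<otimes>\<^bsub>grp N W\<^esub> (inv\<^bsub>grp N W\<^esub> y \<otimes>\<^bsub>grp N W\<^esub> z))"
      using cocycle_value(2)[OF V(3)[OF lmn(1)] V(3)[OF lmn(2)] V(3)[OF lmn(3)] refl W(1)] sub
      by (simp add: cech_open_def)
    note gs = grW[OF lmn(1,2) W(1,2)] grW[OF lmn(1,3) W(1,3)] grW[OF lmn(2,3) W(1,4)]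
    note l = U[OF V(3)[OF lmn(1)]] and m = U[OF V(3)[OF lmn(2)]]
    have Xl: "chi (\<tau> l) W u \<in> homG (\<tau> l) (\<tau> l) W" and Xm: "chi (\<tau> m) W u \<in> homG (\<tau> m) (\<tau> m) W"
      if "u \<in> carrier (grp N W)" for u
      using \<chi>_hom(1)[OF l(1) W(1) sub(1) l(3) that] \<chi>_hom(1)[OF m(1) W(1) sub(2) m(3) that] by auto
    have Xmult: "chi (\<tau> l) W u \<star>\<^bsub>sect G W\<^esub> chi (\<tau> l) W v = chi (\<tau> l) W (u \<otimes>\<^bsub>grp N W\<^esub> v)"
      if "u \<in> carrier (grp N W)" "v \<in> carrier (grp N W)" for u v
      using \<chi>_mult[OF l(1) W(1) sub(1) l(3) that] by simp
    have "\<gamma> m n W \<star>\<^bsub>sect G W\<^esub> \<gamma> l m W = gr (\<tau> m) (\<tau> n) W \<star>\<^bsub>sect G W\<^esub>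
        ((chi (\<tau> m) W (inv\<^bsub>grp N W\<^esub> z) \<star>\<^bsub>sect G W\<^esub> gr (\<tau> l) (\<tau> m) W) \<star>\<^bsub>sect G W\<^esub> chi (\<tau> l) W (inv\<^bsub>grp N W\<^esub> x))"
      using gs Xl[of "inv\<^bsub>grp N W\<^esub> x"] Xm[of "inv\<^bsub>grp N W\<^esub> z"] xyz W
      by (simp add: \<gamma>_def x_def[symmetric] z_def[symmetric] G.hom_sect_iff G.gpd_simps)
    \<comment> \<open>Moving the correction \<open>z\<close> to index \<open>l\<close> brings all
      sections of \<open>N\<close> together on the right, where they multiply inside a single
      copy.\<close>
    also have "chi (\<tau> m) W (inv\<^bsub>grp N W\<^esub> z) \<star>\<^bsub>sect G W\<^esub> gr (\<tau> l) (\<tau> m) W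
        = gr (\<tau> l) (\<tau> m) W \<star>\<^bsub>sect G W\<^esub> chi (\<tau> l) W (inv\<^bsub>grp N W\<^esub> z)"
      by (rule \<chi>_commute[OF l(1) m(1) W(1) sub(1,2) l(3) m(3) gs(1), symmetric]) (use xyz in simp)
    also have "gr (\<tau> m) (\<tau> n) W \<star>\<^bsub>sect G W\<^esub> ((gr (\<tau> l) (\<tau> m) W \<star>\<^bsub>sect G W\<^esub> chi (\<tau> l) W (inv\<^bsub>grp N W\<^esub> z))
          \<star>\<^bsub>sect G W\<^esub> chi (\<tau> l) W (inv\<^bsub>grp N W\<^esub> x))
       = (gr (\<tau> m) (\<tau> n) W \<star>\<^bsub>sect G W\<^esub> gr (\<tau> l) (\<tau> m) W) \<star>\<^bsub>sect G W\<^esub>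
         (chi (\<tau> l) W (inv\<^bsub>grp N W\<^esub> z) \<star>\<^bsub>sect G W\<^esub> chi (\<tau> l) W (inv\<^bsub>grp N W\<^esub> x))"
      using gs Xl[of "inv\<^bsub>grp N W\<^esub> x"] Xl[of "inv\<^bsub>grp N W\<^esub> z"] xyz W
      by (simp add: G.hom_sect_iff G.gpd_simps)
    also have "\<dots> = gr (\<tau> l) (\<tau> n) W \<star>\<^bsub>sect G W\<^esub>
       (chi (\<tau> l) W (x \<otimes>\<^bsub>grp N W\<^esub> (inv\<^bsub>grp N W\<^esub> y \<otimes>\<^bsub>grp N W\<^esub> z)) \<star>\<^bsub>sect G W\<^esub>
         chi (\<tau> l) W (inv\<^bsub>grp N W\<^esub> z \<otimes>\<^bsub>grp N W\<^esub> inv\<^bsub>grp N W\<^esub> x))"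
      using gs Xl[of "x \<otimes>\<^bsub>grp N W\<^esub> (inv\<^bsub>grp N W\<^esub> y \<otimes>\<^bsub>grp N W\<^esub> z)"]
        Xl[of "inv\<^bsub>grp N W\<^esub> z \<otimes>\<^bsub>grp N W\<^esub> inv\<^bsub>grp N W\<^esub> x"] xyz W
      by (simp add: key Xmult G.hom_sect_iff G.gpd_simps)
    also have "\<dots> = gr (\<tau> l) (\<tau> n) W \<star>\<^bsub>sect G W\<^esub>
       chi (\<tau> l) W ((x \<otimes>\<^bsub>grp N W\<^esub> (inv\<^bsub>grp N W\<^esub> y \<otimes>\<^bsub>grp N W\<^esub> z)) \<otimes>\<^bsub>grp N W\<^esub> (inv\<^bsub>grp N W\<^esub> z \<otimes>\<^bsub>grp N W\<^esub> inv\<^bsub>grp N W\<^esub> x))"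
      using xyz by (simp add: Xmult)
    also have "(x \<otimes>\<^bsub>grp N W\<^esub> (inv\<^bsub>grp N W\<^esub> y \<otimes>\<^bsub>grp N W\<^esub> z)) \<otimes>\<^bsub>grp N W\<^esub> (inv\<^bsub>grp N W\<^esub> z \<otimes>\<^bsub>grp N W\<^esub> inv\<^bsub>grp N W\<^esub> x)
      = inv\<^bsub>grp N W\<^esub> y"
    proof -
      have "(x \<otimes>\<^bsub>grp N W\<^esub> (inv\<^bsub>grp N W\<^esub> y \<otimes>\<^bsub>grp N W\<^esub> z)) \<otimes>\<^bsub>grp N W\<^esub> (inv\<^bsub>grp N W\<^esub> z \<otimes>\<^bsub>grp N W\<^esub> inv\<^bsub>grp N W\<^esub> x)
        = (x \<otimes>\<^bsub>grp N W\<^esub> inv\<^bsub>grp N W\<^esub> x) \<otimes>\<^bsub>grp N W\<^esub> ((z \<otimes>\<^bsub>grp N W\<^esub> inv\<^bsub>grp N W\<^esub> z) \<otimes>\<^bsub>grp N W\<^esub> inv\<^bsub>grp N W\<^esub> y)"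
        using xyz by (simp only: m_ac inv_closed m_closed)
      then show ?thesis using xyz by simp
    qed
    finally show ?thesis by (simp add: \<gamma>_def y_def)
  qed
  \<comment> \<open>The objects stay over the sets \<open>U (\<tau> l)\<close> of the original
    covering while the datum lives on the refinement \<open>V\<close>.\<close>
  obtain b f where b: "b \<in> obj (sect G T)"
    and f: "\<And>l. l \<in> L \<Longrightarrow> f l \<in> hom_sect G T b (U (\<tau> l)) (i (\<tau> l)) (V l)"
    and f\<gamma>: "\<And>l m W. \<lbrakk>l \<in> L; m \<in> L; W = V l \<inter> V m\<rbrakk> \<Longrightarrow>
      hom_res G T b (U (\<tau> m)) (i (\<tau> m)) (V m) W (f m)
      = \<gamma> l m (V l \<inter> V m) \<star>\<^bsub>sect G W\<^esub> hom_res G T b (U (\<tau> l)) (i (\<tau> l)) (V l) W (f l)"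
  proof (rule G.descent[of T L V "\<lambda>l. U (\<tau> l)" "\<lambda>l. i (\<tau> l)" "\<lambda>l m. \<gamma> l m (V l \<inter> V m)"])
    show "is_open_cover X T L V" using E by (simp add: L_def V_def)
    show "hom_res G (U (\<tau> m)) (i (\<tau> m)) (U (\<tau> n)) (i (\<tau> n)) (V m \<inter> V n) W (\<gamma> m n (V m \<inter> V n)) \<star>\<^bsub>sect G W\<^esub>
        hom_res G (U (\<tau> l)) (i (\<tau> l)) (U (\<tau> m)) (i (\<tau> m)) (V l \<inter> V m) W (\<gamma> l m (V l \<inter> V m))
        = hom_res G (U (\<tau> l)) (i (\<tau> l)) (U (\<tau> n)) (i (\<tau> n)) (V l \<inter> V n) W (\<gamma> l n (V l \<inter> V n))"
      if lmn: "l \<in> L" "m \<in> L" "n \<in> L" and W_def: "W = V l \<inter> V m \<inter> V n" for l m n W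
    proof -
      have W: "openin X W" "W \<subseteq> V l \<inter> V m" "W \<subseteq> V l \<inter> V n" "W \<subseteq> V m \<inter> V n"
        using V lmn by (auto simp: W_def)
      show ?thesis using cocycle[OF that] \<gamma>_res[OF lmn(1,2) W(1,2)]
          \<gamma>_res[OF lmn(1,3) W(1,3)] \<gamma>_res[OF lmn(2,3) W(1,4)] by simp
    qed
  qed (use V VU U \<gamma>_hom in auto)
  have Fb: "mob F T b \<in> obj (sect H T)" using b by (simp add: mor_simps)
  define Ff where "Ff l = hom_map H F T b (U (\<tau> l)) (i (\<tau> l)) (V l) (f l)" for l
  define s where "s l = hr (\<tau> l) (V l) \<star>\<^bsub>sect H (V l)\<^esub> Ff l" for l
  have Ff: "Ff l \<in> hom_sect H T (mob F T b) (U (\<tau> l)) (mob F (U (\<tau> l)) (i (\<tau> l))) (V l)"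
    and hl: "hr (\<tau> l) (V l) \<in> homH (\<tau> l) (V l)" if "l \<in> L" for l
  proof -
    show "Ff l \<in> hom_sect H T (mob F T b) (U (\<tau> l)) (mob F (U (\<tau> l)) (i (\<tau> l))) (V l)"
      unfolding Ff_def by (rule hom_map_hom) (use U[OF V(3)[OF that]] V[OF that] b f[OF that] in auto)
    show "hr (\<tau> l) (V l) \<in> homH (\<tau> l) (V l)"
      by (rule hr_hom(1)) (use V[OF that] in auto)
  qed
  have s: "s l \<in> hom_sect H T (mob F T b) T j (V l)" if "l \<in> L" for l
    using Ff[OF that] hl[OF that] V(1)[OF that] by (simp add: s_def H.hom_sect_iff H.gpd_simps)
  have s_res: "hom_res H T (mob F T b) T j (V l) W (s l) = hr (\<tau> l) W \<star>\<^bsub>sect H W\<^esub>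
      hom_map H F T b (U (\<tau> l)) (i (\<tau> l)) W (hom_res G T b (U (\<tau> l)) (i (\<tau> l)) (V l) W (f l))"
    if "l \<in> L" "openin X W" "W \<subseteq> V l" for l W
    using H.hom_res_cmp[OF openT U(1)[OF V(3)[OF that(1)]] openT V(1)[OF that(1)] that(2,3)
        V(4,2,4)[OF that(1)] Fb U(4)[OF V(3)[OF that(1)]] j Ff[OF that(1)] hl[OF that(1)]]
      hom_map_res[OF openT U(1)[OF V(3)[OF that(1)]] V(1)[OF that(1)] that(2,3)
        V(4,2)[OF that(1)] b U(3)[OF V(3)[OF that(1)]] f[OF that(1)]]
      hr_hom(2)[OF V(3,1,2)[OF that(1)] that(2,3)]
    by (simp add: s_def Ff_def)
  \<comment> \<open>The correction is invisible to \<open>F\<close>, so the image of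
    \<open>\<gamma> l m\<close> is \<open>h_m^-1 h_l\<close>, here with the indices mapped by
    \<open>\<tau>\<close>. Hence
    \<open>h_m F(f_m) = h_m h_m^-1 h_l F(f_l) = h_l F(f_l)\<close>.\<close>
  have agree: "hom_res H T (mob F T b) T j (V l) (V l \<inter> V m) (s l)
      = hom_res H T (mob F T b) T j (V m) (V l \<inter> V m) (s m)" if lm: "l \<in> L" "m \<in> L" for l m
  proof -
    define W where "W = V l \<inter> V m"
    note l = U[OF V(3)[OF lm(1)]] and m = U[OF V(3)[OF lm(2)]]
    have W: "openin X W" "W \<subseteq> V l" "W \<subseteq> V m" "W \<subseteq> U (\<tau> l)" "W \<subseteq> U (\<tau> m)" "W \<subseteq> T"
      "W \<subseteq> V l \<inter> V m"
      using V[OF lm(1)] V[OF lm(2)] by (auto simp: W_def)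
    let ?fl = "hom_res G T b (U (\<tau> l)) (i (\<tau> l)) (V l) W (f l)"
    let ?fm = "hom_res G T b (U (\<tau> m)) (i (\<tau> m)) (V m) W (f m)"
    have fl: "?fl \<in> hom_sect G T b (U (\<tau> l)) (i (\<tau> l)) W"
      by (rule G.hom_res_hom[OF openT l(1) V(1)[OF lm(1)] W(1,2) V(4,2)[OF lm(1)] b l(3) f[OF lm(1)]])
    note g = grW[OF lm W(1,7)] and x = chiW[OF lm W(1,7)]
    have "hom_map H F (U (\<tau> l)) (i (\<tau> l)) (U (\<tau> m)) (i (\<tau> m)) W (\<gamma> l m W)
      = (minv (sect H W) (hr (\<tau> m) W) \<star>\<^bsub>sect H W\<^esub> hr (\<tau> l) W) \<star>\<^bsub>sect H W\<^esub>
        ident (sect H W) (rob H (U (\<tau> l)) W (mob F (U (\<tau> l)) (i (\<tau> l))))"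
      using hom_map_cmp[OF l(1) l(1) m(1) W(1,4,4,5) l(3) l(3) m(3) x g]
        gr_hom(3)[OF V(3)[OF lm(1)] V(3)[OF lm(2)] W(1,4,5)]
        \<chi>_hom(2)[OF l(1) W(1,4) l(3) aW(2)[OF lm W(1,7)]]
      by (simp add: \<gamma>_def)
    moreover have "?fm = \<gamma> l m W \<star>\<^bsub>sect G W\<^esub> ?fl"
      using f\<gamma>[OF lm W_def] by (simp add: W_def)
    ultimately have "hom_map H F T b (U (\<tau> m)) (i (\<tau> m)) W ?fm =
        ((minv (sect H W) (hr (\<tau> m) W) \<star>\<^bsub>sect H W\<^esub> hr (\<tau> l) W) \<star>\<^bsub>sect H W\<^esub>
        ident (sect H W) (rob H (U (\<tau> l)) W (mob F (U (\<tau> l)) (i (\<tau> l))))) \<star>\<^bsub>sect H W\<^esub>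
        hom_map H F T b (U (\<tau> l)) (i (\<tau> l)) W ?fl"
      using hom_map_cmp[OF openT l(1) m(1) W(1,6,4,5) b l(3) m(3) fl \<gamma>_hom[OF lm W(1,7)]] by simp
    moreover have "hom_map H F T b (U (\<tau> l)) (i (\<tau> l)) W ?fl
        \<in> hom_sect H T (mob F T b) (U (\<tau> l)) (mob F (U (\<tau> l)) (i (\<tau> l))) W"
      by (rule hom_map_hom[OF openT l(1) W(1,6,4) b l(3) fl])
    ultimately show ?thesis
      unfolding W_def[symmetric]
      using hr_hom(1)[OF V(3)[OF lm(1)] W(1,4)] hr_hom(1)[OF V(3)[OF lm(2)] W(1,5)] W(1) l(4) W(4)
      by (simp add: s_res[OF lm(1) W(1,2)] s_res[OF lm(2) W(1,3)] H.hom_sect_iff H.ps_simps)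
  qed
  have "sheaf X (hom_sect H T (mob F T b) T j) (hom_res H T (mob F T b) T j)"
    using H.hom_sheaf[OF openT Fb j] by simp
  then obtain t where t: "t \<in> hom_sect H T (mob F T b) T j T"
    using sheaf.gluing[of X "hom_sect H T (mob F T b) T j" _ T L V s] s agree E
    unfolding L_def V_def by blast
  \<comment> \<open>The glued \<open>t\<close> joins the restrictions of \<open>F(b)\<close> and
    \<open>j\<close> to the whole space; the units turn it into a morphism between the objects
    themselves.\<close>
  have "minv (sect H T) (unt H T j) \<star>\<^bsub>sect H T\<^esub> (t \<star>\<^bsub>sect H T\<^esub> unt H T (mob F T b))
      \<in> homset (sect H T) (mob F T b) j"
    using t Fb j by (simp add: H.hom_sect_iff homset_def H.ps_simps)
  then show ?thesis using b by blast
qed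

text \<open>An arbitrary refinement \<open>D\<close> is allowed because \<open>class_eq_oneI\<close>
  asks for a trivialization below each one. The lifts express every \<open>g\<close> as
  \<open>f_W' f_W^-1\<close> times a section of \<open>N\<close>; the first factors compose without
  defect, so the defect of the \<open>g\<close> is the coboundary of those sections.\<close>

lemma coboundary_of_object:
  fixes D :: "('x set, 'x) cover"
  assumes e: "e \<in> obj (sect G T)" and \<phi>: "\<phi> \<in> homset (sect H T) (mob F T e) j"
    and D: "N.cover D" and \<tau>: "refines_via D (K, U) \<tau>"
  shows "\<exists>(E :: ('x set, 'x) cover) \<rho>. N.cover E \<and> refines_via E D \<rho> \<and>
     cech_pullback N E (K, U) (\<tau> \<circ> \<rho>) 2 c \<in> cech_coboundaries N E (Suc 1)"
proof -
  define L V where "L = fst D" and "V = snd D"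
  have V: "openin X (V l)" "V l \<subseteq> U (\<tau> l)" "\<tau> l \<in> K" "V l \<subseteq> T" if "l \<in> L" for l
    using that D \<tau> by (auto simp: is_open_cover_def refines_via_def L_def V_def)
  have Fe: "mob F T e \<in> obj (sect H T)" using e by (simp add: mor_simps)
  \<comment> \<open>Sections over \<open>T\<close> join restrictions to \<open>T\<close>, so
    \<open>\<phi>\<close> is first restricted from \<open>T\<close> to itself and only then to
    \<open>W\<close>.\<close>
  define \<psi> where "\<psi> W = hom_res H T (mob F T e) T j T W (rarr H T T \<phi>)" for W
  have \<phi>T: "rarr H T T \<phi> \<in> hom_sect H T (mob F T e) T j T"
    using \<phi> by (simp add: H.hom_sect_iff homset_def H.ps_simps)
  have \<psi>: "\<psi> W \<in> hom_sect H T (mob F T e) T j W" if "openin X W" "W \<subseteq> T" for W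
    unfolding \<psi>_def by (rule H.hom_res_hom[OF openT openT openT that subset_refl subset_refl Fe j \<phi>T])
  have \<psi>_res: "hom_res H T (mob F T e) T j W W' (\<psi> W) = \<psi> W'"
    if "openin X W" "W \<subseteq> T" "openin X W'" "W' \<subseteq> W" for W W'
    unfolding \<psi>_def
    by (rule H.hom_res_res[OF openT openT openT that(1,3,4,2) subset_refl subset_refl Fe j \<phi>T])
  define t where "t k W = minv (sect H W) (hr k W) \<star>\<^bsub>sect H W\<^esub> \<psi> W" for k W
  have mh: "minv (sect H W) (hr k W) \<in> hom_sect H T j (U k) (mob F (U k) (i k)) W"
    and t: "t k W \<in> hom_sect H T (mob F T e) (U k) (mob F (U k) (i k)) W"
    if "k \<in> K" "openin X W" "W \<subseteq> U k" for k W
  proof -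
    have "W \<subseteq> T" using that U(2)[OF that(1)] by auto
    then show "minv (sect H W) (hr k W) \<in> hom_sect H T j (U k) (mob F (U k) (i k)) W"
      "t k W \<in> hom_sect H T (mob F T e) (U k) (mob F (U k) (i k)) W"
      using hr_hom(1)[OF that] \<psi>[OF that(2)] that(2)
      by (simp_all add: t_def H.hom_sect_iff H.gpd_simps)
  qed
  have t_res: "hom_res H T (mob F T e) (U k) (mob F (U k) (i k)) W W' (t k W) = t k W'"
    if "k \<in> K" "openin X W" "W \<subseteq> U k" "openin X W'" "W' \<subseteq> W" for k W W'
  proof -
    note k = U[OF that(1)]
    have W: "W \<subseteq> T" using that(3) k(2) by auto
    show ?thesis
      using H.hom_res_cmp[OF openT openT k(1) that(2,4,5) W W that(3) Fe j k(4) \<psi>[OF that(2) W] mh[OF that(1-3)]]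
        H.hom_res_minv[OF k(1) openT that(2,4,5,3) W k(4) j hr_hom(1)[OF that(1-3)]]
        hr_hom(2)[OF that] \<psi>_res[OF that(2) W that(4,5)]
      by (simp add: t_def)
  qed
  \<comment> \<open>All open sets inside a member of \<open>D\<close> on which the required lift
    exists. They index themselves, which keeps the covering within the index type of Cech classes,
    and \<open>lift_locally\<close> shows that they cover.\<close>
  define M where "M = {W. openin X W \<and> (\<exists>l f. l \<in> L \<and> W \<subseteq> V l \<and>
      f \<in> hom_sect G T e (U (\<tau> l)) (i (\<tau> l)) W \<and>
      hom_map H F T e (U (\<tau> l)) (i (\<tau> l)) W f = t (\<tau> l) W)}"
  have "\<exists>W\<in>M. x \<in> W" if x: "x \<in> T" for x
  proof -
    have "x \<in> (\<Union>l\<in>L. V l)" using x D by (simp add: is_open_cover_def L_def V_def)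
    then obtain l where l: "l \<in> L" "x \<in> V l" by blast
    obtain Z f where "openin X Z" "x \<in> Z" "Z \<subseteq> V l" "f \<in> hom_sect G T e (U (\<tau> l)) (i (\<tau> l)) Z"
      "hom_map H F T e (U (\<tau> l)) (i (\<tau> l)) Z f
        = hom_res H T (mob F T e) (U (\<tau> l)) (mob F (U (\<tau> l)) (i (\<tau> l))) (V l) Z (t (\<tau> l) (V l))"
      by (rule lift_locally[OF openT U(1)[OF V(3)[OF l(1)]] V(1,4,2)[OF l(1)] e U(3)[OF V(3)[OF l(1)]]
            t[OF V(3,1,2)[OF l(1)]] l(2)])
    then show ?thesis
      using l t_res[OF V(3,1,2)[OF l(1)]] unfolding M_def by auto
  qed
  moreover have "\<Union>M \<subseteq> T" by (auto simp: M_def dest: openin_subset)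
  ultimately have "\<Union>M = T" by blast
  then have covM: "N.cover (M, \<lambda>W. W)" by (simp add: is_open_cover_def M_def)
  obtain \<rho> f where \<rho>: "\<And>W. W \<in> M \<Longrightarrow> \<rho> W \<in> L \<and> W \<subseteq> V (\<rho> W)"
    and f: "\<And>W. W \<in> M \<Longrightarrow> f W \<in> hom_sect G T e (U (\<tau> (\<rho> W))) (i (\<tau> (\<rho> W))) W"
    and Ff: "\<And>W. W \<in> M \<Longrightarrow> hom_map H F T e (U (\<tau> (\<rho> W))) (i (\<tau> (\<rho> W))) W (f W) = t (\<tau> (\<rho> W)) W"
  proof -
    \<comment> \<open>The index \<open>l\<close> and the lift are chosen as one pair because the
      condition on the lift depends on \<open>l\<close>.\<close>
    have "\<forall>W\<in>M. \<exists>p. fst p \<in> L \<and> W \<subseteq> V (fst p) \<and>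
      snd p \<in> hom_sect G T e (U (\<tau> (fst p))) (i (\<tau> (fst p))) W \<and>
      hom_map H F T e (U (\<tau> (fst p))) (i (\<tau> (fst p))) W (snd p) = t (\<tau> (fst p)) W"
      by (simp add: M_def)
    then obtain p where "\<forall>W\<in>M. fst (p W) \<in> L \<and> W \<subseteq> V (fst (p W)) \<and>
      snd (p W) \<in> hom_sect G T e (U (\<tau> (fst (p W)))) (i (\<tau> (fst (p W)))) W \<and>
      hom_map H F T e (U (\<tau> (fst (p W)))) (i (\<tau> (fst (p W)))) W (snd (p W)) = t (\<tau> (fst (p W))) W"
      by (rule bchoice[THEN exE])
    then show ?thesis by (intro that[of "\<lambda>W. fst (p W)" "\<lambda>W. snd (p W)"]) blast+
  qed
  define \<kappa> where "\<kappa> W = \<tau> (\<rho> W)" for W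
  have M: "openin X W" "\<kappa> W \<in> K" "W \<subseteq> U (\<kappa> W)" "W \<subseteq> T" if "W \<in> M" for W
    using that \<rho>[OF that] V[of "\<rho> W"] by (auto simp: \<kappa>_def M_def)
  note f = f[folded \<kappa>_def] and Ff = Ff[folded \<kappa>_def]
  have ref: "refines_via (M, \<lambda>W. W) D \<rho>"
    using \<rho> by (simp add: refines_via_def L_def V_def)
  define fr where "fr W Z = hom_res G T e (U (\<kappa> W)) (i (\<kappa> W)) W Z (f W)" for W Z
  have fr: "fr W Z \<in> hom_sect G T e (U (\<kappa> W)) (i (\<kappa> W)) Z"
    and fr_res: "\<And>Z'. \<lbrakk>openin X Z'; Z' \<subseteq> Z\<rbrakk> \<Longrightarrow>
       hom_res G T e (U (\<kappa> W)) (i (\<kappa> W)) Z Z' (fr W Z) = fr W Z'"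
    and Ffr: "hom_map H F T e (U (\<kappa> W)) (i (\<kappa> W)) Z (fr W Z) = t (\<kappa> W) Z"
    if "W \<in> M" "openin X Z" "Z \<subseteq> W" for W Z
  proof -
    note m = M[OF that(1)] and k = U[OF M(2)[OF that(1)]]
    show "fr W Z \<in> hom_sect G T e (U (\<kappa> W)) (i (\<kappa> W)) Z"
      unfolding fr_def by (rule G.hom_res_hom[OF openT k(1) m(1) that(2,3) m(4,3) e k(3) f[OF that(1)]])
    show "hom_res G T e (U (\<kappa> W)) (i (\<kappa> W)) Z Z' (fr W Z) = fr W Z'"
      if "openin X Z'" "Z' \<subseteq> Z" for Z'
      unfolding fr_def
      by (rule G.hom_res_res[OF openT k(1) m(1) \<open>openin X Z\<close> that \<open>Z \<subseteq> W\<close> m(4,3) e k(3) f[OF \<open>W \<in> M\<close>]])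
    show "hom_map H F T e (U (\<kappa> W)) (i (\<kappa> W)) Z (fr W Z) = t (\<kappa> W) Z"
      unfolding fr_def hom_map_res[OF openT k(1) m(1) that(2,3) m(4,3) e k(3) f[OF that(1)], symmetric]
      unfolding Ff[OF that(1)] by (rule t_res[OF m(2,1,3) that(2,3)])
  qed
  \<comment> \<open>Writing \<open>k\<close> and \<open>k'\<close> for the indices of
    \<open>W\<close> and \<open>W'\<close>, the image under \<open>F\<close> is
    \<open>h_k^-1 \<psi> \<psi>^-1 h_k' h_k'^-1 h_k\<close>, an identity; so the automorphism comes
    from \<open>N\<close>.\<close>
  have "\<exists>n \<in> carrier (grp N (W \<inter> W')).
      fr W (W \<inter> W') \<star>\<^bsub>sect G (W \<inter> W')\<^esub> (minv (sect G (W \<inter> W')) (fr W' (W \<inter> W')) \<star>\<^bsub>sect G (W \<inter> W')\<^esub>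
        gr (\<kappa> W) (\<kappa> W') (W \<inter> W')) = chi (\<kappa> W) (W \<inter> W') n"
    if WW: "W \<in> M" "W' \<in> M" for W W'
  proof -
    define Z where "Z = W \<inter> W'"
    note m = M[OF WW(1)] and m' = M[OF WW(2)]
    note k = U[OF m(2)] and k' = U[OF m'(2)]
    have Z: "openin X Z" "Z \<subseteq> W" "Z \<subseteq> W'" "Z \<subseteq> U (\<kappa> W)" "Z \<subseteq> U (\<kappa> W')" "Z \<subseteq> T"
      using m m' by (auto simp: Z_def)
    note h1 = fr[OF WW(1) Z(1,2)] and h2 = fr[OF WW(2) Z(1,3)]
      and h3 = gr_hom(1)[OF m(2) m'(2) Z(1,4,5)]
    have h2': "minv (sect G Z) (fr W' Z) \<in> hom_sect G (U (\<kappa> W')) (i (\<kappa> W')) T e Z"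
      and h4: "minv (sect G Z) (fr W' Z) \<star>\<^bsub>sect G Z\<^esub> gr (\<kappa> W) (\<kappa> W') Z \<in> hom_sect G (U (\<kappa> W)) (i (\<kappa> W)) T e Z"
      and h5: "fr W Z \<star>\<^bsub>sect G Z\<^esub> (minv (sect G Z) (fr W' Z) \<star>\<^bsub>sect G Z\<^esub> gr (\<kappa> W) (\<kappa> W') Z) \<in> homG (\<kappa> W) (\<kappa> W) Z"
      using h1 h2 h3 Z(1) by (simp_all add: G.hom_sect_iff G.gpd_simps)
    have "hom_map H F (U (\<kappa> W)) (i (\<kappa> W)) (U (\<kappa> W)) (i (\<kappa> W)) Z
        (fr W Z \<star>\<^bsub>sect G Z\<^esub> (minv (sect G Z) (fr W' Z) \<star>\<^bsub>sect G Z\<^esub> gr (\<kappa> W) (\<kappa> W') Z))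
      = t (\<kappa> W) Z \<star>\<^bsub>sect H Z\<^esub> (minv (sect H Z) (t (\<kappa> W') Z) \<star>\<^bsub>sect H Z\<^esub>
         (minv (sect H Z) (hr (\<kappa> W') Z) \<star>\<^bsub>sect H Z\<^esub> hr (\<kappa> W) Z))"
      using hom_map_cmp[OF k(1) openT k(1) Z(1,4,6,4) k(3) e k(3) h4 h1]
        hom_map_cmp[OF k(1) k'(1) openT Z(1,4,5,6) k(3) k'(3) e h3 h2']
        hom_map_minv[OF openT k'(1) Z(1,6,5) e k'(3) h2]
        Ffr[OF WW(1) Z(1,2)] Ffr[OF WW(2) Z(1,3)] gr_hom(3)[OF m(2) m'(2) Z(1,4,5)]
      by simp
    also have "\<dots> = ident (sect H Z) (rob H (U (\<kappa> W)) Z (mob F (U (\<kappa> W)) (i (\<kappa> W))))"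
      using hr_hom(1)[OF m(2) Z(1,4)] hr_hom(1)[OF m'(2) Z(1,5)] \<psi>[OF Z(1,6)] Z(1)
      by (simp add: t_def H.hom_sect_iff H.gpd_simps)
    finally show ?thesis
      using \<chi>_surj[OF k(1) Z(1,4) k(3) h5] by (simp add: Z_def)
  qed
  then obtain \<beta> where \<beta>: "\<And>W W'. \<lbrakk>W \<in> M; W' \<in> M\<rbrakk> \<Longrightarrow> \<beta> W W' \<in> carrier (grp N (W \<inter> W'))"
    and q\<beta>: "\<And>W W'. \<lbrakk>W \<in> M; W' \<in> M\<rbrakk> \<Longrightarrow>
      fr W (W \<inter> W') \<star>\<^bsub>sect G (W \<inter> W')\<^esub> (minv (sect G (W \<inter> W')) (fr W' (W \<inter> W')) \<star>\<^bsub>sect G (W \<inter> W')\<^esub>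
        gr (\<kappa> W) (\<kappa> W') (W \<inter> W')) = chi (\<kappa> W) (W \<inter> W') (\<beta> W W')"
    by metis
  \<comment> \<open>The relation defining \<open>\<beta>\<close>, restricted to \<open>Z\<close> and
    solved for the transition morphism.\<close>
  have gr\<beta>: "gr (\<kappa> W) (\<kappa> W') Z = fr W' Z \<star>\<^bsub>sect G Z\<^esub> (minv (sect G Z) (fr W Z) \<star>\<^bsub>sect G Z\<^esub>
      chi (\<kappa> W) Z (gres N (W \<inter> W') Z (\<beta> W W')))"
    if WW: "W \<in> M" "W' \<in> M" and Z: "openin X Z" "Z \<subseteq> W \<inter> W'" for W W' Z
  proof -
    define Y where "Y = W \<inter> W'"
    note m = M[OF WW(1)] and m' = M[OF WW(2)]
    note k = U[OF m(2)] and k' = U[OF m'(2)]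
    have Y: "openin X Y" "Y \<subseteq> W" "Y \<subseteq> W'" "Y \<subseteq> U (\<kappa> W)" "Y \<subseteq> U (\<kappa> W')" "Y \<subseteq> T"
      using m m' by (auto simp: Y_def)
    have ZY: "Z \<subseteq> Y" using Z by (simp add: Y_def)
    note h1 = fr[OF WW(1) Y(1,2)] and h2 = fr[OF WW(2) Y(1,3)]
      and h3 = gr_hom(1)[OF m(2) m'(2) Y(1,4,5)]
    have h2': "minv (sect G Y) (fr W' Y) \<in> hom_sect G (U (\<kappa> W')) (i (\<kappa> W')) T e Y"
      and h4: "minv (sect G Y) (fr W' Y) \<star>\<^bsub>sect G Y\<^esub> gr (\<kappa> W) (\<kappa> W') Y \<in> hom_sect G (U (\<kappa> W)) (i (\<kappa> W)) T e Y"
      using h1 h2 h3 Y(1) by (simp_all add: G.hom_sect_iff G.gpd_simps)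
    have "hom_res G (U (\<kappa> W)) (i (\<kappa> W)) (U (\<kappa> W)) (i (\<kappa> W)) Y Z
        (fr W Y \<star>\<^bsub>sect G Y\<^esub> (minv (sect G Y) (fr W' Y) \<star>\<^bsub>sect G Y\<^esub> gr (\<kappa> W) (\<kappa> W') Y))
      = fr W Z \<star>\<^bsub>sect G Z\<^esub> (minv (sect G Z) (fr W' Z) \<star>\<^bsub>sect G Z\<^esub> gr (\<kappa> W) (\<kappa> W') Z)"
      using G.hom_res_cmp[OF k(1) openT k(1) Y(1) Z(1) ZY Y(4,6,4) k(3) e k(3) h4 h1]
        G.hom_res_cmp[OF k(1) k'(1) openT Y(1) Z(1) ZY Y(4,5,6) k(3) k'(3) e h3 h2']
        G.hom_res_minv[OF openT k'(1) Y(1) Z(1) ZY Y(6,5) e k'(3) h2]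
        fr_res[OF WW(1) Y(1,2) Z(1) ZY] fr_res[OF WW(2) Y(1,3) Z(1) ZY]
        gr_hom(2)[OF m(2) m'(2) Y(1,4,5) Z(1) ZY]
      by simp
    moreover have "hom_res G (U (\<kappa> W)) (i (\<kappa> W)) (U (\<kappa> W)) (i (\<kappa> W)) Y Z (chi (\<kappa> W) Y (\<beta> W W'))
      = chi (\<kappa> W) Z (gres N Y Z (\<beta> W W'))"
      by (rule \<chi>_res[OF k(1) Y(1) Z(1) Y(4) ZY k(3)]) (use \<beta>[OF WW] in \<open>simp add: Y_def\<close>)
    ultimately have "chi (\<kappa> W) Z (gres N (W \<inter> W') Z (\<beta> W W'))
      = fr W Z \<star>\<^bsub>sect G Z\<^esub> (minv (sect G Z) (fr W' Z) \<star>\<^bsub>sect G Z\<^esub> gr (\<kappa> W) (\<kappa> W') Z)"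
      using q\<beta>[OF WW] by (simp add: Y_def)
    moreover have "fr W Z \<in> hom_sect G T e (U (\<kappa> W)) (i (\<kappa> W)) Z"
      "fr W' Z \<in> hom_sect G T e (U (\<kappa> W')) (i (\<kappa> W')) Z"
      "gr (\<kappa> W) (\<kappa> W') Z \<in> homG (\<kappa> W) (\<kappa> W') Z"
      using fr[OF WW(1) Z(1)] fr[OF WW(2) Z(1)] gr_hom(1)[OF m(2) m'(2) Z(1)] ZY Y by auto
    ultimately show ?thesis using Z(1) by (simp add: G.hom_sect_iff G.gpd_simps)
  qed
  let ?E = "(M, \<lambda>W. W) :: ('x set, 'x) cover"
  define b where "b = (\<lambda>ks\<in>simplices M 1. \<beta> (ks ! 0) (ks ! 1))"
  have b: "b \<in> carrier (cech_cochains N ?E 1)"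
  proof -
    have "b \<in> (\<Pi>\<^sub>E ks\<in>simplices M 1. carrier (grp N (cech_open (\<lambda>W. W) ks)))"
    proof (rule PiE_I)
      fix ks assume ks: "ks \<in> simplices M 1"
      then obtain W W' where "ks = [W, W']" "W \<in> M" "W' \<in> M" unfolding simplices_1_iff by blast
      then show "b ks \<in> carrier (grp N (cech_open (\<lambda>W. W) ks))"
        using \<beta>[of W W'] ks by (simp add: b_def cech_open_def)
    qed (simp add: b_def)
    then show ?thesis by (simp add: cech_cochains_def)
  qed
  have "cech_pullback N ?E (K, U) (\<tau> \<circ> \<rho>) 2 c ks = cech_d N ?E 1 b ks" for ks
  proof (cases "ks \<in> simplices M 2")
    case True
    then obtain l m n where ks: "ks = [l, m, n]" and lmn: "l \<in> M" "m \<in> M" "n \<in> M"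
      unfolding simplices_2_iff by blast
    define W where "W = cech_open (\<lambda>W. W) [l, m, n]"
    have W: "openin X W" "W \<subseteq> l \<inter> m" "W \<subseteq> l \<inter> n" "W \<subseteq> m \<inter> n" "W \<subseteq> l" "W \<subseteq> m" "W \<subseteq> n"
      using M(1)[OF lmn(1)] M(1)[OF lmn(2)] M(1)[OF lmn(3)] by (auto simp: W_def cech_open_def)
    have sub: "W \<subseteq> U (\<kappa> l)" "W \<subseteq> U (\<kappa> m)" "W \<subseteq> U (\<kappa> n)"
      using W M(3)[OF lmn(1)] M(3)[OF lmn(2)] M(3)[OF lmn(3)] by auto
    note kl = U[OF M(2)[OF lmn(1)]] and km = U[OF M(2)[OF lmn(2)]]
    interpret comm_group "grp N W" by (rule N.comm_groups[OF W(1)])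
    define x y z where "x = gres N (l \<inter> m) W (\<beta> l m)"
      and "y = gres N (l \<inter> n) W (\<beta> l n)" and "z = gres N (m \<inter> n) W (\<beta> m n)"
    have xyz: "x \<in> carrier (grp N W)" "y \<in> carrier (grp N W)" "z \<in> carrier (grp N W)"
      unfolding x_def y_def z_def
      by (rule N.gres_simps(1); use M(1) lmn W \<beta> in \<open>simp add: openin_Int\<close>)+
    define w where "w = gres N (cech_open U [\<kappa> l, \<kappa> m, \<kappa> n]) W (c [\<kappa> l, \<kappa> m, \<kappa> n])"
    have Wc: "W \<subseteq> cech_open U [\<kappa> l, \<kappa> m, \<kappa> n]" using sub by (simp add: cech_open_def)
    have oc: "openin X (cech_open U [\<kappa> l, \<kappa> m, \<kappa> n])"
      using N.openin_cech_open[OF cover_U, of "[\<kappa> l, \<kappa> m, \<kappa> n]" 2] M(2) lmn by (auto simp: simplices_2_iff)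
    have w: "w \<in> carrier (grp N W)"
      unfolding w_def
      by (rule N.gres_simps(1)[OF oc W(1) Wc cocycle_value(1)[OF M(2)[OF lmn(1)] M(2)[OF lmn(2)] M(2)[OF lmn(3)] refl]])
    have key: "gr (\<kappa> m) (\<kappa> n) W \<star>\<^bsub>sect G W\<^esub> gr (\<kappa> l) (\<kappa> m) W
      = gr (\<kappa> l) (\<kappa> n) W \<star>\<^bsub>sect G W\<^esub> chi (\<kappa> l) W w"
      unfolding w_def
      by (rule cocycle_value(2)[OF M(2)[OF lmn(1)] M(2)[OF lmn(2)] M(2)[OF lmn(3)] refl W(1) Wc])
    note fs = fr[OF lmn(1) W(1,5)] fr[OF lmn(2) W(1,6)] fr[OF lmn(3) W(1,7)]
    have Xl: "chi (\<kappa> l) W u \<in> homG (\<kappa> l) (\<kappa> l) W" and Xm: "chi (\<kappa> m) W u \<in> homG (\<kappa> m) (\<kappa> m) W"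
      if "u \<in> carrier (grp N W)" for u
      using \<chi>_hom(1)[OF kl(1) W(1) sub(1) kl(3) that] \<chi>_hom(1)[OF km(1) W(1) sub(2) km(3) that] by auto
    \<comment> \<open>\<open>p\<close> and \<open>r\<close> are the defect-free parts of
      \<open>g_lm\<close> and \<open>g_ln\<close>. Once \<open>z\<close> has passed through
      \<open>p\<close>, the product \<open>g_mn g_lm\<close> equals \<open>r\<close> times
      \<open>z x\<close>, while \<open>g_ln c\<close> equals \<open>r\<close> times
      \<open>y w\<close>; cancelling \<open>r\<close> compares the two inside
      \<open>N\<close>.\<close>
    define p where "p = fr m W \<star>\<^bsub>sect G W\<^esub> minv (sect G W) (fr l W)"
    have p: "p \<in> homG (\<kappa> l) (\<kappa> m) W" using fs W(1) by (simp add: p_def G.hom_sect_iff G.gpd_simps)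
    have comm: "chi (\<kappa> m) W z \<star>\<^bsub>sect G W\<^esub> p = p \<star>\<^bsub>sect G W\<^esub> chi (\<kappa> l) W z"
      by (rule \<chi>_commute[OF kl(1) km(1) W(1) sub(1,2) kl(3) km(3) p xyz(3), symmetric])
    define r where "r = fr n W \<star>\<^bsub>sect G W\<^esub> minv (sect G W) (fr l W)"
    have r: "r \<in> homG (\<kappa> l) (\<kappa> n) W" using fs W(1) by (simp add: r_def G.hom_sect_iff G.gpd_simps)
    have "gr (\<kappa> m) (\<kappa> n) W \<star>\<^bsub>sect G W\<^esub> gr (\<kappa> l) (\<kappa> m) W
      = fr n W \<star>\<^bsub>sect G W\<^esub> minv (sect G W) (fr m W) \<star>\<^bsub>sect G W\<^esub> (chi (\<kappa> m) W z \<star>\<^bsub>sect G W\<^esub> p) \<star>\<^bsub>sect G W\<^esub> chi (\<kappa> l) W x"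
      using fs Xl[OF xyz(1)] Xm[OF xyz(3)] W(1)
      by (simp add: gr\<beta>[OF lmn(1,2) W(1,2)] gr\<beta>[OF lmn(2,3) W(1,4)] x_def[symmetric] z_def[symmetric] p_def
          G.hom_sect_iff G.gpd_simps)
    also have "\<dots> = r \<star>\<^bsub>sect G W\<^esub> (chi (\<kappa> l) W z \<star>\<^bsub>sect G W\<^esub> chi (\<kappa> l) W x)"
      unfolding comm using fs Xl[OF xyz(1)] Xl[OF xyz(3)] W(1)
      by (simp add: p_def r_def G.hom_sect_iff G.gpd_simps)
    finally have "r \<star>\<^bsub>sect G W\<^esub> (chi (\<kappa> l) W z \<star>\<^bsub>sect G W\<^esub> chi (\<kappa> l) W x)
      = r \<star>\<^bsub>sect G W\<^esub> (chi (\<kappa> l) W y \<star>\<^bsub>sect G W\<^esub> chi (\<kappa> l) W w)"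
      unfolding key using fs Xl[OF xyz(2)] Xl[OF w] W(1)
      by (simp add: gr\<beta>[OF lmn(1,3) W(1,3)] y_def[symmetric] r_def G.hom_sect_iff G.gpd_simps)
    then have "chi (\<kappa> l) W z \<star>\<^bsub>sect G W\<^esub> chi (\<kappa> l) W x = chi (\<kappa> l) W y \<star>\<^bsub>sect G W\<^esub> chi (\<kappa> l) W w"
      by (rule groupoid.left_cancel[OF G.sect_groupoid[OF W(1)], rotated -1])
        (use r Xl[OF xyz(1)] Xl[OF xyz(2)] Xl[OF xyz(3)] Xl[OF w] W(1) in
          \<open>simp_all add: G.hom_sect_iff G.gpd_simps\<close>)
    then have "chi (\<kappa> l) W (z \<otimes>\<^bsub>grp N W\<^esub> x) = chi (\<kappa> l) W (y \<otimes>\<^bsub>grp N W\<^esub> w)"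
      using \<chi>_mult[OF kl(1) W(1) sub(1) kl(3)] xyz w by simp
    then have zx: "z \<otimes>\<^bsub>grp N W\<^esub> x = y \<otimes>\<^bsub>grp N W\<^esub> w"
      using inj_onD[OF \<chi>_inj[OF kl(1) W(1) sub(1) kl(3)]] xyz w by blast
    have "cech_d N ?E 1 b ks = x \<otimes>\<^bsub>grp N W\<^esub> (inv\<^bsub>grp N W\<^esub> y \<otimes>\<^bsub>grp N W\<^esub> z)"
      unfolding ks using N.cech_d_1[OF covM b, of l m n W] lmn
      by (simp add: W_def b_def simplices_1_iff[unfolded One_nat_def] cech_open_def x_def y_def z_def)
    also have "\<dots> = inv\<^bsub>grp N W\<^esub> y \<otimes>\<^bsub>grp N W\<^esub> (z \<otimes>\<^bsub>grp N W\<^esub> x)"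
      using xyz by (simp add: m_ac)
    also have "\<dots> = w" using xyz w by (simp add: zx m_assoc[symmetric])
    finally show ?thesis
      using True ks by (simp add: cech_pullback_def w_def W_def \<kappa>_def)
  next
    \<comment> \<open>Off the simplices both families take the default value of
      \<open>restrict\<close>; unfolding \<open>2\<close> to \<open>Suc 1\<close> makes the two
      index sets coincide.\<close>
    case False
    then show ?thesis by (simp add: cech_pullback_def N.cech_d_eq Suc_1[symmetric] del: Suc_1)
  qed
  then have "cech_pullback N ?E (K, U) (\<tau> \<circ> \<rho>) 2 c = cech_d N ?E 1 b" by blast
  then have "cech_pullback N ?E (K, U) (\<tau> \<circ> \<rho>) 2 c \<in> cech_coboundaries N ?E (Suc 1)"
    using b by simp
  then show ?thesis using covM ref by blast
qed

lemma class_eq_one_iff: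
  "cech_class X N 2 (K, U) c = \<one>\<^bsub>cech_cohomology X N 2\<^esub> \<longleftrightarrow>
    (\<exists>b \<in> obj (sect G T). homset (sect H T) (mob F T b) j \<noteq> {})"
proof
  assume "cech_class X N 2 (K, U) c = \<one>\<^bsub>cech_cohomology X N 2\<^esub>"
  then obtain E :: "('x set, 'x) cover" and \<tau> where E: "N.cover E" "refines_via E (K, U) \<tau>"
    "cech_pullback N E (K, U) \<tau> (Suc 1) c \<in> cech_coboundaries N E (Suc 1)"
    using N.class_eq_oneD[where p = 1 and C = "(K, U)" and c = c] unfolding Suc_1 by blast
  then show "\<exists>b \<in> obj (sect G T). homset (sect H T) (mob F T b) j \<noteq> {}"
    by (intro object_of_coboundary[of E \<tau>]) (simp_all only: Suc_1)
next
  assume "\<exists>b \<in> obj (sect G T). homset (sect H T) (mob F T b) j \<noteq> {}"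
  then obtain e \<phi> where e: "e \<in> obj (sect G T)" "\<phi> \<in> homset (sect H T) (mob F T e) j" by blast
  \<comment> \<open>The object \<open>e\<close> serves every refinement, so
    \<open>coboundary_of_object\<close> discharges the quantified premise of
    \<open>class_eq_oneI\<close>.\<close>
  have "cech_class X N (Suc 1) (K, U) c = \<one>\<^bsub>cech_cohomology X N (Suc 1)\<^esub>"
    using cocycle_in_pairs coboundary_of_object[OF e] unfolding Suc_1
    by (intro N.class_eq_oneI[where p = 1, unfolded Suc_1])
  then show "cech_class X N 2 (K, U) c = \<one>\<^bsub>cech_cohomology X N 2\<^esub>" by (simp only: Suc_1)
qed

end

theorem theorem4p17:
  fixes X :: "'x topology" and N :: "('x, 'n) group_presheaf"
    and G :: "('x, 'o, 'm) prestack" and H :: "('x, 'p, 'q) prestack"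
    and F :: "('x, 'o, 'm, 'p, 'q) prestack_mor"
    and \<chi> :: "'x set \<Rightarrow> 'o \<Rightarrow> 'x set \<Rightarrow> 'n \<Rightarrow> 'm" and j :: 'p
  assumes "central_extension X N G H F \<chi>"
    and "j \<in> obj (sect H (topspace X))"
    and "cl2_defined X G H F j"
  shows "(\<exists>i \<in> obj (sect G (topspace X)). homset (sect H (topspace X)) (mob F (topspace X) i) j \<noteq> {})
    \<longleftrightarrow> cl2 X N G H F \<chi> j = \<one>\<^bsub>cech_cohomology X N 2\<^esub>"
proof -
  have "\<exists>a (K :: 'x set set) U i h g. obs_choice X G H F j K U i h g \<and>
        a = cech_class X N 2 (K, U) (obs_cocycle N G \<chi> K U i g)"
    using assms(3) unfolding cl2_defined_def by blast
  \<comment> \<open>\<open>cl2_defined\<close> provides a candidate for the \<open>SOME\<close> in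
    \<open>cl2\<close>, so the selected class comes from an actual choice, for which
    \<open>obstruction\<close> can be interpreted.\<close>
  then have "\<exists>(K :: 'x set set) U i h g. obs_choice X G H F j K U i h g \<and>
        cl2 X N G H F \<chi> j = cech_class X N 2 (K, U) (obs_cocycle N G \<chi> K U i g)"
    unfolding cl2_def by (rule someI_ex)
  then obtain K :: "'x set set" and U i h g where choice: "obs_choice X G H F j K U i h g"
    and cl2: "cl2 X N G H F \<chi> j = cech_class X N 2 (K, U) (obs_cocycle N G \<chi> K U i g)"
    by blast
  interpret obstruction X N G H F \<chi> j K U i h g
    by (intro obstruction.intro obstruction_axioms.intro assms(1,2) choice)
  show ?thesis unfolding cl2 class_eq_one_iff ..
qed

end
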